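(* Let $G$ be a finitely generated group with infinitely many ends that has no non-trivial finite normal subgroups. Then the action of $G$ by conjugation on the space $\mathrm{Sub}_\infty(G)$ is topologically $\mu$-mixing for every probability measure $\mu\in\mathrm{Prob}(G)$ whose support is finite, symmetric and generates $G$.
   Context: $\mathrm{Sub}(G)$ is the set of subgroups of $G$ with the topology induced from the product topology on $2^G$, and $\mathrm{Sub}_\infty(G)=\{H\le G\mid |G:H|=\infty\}$ with the subspace topology; $G$ acts by $H\mapsto gHg^{-1}$. $\mathrm{Prob}(G)$ is the set of countably additive probability measures on $G$; the support of $\mu$ is $\{g\mid\mu(g)>0\}$; $A\subseteq G$ is symmetric if $A^{-1}=A$; $\mu^{*n}$ is the $n$-fold convolution. An action of $G$ on a topological space $X$ is topologically $\mu$-mixing if $\lim_{n\to\infty}\mu^{*n}(\{g\in G\mid g(U)\cap V\ne\emptyset\})=1$ for all non-empty open $U,V\subseteq X$. *)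

theory Defs
  imports
    "HOL-Algebra.Group_Action"
    "HOL-Algebra.Generated_Groups"
    "HOL-Analysis.Analysis"
    "HOL-Probability.Probability_Mass_Function"
begin

section \<open>Ends of finitely generated groups\<close>

definition finitely_generated :: "('a, 'b) monoid_scheme \<Rightarrow> bool" where
  "finitely_generated G \<longleftrightarrow>
     (\<exists>S. finite S \<and> S \<subseteq> carrier G \<and> generate G S = carrier G)"

text \<open>The Cayley graph, as an undirected graph: its edge relation is symmetric.\<close>

definition cayley_edges :: "('a, 'b) monoid_scheme \<Rightarrow> 'a set \<Rightarrow> ('a \<times> 'a) set" where
  "cayley_edges G S =
     {(g, h). g \<in> carrier G \<and> h \<in> carrier G \<and>
              (\<exists>s\<in>S. h = g \<otimes>\<^bsub>G\<^esub> s \<or> g = h \<otimes>\<^bsub>G\<^esub> s)}"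

definition components_off :: "'a set \<Rightarrow> ('a \<times> 'a) set \<Rightarrow> 'a set \<Rightarrow> 'a set set" where
  "components_off V E K = (V - K) // (Restr E (V - K))\<^sup>*"

text \<open>The set of ends of a connected, locally finite graph with vertex set \<open>V\<close> and symmetric
  edge relation \<open>E\<close>: the inverse limit, over the finite vertex sets \<open>K\<close> ordered by inclusion, of
  the sets of infinite connected components of the graph with \<open>K\<close> deleted.\<close>

definition ends :: "'a set \<Rightarrow> ('a \<times> 'a) set \<Rightarrow> ('a set \<Rightarrow> 'a set) set" where
  "ends V E =
     {e \<in> (\<Pi>\<^sub>E K \<in> {K. finite K \<and> K \<subseteq> V}. {C \<in> components_off V E K. infinite C}).
        \<forall>K L. finite L \<and> L \<subseteq> V \<and> K \<subseteq> L \<longrightarrow> e L \<subseteq> e K}"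

text \<open>The space of ends of the Cayley graph with respect to a finite generating set does not
  depend on the generating set (up to homeomorphism), so asking for some finite generating set
  with infinitely many ends is the same as asking it for all of them.\<close>

definition infinitely_many_ends :: "('a, 'b) monoid_scheme \<Rightarrow> bool" where
  "infinitely_many_ends G \<longleftrightarrow>
     (\<exists>S. finite S \<and> S \<subseteq> carrier G \<and> generate G S = carrier G \<and>
          infinite (ends (carrier G) (cayley_edges G S)))"


section \<open>The space of subgroups\<close>

text \<open>A subgroup is identified with its indicator function in
  the product of copies of the two-point discrete space.\<close>

definition Sub :: "('a, 'b) monoid_scheme \<Rightarrow> 'a set topology" where
  "Sub G = pullback_topology {H. subgroup H G} (\<lambda>H. \<lambda>g\<in>carrier G. g \<in> H)
             (product_topology (\<lambda>_. discrete_topology (UNIV :: bool set)) (carrier G))"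

definition Sub_inf :: "('a, 'b) monoid_scheme \<Rightarrow> 'a set topology" where
  "Sub_inf G = subtopology (Sub G) {H. subgroup H G \<and> infinite (rcosets\<^bsub>G\<^esub> H)}"

definition conj_subgroup :: "('a, 'b) monoid_scheme \<Rightarrow> 'a \<Rightarrow> 'a set \<Rightarrow> 'a set" where
  "conj_subgroup G g H = g <#\<^bsub>G\<^esub> (H #>\<^bsub>G\<^esub> inv\<^bsub>G\<^esub> g)"


section \<open>Probability measures on a group and mixing\<close>

text \<open>\<open>G\<close> carries the \<open>\<sigma>\<close>-algebra of all its subsets. On a countable group, the countably
  additive probability measures are exactly the probability mass functions on \<open>carrier G\<close>;
  \<open>set_pmf \<mu>\<close> is the support of \<open>\<mu>\<close>.\<close>

definition Prob :: "('a, 'b) monoid_scheme \<Rightarrow> 'a pmf set" where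
  "Prob G = {\<mu>. set_pmf \<mu> \<subseteq> carrier G}"

definition convolve :: "('a, 'b) monoid_scheme \<Rightarrow> 'a pmf \<Rightarrow> 'a pmf \<Rightarrow> 'a pmf" where
  "convolve G \<mu> \<nu> = map_pmf (\<lambda>(g, h). g \<otimes>\<^bsub>G\<^esub> h) (pair_pmf \<mu> \<nu>)"

primrec conv_pow :: "('a, 'b) monoid_scheme \<Rightarrow> 'a pmf \<Rightarrow> nat \<Rightarrow> 'a pmf" where
  "conv_pow G \<mu> 0 = return_pmf \<one>\<^bsub>G\<^esub>"
| "conv_pow G \<mu> (Suc n) = convolve G (conv_pow G \<mu> n) \<mu>"

definition topologically_mixing ::
  "('a, 'b) monoid_scheme \<Rightarrow> 'a pmf \<Rightarrow> ('a \<Rightarrow> 'x \<Rightarrow> 'x) \<Rightarrow> 'x topology \<Rightarrow> bool" where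
  "topologically_mixing G \<mu> \<phi> X \<longleftrightarrow>
     (\<forall>U V. openin X U \<and> openin X V \<and> U \<noteq> {} \<and> V \<noteq> {} \<longrightarrow>
        (\<lambda>n. measure_pmf.prob (conv_pow G \<mu> n) {g \<in> carrier G. \<phi> g ` U \<inter> V \<noteq> {}})
          \<longlonglongrightarrow> 1)"

end

theory Submission
  imports Defs
begin

text \<open>A basic open subset of \<open>Sub_inf G\<close> prescribes a subgroup on a finite set \<open>F\<close>, and on \<open>F\<close> a subgroup
  of infinite index agrees with a finitely generated subgroup of infinite index. So the theorem asks,
  for finitely generated \<open>H1\<close> and \<open>H2\<close> of infinite index and for \<open>g\<close> outside a set of small
  \<open>\<mu>\<^sup>*\<^sup>n\<close>-measure, for a subgroup \<open>H\<close> of infinite index that agrees with \<open>H1\<close> on \<open>F\<close> while \<open>g H g\<inverse>\<close>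
  agrees with \<open>H2\<close> on \<open>F\<close>. With \<open>\<gamma> = g\<inverse>\<close>, such an \<open>H\<close> is generated by \<open>H1\<close> and \<open>\<gamma> H2 \<gamma>\<inverse>\<close>.

  The geometry takes place in a Cayley graph. As there are infinitely many ends, some finite connected
  \<open>K\<close> leaves at least four infinite components; call \<open>g D\<close>, for such a component \<open>D\<close>, a half-space.
  Suppose that a translate \<open>x K\<close> misses a connected \<open>H1\<close>-invariant neighbourhood \<open>N1\<close> of \<open>H1\<close>, and
  that it is disjoint from its translates by the non-trivial elements of \<open>H1\<close>. Then these elements
  move everything outside the component \<open>core x\<close> of \<open>N1\<close> into \<open>core x\<close> (\<open>separates_moved\<close>). If \<open>\<gamma>\<close> is
  outside \<open>core x\<close>, if a cut \<open>y K\<close> does the same for \<open>H2\<close> and \<open>\<gamma>\<inverse>\<close>, and if \<open>\<gamma>\<close> is far away compared with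
  \<open>x\<close> and \<open>y\<close>, then the complements of \<open>core x\<close> and of \<open>\<gamma> (core y)\<close> cover \<open>G\<close>, and the ping-pong lemma
  shows that \<open>H\<close> has the required properties (\<open>joint_subgroup_properties\<close>).

  It remains to see that a long random walk ends outside \<open>core x\<close> for some \<open>x\<close> from a fixed finite
  set. Cuts that separate \<open>H1\<close> exist within a bounded distance of every point
  (\<open>separating_cuts_nearby\<close>), so the set of bad endpoints avoids a half-space near every point. The
  complement of a half-space has arbitrarily many pairwise disjoint translates
  (\<open>spread_compl_component\<close>). So near every starting point there are \<open>k\<close> points from which
  the walks that end in the bad set follow disjoint sets of displacements. The probabilities to end
  in the bad set from these \<open>k\<close> points add up to at most \<open>1\<close>, and averaging over the first steps of the
  walk makes the largest such probability contract towards \<open>1/k\<close> (\<open>walk_escapes\<close>).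

  Two facts about \<open>G\<close> enter. The disjoint translates exist because no component of the complement of
  \<open>K\<close> is distinguished from the others by the way in which translates of \<open>K\<close> are nested
  (\<open>not_star\<close>). The separating cuts exist because the elements with finitely many conjugates
  form a finite normal subgroup, which is trivial by hypothesis (\<open>fc_center_trivial\<close>).\<close>

no_notation subset_mset (infix "<#" 50)

section \<open>Connected sets and components in the Cayley graph\<close>

context group
begin

lemma mult_inv_cancel:
  assumes "g \<in> carrier G" "x \<in> carrier G"
  shows "g \<otimes> (inv g \<otimes> x) = x" "inv g \<otimes> (g \<otimes> x) = x"
  using assms by (simp_all add: m_assoc[symmetric])

lemma mem_l_coset_iff:
  assumes "A \<subseteq> carrier G" "g \<in> carrier G"
  shows "x \<in> g <# A \<longleftrightarrow> x \<in> carrier G \<and> inv g \<otimes> x \<in> A"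
proof
  assume "x \<in> g <# A"
  then obtain a where "a \<in> A" "x = g \<otimes> a" by (auto simp: l_coset_def)
  then show "x \<in> carrier G \<and> inv g \<otimes> x \<in> A" using assms
    by (auto simp: m_assoc[symmetric])
next
  assume *: "x \<in> carrier G \<and> inv g \<otimes> x \<in> A"
  then have "x = g \<otimes> (inv g \<otimes> x)" using assms by (simp add: m_assoc[symmetric])
  then show "x \<in> g <# A" using * by (auto simp: l_coset_def)
qed

lemma l_coset_inv_cancel:
  assumes "A \<subseteq> carrier G" "g \<in> carrier G"
  shows "inv g <# (g <# A) = A" "g <# (inv g <# A) = A"
  using assms by (auto simp: lcos_m_assoc lcos_mult_one)

lemma l_coset_memI: "a \<in> A \<Longrightarrow> g \<otimes> a \<in> g <# A"
  by (auto simp: l_coset_def)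

lemma l_coset_mono: "A \<subseteq> B \<Longrightarrow> g <# A \<subseteq> g <# B"
  by (auto simp: l_coset_def)

lemma l_coset_eq_image: "g <# A = (\<lambda>x. g \<otimes> x) ` A"
  by (auto simp: l_coset_def)

lemma finite_l_coset: "finite A \<Longrightarrow> finite (g <# A)"
  by (simp add: l_coset_eq_image)

lemma l_coset_Int:
  assumes "A \<subseteq> carrier G" "B \<subseteq> carrier G" "g \<in> carrier G"
  shows "(g <# A) \<inter> (g <# B) = g <# (A \<inter> B)"
proof -
  have "A \<inter> B \<subseteq> carrier G" using assms by auto
  then show ?thesis using assms by (auto simp: mem_l_coset_iff)
qed

lemma l_coset_empty_iff [simp]: "g <# A = {} \<longleftrightarrow> A = {}"
  by (simp add: l_coset_eq_image)

lemma l_coset_disjoint_iff: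
  assumes "A \<subseteq> carrier G" "B \<subseteq> carrier G" "g \<in> carrier G"
  shows "(g <# A) \<inter> (g <# B) = {} \<longleftrightarrow> A \<inter> B = {}"
  by (simp add: l_coset_Int[OF assms])

lemma l_coset_disjoint_move:
  assumes "A \<subseteq> carrier G" "B \<subseteq> carrier G" "g \<in> carrier G"
  shows "(g <# A) \<inter> B = {} \<longleftrightarrow> A \<inter> (inv g <# B) = {}"
proof -
  have "(g <# A) \<inter> (g <# (inv g <# B)) = {} \<longleftrightarrow> A \<inter> (inv g <# B) = {}"
    using assms by (intro l_coset_disjoint_iff) (simp_all add: l_coset_subset_G)
  then show ?thesis using assms by (simp add: l_coset_inv_cancel)
qed

lemma l_coset_subset_iff:
  assumes "A \<subseteq> carrier G" "B \<subseteq> carrier G" "g \<in> carrier G"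
  shows "g <# A \<subseteq> g <# B \<longleftrightarrow> A \<subseteq> B"
  using assms l_coset_mono[of A B g] l_coset_mono[of "g <# A" "g <# B" "inv g"]
  by (auto simp: l_coset_inv_cancel)

lemma l_coset_subset_move:
  assumes "A \<subseteq> carrier G" "B \<subseteq> carrier G" "g \<in> carrier G"
  shows "g <# A \<subseteq> B \<longleftrightarrow> A \<subseteq> inv g <# B"
proof -
  have "g <# A \<subseteq> g <# (inv g <# B) \<longleftrightarrow> A \<subseteq> inv g <# B"
    using assms by (intro l_coset_subset_iff) (simp_all add: l_coset_subset_G)
  then show ?thesis using assms by (simp add: l_coset_inv_cancel)
qed

lemma l_coset_Diff:
  assumes "A \<subseteq> carrier G" "g \<in> carrier G"
  shows "g <# (carrier G - A) = carrier G - (g <# A)"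
  using assms by (auto simp: mem_l_coset_iff)

lemma finite_translates_meeting:
  assumes "finite A" "finite B" "A \<subseteq> carrier G" "B \<subseteq> carrier G"
  shows "finite {g \<in> carrier G. (g <# A) \<inter> B \<noteq> {}}"
proof (rule finite_subset)
  show "{g \<in> carrier G. (g <# A) \<inter> B \<noteq> {}} \<subseteq> (\<lambda>(b, a). b \<otimes> inv a) ` (B \<times> A)"
  proof clarify
    fix g assume g: "g \<in> carrier G" "(g <# A) \<inter> B \<noteq> {}"
    then obtain a b where "a \<in> A" "b \<in> B" "b = g \<otimes> a" by (auto simp: l_coset_def)
    moreover have "g = b \<otimes> inv a" using calculation g assms by (auto simp: m_assoc subset_eq)
    ultimately show "g \<in> (\<lambda>(b, a). b \<otimes> inv a) ` (B \<times> A)" by force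
  qed
qed (use assms in auto)

end

locale cayley_graph = group G for G (structure) +
  fixes S
  assumes S_fin: "finite S" and S_carrier: "S \<subseteq> carrier G"
    and S_gen: "generate G S = carrier G"
begin

abbreviation "E \<equiv> cayley_edges G S"
abbreviation "V \<equiv> carrier G"

definition conn :: "'a set \<Rightarrow> bool" where
  "conn A \<longleftrightarrow> A \<subseteq> V \<and> (\<forall>x\<in>A. \<forall>y\<in>A. (x, y) \<in> (Restr E A)\<^sup>*)"

definition component :: "'a set \<Rightarrow> 'a \<Rightarrow> 'a set" where
  "component L x = (Restr E (V - L))\<^sup>* `` {x}"

lemma E_sym: "(x, y) \<in> E \<Longrightarrow> (y, x) \<in> E"
  by (auto simp: cayley_edges_def)

lemma E_V: "(x, y) \<in> E \<Longrightarrow> x \<in> V \<and> y \<in> V"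
  by (auto simp: cayley_edges_def)

lemma E_shift: "(x, y) \<in> E \<Longrightarrow> g \<in> V \<Longrightarrow> (g \<otimes> x, g \<otimes> y) \<in> E"
  using S_carrier by (force simp: cayley_edges_def m_assoc)

lemma Restr_rtrancl_sym: "(x, y) \<in> (Restr E A)\<^sup>* \<Longrightarrow> (y, x) \<in> (Restr E A)\<^sup>*"
  by (rule symD[OF sym_rtrancl]) (auto simp: sym_def E_sym)

lemma Restr_rtrancl_mono: "(x, y) \<in> (Restr E A)\<^sup>* \<Longrightarrow> A \<subseteq> B \<Longrightarrow> (x, y) \<in> (Restr E B)\<^sup>*"
  using rtrancl_mono[of "Restr E A" "Restr E B"] by blast

lemma Restr_rtrancl_shift:
  assumes "(x, y) \<in> (Restr E A)\<^sup>*" "g \<in> V"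
  shows "(g \<otimes> x, g \<otimes> y) \<in> (Restr E (g <# A))\<^sup>*"
  using assms(1)
proof induction
  case (step y z)
  then have "(g \<otimes> y, g \<otimes> z) \<in> Restr E (g <# A)"
    using assms(2) by (auto intro: E_shift l_coset_memI)
  with step show ?case by (meson rtrancl.rtrancl_into_rtrancl)
qed simp

lemma conn_V: "conn A \<Longrightarrow> A \<subseteq> V"
  by (simp add: conn_def)

lemma conn_shift:
  assumes "conn A" "g \<in> V" shows "conn (g <# A)"
  unfolding conn_def
proof (intro conjI ballI)
  show "g <# A \<subseteq> V" using assms by (intro l_coset_subset_G) (auto simp: conn_def)
next
  fix x y assume "x \<in> g <# A" "y \<in> g <# A"
  then obtain a b where "a \<in> A" "b \<in> A" "x = g \<otimes> a" "y = g \<otimes> b" by (auto simp: l_coset_def)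
  then show "(x, y) \<in> (Restr E (g <# A))\<^sup>*"
    using assms Restr_rtrancl_shift[of a b A g] by (auto simp: conn_def)
qed

lemma connI_star:
  assumes "A \<subseteq> V" "\<And>x. x \<in> A \<Longrightarrow> (x, z) \<in> (Restr E A)\<^sup>*"
  shows "conn A"
  unfolding conn_def using assms Restr_rtrancl_sym by (meson rtrancl_trans)

lemma conn_Un:
  assumes "conn A" "conn B" "A \<inter> B \<noteq> {}"
  shows "conn (A \<union> B)"
proof -
  obtain z where z: "z \<in> A" "z \<in> B" using assms by auto
  show ?thesis
  proof (rule connI_star[of _ z])
    fix x assume "x \<in> A \<union> B"
    then show "(x, z) \<in> (Restr E (A \<union> B))\<^sup>*"
      using assms z Restr_rtrancl_mono[of x z A "A \<union> B"] Restr_rtrancl_mono[of x z B "A \<union> B"]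
      unfolding conn_def by blast
  qed (use assms in \<open>auto simp: conn_def\<close>)
qed

lemma comp_self: "x \<in> component L x"
  by (simp add: component_def)

lemma comp_subset: "x \<in> V - L \<Longrightarrow> component L x \<subseteq> V - L"
proof
  fix y assume "x \<in> V - L" "y \<in> component L x"
  then have "(x, y) \<in> (Restr E (V - L))\<^sup>*" by (simp add: component_def)
  then show "y \<in> V - L" using \<open>x \<in> V - L\<close> by induction auto
qed

lemma comp_eq: "y \<in> component L x \<Longrightarrow> component L y = component L x"
  unfolding component_def using Restr_rtrancl_sym by (auto intro: rtrancl_trans)

lemma comp_disjoint: "component L x \<inter> component L y \<noteq> {} \<Longrightarrow> component L x = component L y"
  using comp_eq by blast

lemma conn_subset_comp:
  assumes "conn A" "A \<inter> L = {}" "x \<in> A" shows "A \<subseteq> component L x"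
proof
  fix y assume "y \<in> A"
  then have "(x, y) \<in> (Restr E A)\<^sup>*" using assms by (auto simp: conn_def)
  then show "y \<in> component L x" unfolding component_def
    using assms Restr_rtrancl_mono[of x y A "V - L"] by (auto simp: conn_def)
qed

lemma conn_meets_comp:
  assumes "conn A" "A \<inter> L = {}" "A \<inter> component L x \<noteq> {}" shows "A \<subseteq> component L x"
  using assms conn_subset_comp comp_eq by blast

lemma conn_comp:
  assumes "x \<in> V - L" shows "conn (component L x)"
proof (rule connI_star[of _ x])
  fix y assume "y \<in> component L x"
  then have "(x, y) \<in> (Restr E (V - L))\<^sup>*" by (simp add: component_def)
  then have "(x, y) \<in> (Restr E (component L x))\<^sup>*"
  proof induction
    case (step y z)
    then have "y \<in> component L x" "z \<in> component L x" by (auto simp: component_def intro: rtrancl.rtrancl_into_rtrancl)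
    with step show ?case by (auto intro: rtrancl.rtrancl_into_rtrancl)
  qed simp
  then show "(y, x) \<in> (Restr E (component L x))\<^sup>*" by (rule Restr_rtrancl_sym)
qed (use comp_subset[OF assms] in auto)

lemma comp_neighbour:
  assumes "v \<in> component L x" "x \<in> V - L" "(v, w) \<in> E" "w \<notin> L" shows "w \<in> component L x"
proof -
  have "v \<in> V - L" using comp_subset assms by blast
  then have "(v, w) \<in> Restr E (V - L)" using assms E_V by auto
  then show ?thesis using assms unfolding component_def by (auto intro: rtrancl.rtrancl_into_rtrancl)
qed

lemma comp_shift_subset:
  assumes "g \<in> V" "L \<subseteq> V" shows "g <# component L x \<subseteq> component (g <# L) (g \<otimes> x)"
proof
  fix y assume "y \<in> g <# component L x"
  then obtain z where z: "(x, z) \<in> (Restr E (V - L))\<^sup>*" "y = g \<otimes> z"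
    by (auto simp: l_coset_def component_def)
  then show "y \<in> component (g <# L) (g \<otimes> x)"
    using Restr_rtrancl_shift[OF z(1) assms(1)] assms by (simp add: component_def l_coset_Diff)
qed

lemma comp_shift:
  assumes "g \<in> V" "L \<subseteq> V" "x \<in> V - L" shows "g <# component L x = component (g <# L) (g \<otimes> x)"
proof
  have gL: "g <# L \<subseteq> V" using assms l_coset_subset_G by auto
  have gx: "g \<otimes> x \<in> V - (g <# L)" using assms by (auto simp: mem_l_coset_iff m_assoc[symmetric])
  have "inv g <# component (g <# L) (g \<otimes> x) \<subseteq> component (inv g <# (g <# L)) (inv g \<otimes> (g \<otimes> x))"
    using assms gL by (intro comp_shift_subset) auto
  then have "inv g <# component (g <# L) (g \<otimes> x) \<subseteq> component L x"
    using assms by (simp add: l_coset_inv_cancel m_assoc[symmetric])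
  then have "g <# (inv g <# component (g <# L) (g \<otimes> x)) \<subseteq> g <# component L x" by (rule l_coset_mono)
  moreover have "component (g <# L) (g \<otimes> x) \<subseteq> V" using comp_subset[OF gx] by auto
  ultimately show "component (g <# L) (g \<otimes> x) \<subseteq> g <# component L x" using assms by (simp add: l_coset_inv_cancel)
qed (use assms comp_shift_subset in auto)

lemma E_gen: "s \<in> S \<Longrightarrow> g \<in> V \<Longrightarrow> (g, g \<otimes> s) \<in> E"
  using S_carrier by (auto simp: cayley_edges_def)

lemma generated_reachable:
  assumes "x \<in> generate G S" shows "(\<one>, x) \<in> E\<^sup>*"
  using assms
proof induction
  case one then show ?case by simp
next
  case (incl s) then show ?case using E_gen[of s \<one>] S_carrier by auto
next
  case (inv s)
  then have "(inv s, \<one>) \<in> E" using E_gen[of s "inv s"] S_carrier by auto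
  then show ?case using E_sym by blast
next
  case (eng x y)
  then have "x \<in> V" "y \<in> V" using S_gen by auto
  have "(\<one>, y) \<in> (Restr E V)\<^sup>*"
    using eng E_V by (metis (no_types, lifting) Int_absorb2 mem_Sigma_iff subrelI)
  then have "(x \<otimes> \<one>, x \<otimes> y) \<in> (Restr E (x <# V))\<^sup>*" using \<open>x \<in> V\<close> by (intro Restr_rtrancl_shift)
  then have "(x, x \<otimes> y) \<in> E\<^sup>*" using \<open>x \<in> V\<close>
    by (metis Int_lower1 r_one rtrancl_mono subsetD)
  with eng show ?case by (meson rtrancl_trans)
qed

lemma E_connected:
  assumes "x \<in> V" "y \<in> V" shows "(x, y) \<in> E\<^sup>*"
proof -
  have "(\<one>, x) \<in> E\<^sup>*" "(\<one>, y) \<in> E\<^sup>*" using assms generated_reachable S_gen by auto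
  moreover have "sym (E\<^sup>*)" by (rule sym_rtrancl) (auto simp: sym_def E_sym)
  ultimately show ?thesis by (meson rtrancl_trans symD)
qed

text \<open>A path from a point outside the component to \<open>L\<close> can enter the component only through \<open>L\<close>, and
  once it has reached \<open>L\<close> it can continue inside \<open>L\<close>.\<close>

lemma conn_compl_comp:
  assumes "conn L" "L \<noteq> {}" "x \<in> V - L"
  shows "conn (V - component L x)"
proof -
  obtain z where z: "z \<in> L" using assms by auto
  have LV: "L \<subseteq> V" using assms conn_V by auto
  have disj: "L \<subseteq> V - component L x" using comp_subset[OF assms(3)] LV by auto
  show ?thesis
  proof (rule connI_star[of _ z])
    fix y assume y: "y \<in> V - component L x"
    have "(y, z) \<in> E\<^sup>*" using y z LV by (intro E_connected) auto
    then show "(y, z) \<in> (Restr E (V - component L x))\<^sup>*" using y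
    proof (induction rule: converse_rtrancl_induct)
      case (step y w)
      show ?case
      proof (cases "w \<in> component L x")
        case True
        then have "y \<in> L" using comp_neighbour[OF True assms(3)] step E_sym by blast
        then show ?thesis using assms(1) z disj Restr_rtrancl_mono[of y z L] unfolding conn_def by blast
      next
        case False
        then have "(w, z) \<in> (Restr E (V - component L x))\<^sup>*" "(y, w) \<in> Restr E (V - component L x)"
          using step E_V by auto
        then show ?thesis by (meson converse_rtrancl_into_rtrancl)
      qed
    qed simp
  qed auto
qed

lemma finite_conn_pair:
  assumes "x \<in> V" "y \<in> V" shows "\<exists>A. finite A \<and> conn A \<and> x \<in> A \<and> y \<in> A"
  using E_connected[OF assms]
proof induction
  case base
  have "conn {x}" using assms by (auto simp: conn_def)
  then show ?case by blast
next
  case (step y z)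
  then obtain A where A: "finite A" "conn A" "x \<in> A" "y \<in> A" by auto
  have "conn {y, z}" using step E_V E_sym by (auto simp: conn_def intro!: r_into_rtrancl)
  then have "conn (A \<union> {y, z})" using A by (intro conn_Un) auto
  then show ?case using A by (intro exI[of _ "A \<union> {y, z}"]) auto
qed

lemma finite_conn_superset:
  assumes "finite B" "B \<subseteq> V"
  shows "\<exists>A. finite A \<and> conn A \<and> \<one> \<in> A \<and> B \<subseteq> A"
  using assms
proof induction
  case empty
  have "conn {\<one>}" by (auto simp: conn_def)
  then show ?case by blast
next
  case (insert b B)
  then obtain A where A: "finite A" "conn A" "\<one> \<in> A" "B \<subseteq> A" by auto
  obtain A' where A': "finite A'" "conn A'" "\<one> \<in> A'" "b \<in> A'" using finite_conn_pair[of \<one> b] insert by auto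
  have "conn (A \<union> A')" using A A' by (intro conn_Un) auto
  then show ?case using A A' by (intro exI[of _ "A \<union> A'"]) auto
qed

lemma components_off_eq: "components_off V E L = component L ` (V - L)"
  by (auto simp: components_off_def quotient_def component_def)

definition inf_comps :: "'a set \<Rightarrow> 'a set set" where
  "inf_comps L = {C \<in> components_off V E L. infinite C}"

lemma conn_in_component:
  assumes "conn A" "A \<inter> L = {}" "A \<noteq> {}"
  shows "\<exists>C\<in>components_off V E L. A \<subseteq> C"
proof -
  obtain x where x: "x \<in> A" using assms by auto
  then have "x \<in> V - L" using assms conn_V by auto
  then show ?thesis using conn_subset_comp[OF assms(1,2) x] by (auto simp: components_off_eq)
qed

lemma component_props:
  assumes "C \<in> components_off V E L"
  shows "C \<subseteq> V - L" "conn C" "C \<noteq> {}" "C \<subseteq> V" "C \<inter> L = {}"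
proof -
  obtain x where x: "x \<in> V - L" "C = component L x" using assms by (auto simp: components_off_eq)
  show "C \<subseteq> V - L" "conn C" "C \<noteq> {}" using comp_subset[OF x(1)] conn_comp[OF x(1)] comp_self[of x L] x(2) by auto
  then show "C \<subseteq> V" "C \<inter> L = {}" by auto
qed

lemma component_disjoint:
  assumes "C \<in> components_off V E L" "D \<in> components_off V E L" "C \<inter> D \<noteq> {}" shows "C = D"
  using assms comp_disjoint by (auto simp: components_off_eq)

lemma conn_compl_component:
  assumes "conn L" "L \<noteq> {}" "C \<in> components_off V E L" shows "conn (V - C)"
  using assms conn_compl_comp by (auto simp: components_off_eq)

lemma conn_meets_component:
  assumes "conn A" "A \<inter> L = {}" "C \<in> components_off V E L" "A \<inter> C \<noteq> {}" shows "A \<subseteq> C"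
proof -
  obtain x where "C = component L x" using assms by (auto simp: components_off_eq)
  then show ?thesis using conn_meets_comp[OF assms(1,2), of x] assms by simp
qed

lemma component_shift:
  assumes "C \<in> components_off V E L" "g \<in> V" "L \<subseteq> V" shows "g <# C \<in> components_off V E (g <# L)"
proof -
  obtain x where x: "x \<in> V - L" "C = component L x" using assms by (auto simp: components_off_eq)
  have "g \<otimes> x \<in> V - (g <# L)" using assms x by (auto simp: mem_l_coset_iff m_assoc[symmetric])
  then show ?thesis using x assms comp_shift by (auto simp: components_off_eq)
qed

lemma ends_in_comps:
  assumes "e \<in> ends V E" "finite L" "L \<subseteq> V" shows "e L \<in> inf_comps L"
  using assms by (auto simp: ends_def inf_comps_def)

text \<open>Distinct ends differ at some finite set. Enlarging the finite set keeps them apart, because the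
  values of an end are nested components, so one finite set works for finitely many ends.\<close>

lemma finite_set_separating_ends:
  assumes "finite T" "T \<subseteq> ends V E"
  shows "\<exists>K. finite K \<and> conn K \<and> \<one> \<in> K \<and> inj_on (\<lambda>e. e K) T"
proof -
  define sep where "sep e e' M \<longleftrightarrow> finite M \<and> M \<subseteq> V \<and> (e \<noteq> e' \<longrightarrow> e M \<noteq> e' M)"
    for e e' :: "'a set \<Rightarrow> 'a set" and M
  have "\<exists>M. sep e e' M" if "e \<in> T" "e' \<in> T" for e e'
  proof (cases "e = e'")
    case False
    have "e \<in> ends V E" "e' \<in> ends V E" using that assms by auto
    then have *: "e \<in> extensional {K. finite K \<and> K \<subseteq> V}" "e' \<in> extensional {K. finite K \<and> K \<subseteq> V}"
      by (auto simp: ends_def PiE_def)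
    have "\<exists>M \<in> {K. finite K \<and> K \<subseteq> V}. e M \<noteq> e' M"
      using False extensionalityI[OF *] by auto
    then show ?thesis using False by (auto simp: sep_def)
  qed (auto simp: sep_def)
  then obtain M where M: "\<And>e e'. e \<in> T \<Longrightarrow> e' \<in> T \<Longrightarrow> sep e e' (M e e')"
    by metis
  have "finite (M e e') \<and> M e e' \<subseteq> V" if "e \<in> T" "e' \<in> T" for e e'
    using M[OF that] by (simp add: sep_def)
  then have "finite (\<Union>e\<in>T. \<Union>e'\<in>T. M e e')" "(\<Union>e\<in>T. \<Union>e'\<in>T. M e e') \<subseteq> V"
    using assms(1) by (simp_all add: UN_subset_iff)
  then obtain K where K: "finite K" "conn K" "\<one> \<in> K" "(\<Union>e\<in>T. \<Union>e'\<in>T. M e e') \<subseteq> K"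
    using finite_conn_superset[of "\<Union>e\<in>T. \<Union>e'\<in>T. M e e'"] by auto
  have KV: "K \<subseteq> V" using K conn_V by auto
  have "inj_on (\<lambda>e. e K) T"
  proof (rule inj_onI, rule ccontr)
    fix e e' assume e: "e \<in> T" "e' \<in> T" "e K = e' K" "e \<noteq> e'"
    let ?M = "M e e'"
    have e': "e \<in> ends V E" "e' \<in> ends V E" using e assms by auto
    have MK: "?M \<subseteq> K" using K(4) e(1,2) by (simp add: UN_subset_iff)
    have sub: "e K \<subseteq> e ?M" "e' K \<subseteq> e' ?M" using e' MK K KV by (auto simp: ends_def)
    have "e K \<in> components_off V E K" using ends_in_comps[OF e'(1) K(1) KV] by (simp add: inf_comps_def)
    then have "e K \<noteq> {}" by (rule component_props)
    then have "e ?M \<inter> e' ?M \<noteq> {}" using sub e by auto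
    moreover have "e ?M \<in> inf_comps ?M" "e' ?M \<in> inf_comps ?M" using ends_in_comps e' M e by (auto simp: sep_def)
    ultimately have "e ?M = e' ?M" using component_disjoint by (auto simp: inf_comps_def)
    then show False using M e by (auto simp: sep_def)
  qed
  then show ?thesis using K by blast
qed

lemma infinite_ends_cut:
  assumes "infinite (ends V E)"
  shows "\<exists>K \<D>. finite K \<and> conn K \<and> \<one> \<in> K \<and> \<D> \<subseteq> inf_comps K \<and> card \<D> = n"
proof -
  obtain T where T: "T \<subseteq> ends V E" "finite T" "card T = n" using infinite_arbitrarily_large[OF assms] by blast
  obtain K where K: "finite K" "conn K" "\<one> \<in> K" "inj_on (\<lambda>e. e K) T"
    using finite_set_separating_ends T by blast
  have "(\<lambda>e. e K) ` T \<subseteq> inf_comps K" using T K conn_V ends_in_comps by blast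
  moreover have "card ((\<lambda>e. e K) ` T) = n" using K T by (simp add: card_image)
  ultimately show ?thesis using K by (intro exI[of _ K] exI[of _ "(\<lambda>e. e K) ` T"] conjI)
qed

end

section \<open>Translates of a cut\<close>

context group
begin

text \<open>Sets with arbitrarily many pairwise disjoint translates. The number of translates is a parameter
  and no infinite family is asked for, since the random walk will use finitely many of them.\<close>

definition spread :: "'a set \<Rightarrow> bool" where
  "spread X \<longleftrightarrow> X \<subseteq> carrier G \<and>
     (\<forall>n. \<exists>Z\<subseteq>carrier G. finite Z \<and> card Z = n \<and>
        (\<forall>z\<in>Z. \<forall>z'\<in>Z. z \<noteq> z' \<longrightarrow> (z <# X) \<inter> (z' <# X) = {}))"

text \<open>The translates by \<open>a, b a, b\<^sup>2 a, \<dots>\<close> are disjoint.\<close>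

lemma spreadI_pingpong:
  assumes X: "X \<subseteq> carrier G" "X \<noteq> {}" and ab: "a \<in> carrier G" "b \<in> carrier G"
    and sub: "a <# X \<subseteq> X" "b <# X \<subseteq> X" and disj: "(a <# X) \<inter> (b <# X) = {}"
  shows "spread X"
proof -
  have *: "\<exists>Z\<subseteq>carrier G. finite Z \<and> card Z = n \<and> (\<forall>z\<in>Z. z <# X \<subseteq> X) \<and>
      (\<forall>z\<in>Z. \<forall>z'\<in>Z. z \<noteq> z' \<longrightarrow> (z <# X) \<inter> (z' <# X) = {})" for n
  proof (induction n)
    case 0
    then show ?case by (intro exI[of _ "{}"]) auto
  next
    case (Suc n)
    then obtain Z where Z: "Z \<subseteq> carrier G" "finite Z" "card Z = n" "\<forall>z\<in>Z. z <# X \<subseteq> X"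
      "\<forall>z\<in>Z. \<forall>z'\<in>Z. z \<noteq> z' \<longrightarrow> (z <# X) \<inter> (z' <# X) = {}" by (elim exE conjE) (rule that)
    have bz: "(b \<otimes> z) <# X = b <# (z <# X)" if "z \<in> Z" for z
      using that Z ab X by (intro lcos_m_assoc[symmetric]) auto
    have bzb: "(b \<otimes> z) <# X \<subseteq> b <# X" if "z \<in> Z" for z
      using bz Z that by (simp add: l_coset_mono)
    have bdisj: "((b \<otimes> z) <# X) \<inter> ((b \<otimes> z') <# X) = {}" if "z \<in> Z" "z' \<in> Z" "b \<otimes> z \<noteq> b \<otimes> z'" for z z'
    proof -
      have "(z <# X) \<inter> (z' <# X) = {}" using that Z(5) by (metis (no_types))
      moreover have "z <# X \<subseteq> carrier G" "z' <# X \<subseteq> carrier G" using that Z X by blast+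
      ultimately show ?thesis using that bz ab by (simp add: l_coset_disjoint_iff)
    qed
    have notin: "a \<notin> (\<lambda>z. b \<otimes> z) ` Z"
    proof
      assume "a \<in> (\<lambda>z. b \<otimes> z) ` Z"
      then have "a <# X \<subseteq> b <# X" using bzb by auto
      then have "a <# X = {}" using disj by blast
      then show False using X by simp
    qed
    let ?Z = "insert a ((\<lambda>z. b \<otimes> z) ` Z)"
    have "inj_on (\<lambda>z. b \<otimes> z) Z" using Z ab by (auto simp: inj_on_def subset_iff)
    then have "card ?Z = Suc n" using Z notin by (simp add: card_image)
    moreover have "(z <# X) \<inter> (z' <# X) = {}" if "z \<in> ?Z" "z' \<in> ?Z" "z \<noteq> z'" for z z'
      using that bzb bdisj disj by fast
    moreover have "z <# X \<subseteq> X" if "z \<in> ?Z" for z using that bzb sub by blast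
    moreover have "?Z \<subseteq> carrier G" using Z ab by auto
    ultimately show ?case using Z by (intro exI[of _ ?Z]) auto
  qed
  show ?thesis unfolding spread_def
  proof (intro conjI allI)
    fix n
    from *[of n] show "\<exists>Z\<subseteq>carrier G. finite Z \<and> card Z = n \<and>
      (\<forall>z\<in>Z. \<forall>z'\<in>Z. z \<noteq> z' \<longrightarrow> (z <# X) \<inter> (z' <# X) = {})"
      by (elim exE conjE) (intro exI conjI)
  qed (rule X)
qed

lemma spread_shift:
  assumes "spread X" "g \<in> carrier G" shows "spread (g <# X)"
  unfolding spread_def
proof (intro conjI allI)
  have X: "X \<subseteq> carrier G" using assms by (simp add: spread_def)
  then show "g <# X \<subseteq> carrier G" using assms by (simp add: l_coset_subset_G)
  fix n
  obtain Z where Z: "Z \<subseteq> carrier G" "finite Z" "card Z = n"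
      "\<forall>z\<in>Z. \<forall>z'\<in>Z. z \<noteq> z' \<longrightarrow> (z <# X) \<inter> (z' <# X) = {}"
    using assms unfolding spread_def by (elim exE conjE allE[of _ n]) (rule that)
  have inj: "inj_on (\<lambda>z. z \<otimes> inv g) Z" using Z assms by (auto simp: inj_on_def subset_iff)
  have eq: "(z \<otimes> inv g) <# (g <# X) = z <# X" if "z \<in> Z" for z
  proof -
    have "z \<in> carrier G" using that Z by auto
    then show ?thesis using X assms(2) by (simp add: lcos_m_assoc m_assoc)
  qed
  show "\<exists>Z\<subseteq>carrier G. finite Z \<and> card Z = n \<and>
        (\<forall>z\<in>Z. \<forall>z'\<in>Z. z \<noteq> z' \<longrightarrow> (z <# (g <# X)) \<inter> (z' <# (g <# X)) = {})"
  proof (intro exI[of _ "(\<lambda>z. z \<otimes> inv g) ` Z"] conjI ballI impI)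
    fix z z' assume "z \<in> (\<lambda>z. z \<otimes> inv g) ` Z" "z' \<in> (\<lambda>z. z \<otimes> inv g) ` Z" "z \<noteq> z'"
    then obtain y y' where y: "y \<in> Z" "y' \<in> Z" "z = y \<otimes> inv g" "z' = y' \<otimes> inv g" "y \<noteq> y'" by auto
    then show "(z <# (g <# X)) \<inter> (z' <# (g <# X)) = {}" using Z(4) eq by simp
  qed (use Z inj assms in \<open>auto simp: card_image\<close>)
qed

end

text \<open>Four components, so that three given ones can be avoided in \<open>moved_half_space\<close>.\<close>

locale cut = cayley_graph +
  fixes K
  assumes K_fin: "finite K" and K_conn: "conn K" and K_one: "\<one> \<in> K"
    and four_components: "\<exists>\<D>\<subseteq>inf_comps K. card \<D> = 4"
begin

abbreviation "comps \<equiv> components_off V E K"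
abbreviation "I \<equiv> inf_comps K"

text \<open>As \<open>K\<close> is finite, all but finitely many elements are far.\<close>

definition far :: "'a \<Rightarrow> bool" where
  "far g \<longleftrightarrow> g \<in> V \<and> (g <# K) \<inter> K = {}"

definition near :: "'a set" where
  "near = {g \<in> V. \<not> far g}"

lemma K_V: "K \<subseteq> V" using K_conn conn_V by auto

lemma I_comps: "i \<in> I \<Longrightarrow> i \<in> comps" and I_inf: "i \<in> I \<Longrightarrow> infinite i"
  by (auto simp: inf_comps_def)

lemma I_V: "i \<in> I \<Longrightarrow> i \<subseteq> V" using component_props I_comps by blast

lemma I_disjoint: "i \<in> I \<Longrightarrow> j \<in> I \<Longrightarrow> i \<noteq> j \<Longrightarrow> i \<inter> j = {}"
  using component_disjoint I_comps by blast

lemma far_V: "far g \<Longrightarrow> g \<in> V" by (simp add: far_def)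

lemma far_inv: "far g \<Longrightarrow> far (inv g)"
  using l_coset_disjoint_move[of K K g] K_V by (auto simp: far_def)

lemma finite_near: "finite near"
proof -
  have "near \<subseteq> {g \<in> V. (g <# K) \<inter> K \<noteq> {}}" by (auto simp: near_def far_def)
  then show ?thesis using finite_translates_meeting[OF K_fin K_fin K_V K_V] finite_subset by blast
qed

lemma self_in_shift: "g \<in> V \<Longrightarrow> g \<in> g <# K"
  using l_coset_memI[OF K_one, of g] by simp

lemma farI_component: "g \<in> V \<Longrightarrow> C \<in> comps \<Longrightarrow> g <# K \<subseteq> C \<Longrightarrow> far g"
  using component_props[of C K] unfolding far_def by blast

lemma other_component:
  assumes "finite X" "card X < 4" shows "\<exists>i\<in>I. i \<notin> X"
proof (rule ccontr)
  assume *: "\<not> ?thesis"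
  obtain \<D> where "\<D> \<subseteq> I" "card \<D> = 4" using four_components by blast
  then have "\<D> \<subseteq> X" using * by auto
  then show False using card_mono[OF assms(1), of \<D>] assms \<open>card \<D> = 4\<close> by auto
qed

lemma two_components: obtains D1 D2 where "D1 \<in> I" "D2 \<in> I" "D1 \<noteq> D2"
proof -
  obtain D1 where D1: "D1 \<in> I" using other_component[of "{}"] by auto
  obtain D2 where "D2 \<in> I" "D2 \<noteq> D1" using other_component[of "{D1}"] by auto
  then show thesis using that D1 by blast
qed

lemma shift_component:
  assumes "far g" shows "\<exists>C\<in>comps. g <# K \<subseteq> C"
  using assms conn_in_component[OF conn_shift[OF K_conn, of g]] K_one by (auto simp: far_def)

text \<open>The set \<open>g (V - j)\<close> is connected, meets \<open>i\<close> and misses \<open>K\<close>. Thus a far element maps the complement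
  of one half-space into another one: these are the moves from which all the dynamics is built.\<close>

lemma nest:
  assumes "far g" "i \<in> comps" "j \<in> comps" "g <# K \<subseteq> i" "inv g <# K \<subseteq> j"
  shows "g <# (V - j) \<subseteq> i"
proof (rule conn_meets_component)
  have g: "g \<in> V" using assms far_V by auto
  show "conn (g <# (V - j))"
    using g assms K_conn K_one by (intro conn_shift conn_compl_component) auto
  show "(g <# (V - j)) \<inter> K = {}" using g assms K_V by (subst l_coset_disjoint_move) auto
  have "K \<subseteq> V - j" using component_props[OF assms(3)] K_V by auto
  then have "g <# K \<subseteq> g <# (V - j)" by (rule l_coset_mono)
  then show "(g <# (V - j)) \<inter> i \<noteq> {}" using assms(4) self_in_shift[OF g] by blast
qed (use assms in auto)

lemma infinite_compl:
  assumes "j \<in> comps" shows "infinite (V - j)"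
proof -
  obtain i where i: "i \<in> I" "i \<noteq> j" using other_component[of "{j}"] by auto
  then have "i \<subseteq> V - j" using component_disjoint[OF I_comps[OF i(1)] assms] I_V by blast
  then show ?thesis using I_inf[OF i(1)] finite_subset by blast
qed

lemma infinite_l_coset: "g \<in> V \<Longrightarrow> A \<subseteq> V \<Longrightarrow> infinite A \<Longrightarrow> infinite (g <# A)"
  using finite_l_coset[of "g <# A" "inv g"] l_coset_inv_cancel by auto

lemma nest_infinite:
  assumes "far g" "i \<in> comps" "j \<in> comps" "g <# K \<subseteq> i" "inv g <# K \<subseteq> j"
  shows "i \<in> I"
proof -
  have "infinite (g <# (V - j))" using infinite_compl[OF assms(3)] assms far_V by (intro infinite_l_coset) auto
  then have "infinite i" using nest[OF assms] finite_subset by blast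
  then show ?thesis using assms by (simp add: inf_comps_def)
qed

lemma far_type:
  assumes "far g"
  obtains i j where "i \<in> I" "j \<in> I" "g <# K \<subseteq> i" "inv g <# K \<subseteq> j" "g <# (V - j) \<subseteq> i" "inv g <# (V - i) \<subseteq> j"
proof -
  have g: "g \<in> V" using assms far_V by auto
  obtain i where i: "i \<in> comps" "g <# K \<subseteq> i" using shift_component[OF assms] by auto
  obtain j where j: "j \<in> comps" "inv g <# K \<subseteq> j" using shift_component[OF far_inv[OF assms]] by auto
  have "inv (inv g) <# K \<subseteq> i" using i g by simp
  note i' = far_inv[OF assms] j(1) i(1) j(2) this
  show thesis by (rule that[OF nest_infinite[OF assms i(1) j(1) i(2) j(2)] nest_infinite[OF i'] i(2) j(2)
    nest[OF assms i(1) j(1) i(2) j(2)] nest[OF i']])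
qed

lemma deep_point:
  assumes "D \<in> I" "finite P" "conn P" "\<one> \<in> P"
  shows "\<exists>c\<in>D. c <# P \<subseteq> D"
proof -
  have PV: "P \<subseteq> V" using assms conn_V by auto
  have "finite {c \<in> V. (c <# P) \<inter> K \<noteq> {}}" using finite_translates_meeting K_fin K_V PV assms by auto
  then have "infinite (D - {c \<in> V. (c <# P) \<inter> K \<noteq> {}})" using I_inf assms by auto
  then have "D - {c \<in> V. (c <# P) \<inter> K \<noteq> {}} \<noteq> {}" by (rule infinite_imp_nonempty)
  then obtain c where c: "c \<in> D" "(c <# P) \<inter> K = {}" "c \<in> V" using I_V[OF assms(1)] by auto
  have "c \<in> c <# P" using l_coset_memI[OF assms(4), of c] c by simp
  then have "c <# P \<subseteq> D" using c assms I_comps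
    by (intro conn_meets_component[of _ K]) (auto intro: conn_shift)
  then show ?thesis using c by auto
qed

lemma deep_cut: "D \<in> I \<Longrightarrow> \<exists>c\<in>D. c <# K \<subseteq> D"
  by (rule deep_point[OF _ K_fin K_conn K_one])

text \<open>By \<open>nest\<close>, some translation maps the complement of \<open>j\<close> into \<open>i\<close>.\<close>

definition joins :: "'a set \<Rightarrow> 'a set \<Rightarrow> bool" where
  "joins i j \<longleftrightarrow> i \<in> I \<and> j \<in> I \<and> (\<exists>g. far g \<and> g <# K \<subseteq> i \<and> inv g <# K \<subseteq> j)"

lemma joins_sym: "joins i j \<Longrightarrow> joins j i"
  unfolding joins_def using far_inv far_V inv_inv by metis

lemma joins_total:
  assumes "i \<in> I" shows "\<exists>j. joins i j"
proof -
  obtain c where c: "c \<in> i" "c <# K \<subseteq> i" using deep_cut assms by auto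
  have "far c" using c assms I_V by (intro farI_component[of _ i]) (auto simp: I_comps)
  then obtain i' j where *: "i' \<in> I" "j \<in> I" "c <# K \<subseteq> i'" "inv c <# K \<subseteq> j" by (rule far_type)
  then show ?thesis using c assms \<open>far c\<close> unfolding joins_def by blast
qed

text \<open>The move \<open>j \<rightarrow> i\<close> can be followed by the move \<open>i' \<rightarrow> l\<close> when \<open>i\<close> lies in the complement of \<open>i'\<close>.\<close>

lemma joins_compose:
  assumes "joins l i'" "joins i j" "i \<noteq> i'" shows "joins l j"
proof -
  obtain g' where g': "far g'" "g' <# K \<subseteq> l" "inv g' <# K \<subseteq> i'" "l \<in> I" "i' \<in> I" using assms by (auto simp: joins_def)
  obtain g where g: "far g" "g <# K \<subseteq> i" "inv g <# K \<subseteq> j" "j \<in> I" "i \<in> I" using assms by (auto simp: joins_def)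
  have V: "g \<in> V" "g' \<in> V" using g g' far_V by auto
  have disj: "i \<inter> i' = {}" using I_disjoint g g' assms by blast
  have "g' <# (g <# K) \<subseteq> g' <# (V - i')" using g disj I_V[OF g(5)] by (intro l_coset_mono) blast
  also have "\<dots> \<subseteq> l" using nest g' I_comps by blast
  finally have 1: "(g' \<otimes> g) <# K \<subseteq> l" using V K_V by (simp add: lcos_m_assoc)
  have "inv g <# (inv g' <# K) \<subseteq> inv g <# (V - i)" using g' disj I_V[OF g'(5)] by (intro l_coset_mono) blast
  also have "\<dots> \<subseteq> j" using nest[OF far_inv[OF g(1)], of j i] g V I_comps by simp
  finally have 2: "inv (g' \<otimes> g) <# K \<subseteq> j" using V K_V by (simp add: lcos_m_assoc inv_mult_group)
  have "far (g' \<otimes> g)" using 1 V g' I_comps by (intro farI_component[of _ l]) auto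
  then show ?thesis using 1 2 g g' unfolding joins_def by blast
qed

text \<open>This is a consequence of symmetry, totality and the composition rule. If \<open>j0\<close> cannot be reached
  from \<open>i0\<close>, then \<open>i0\<close> is joined to a single \<open>q\<close>, and composing with \<open>i0\<close> shows that every other
  component is joined to \<open>q\<close> only.\<close>

lemma joins_dichotomy:
  "(\<forall>i\<in>I. \<forall>j\<in>I. joins i j) \<or> (\<exists>q\<in>I. \<forall>i j. joins i j \<longrightarrow> i \<noteq> q \<longrightarrow> j = q)"
proof (cases "\<forall>i\<in>I. \<forall>j\<in>I. joins i j")
  case False
  then obtain i0 j0 where ij: "i0 \<in> I" "j0 \<in> I" "\<not> joins i0 j0" by auto
  obtain q where q: "joins i0 q" using joins_total ij by blast
  obtain k where k: "joins k j0" using joins_total[OF ij(2)] joins_sym by blast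
  have uniq: "i = q" if "joins i0 i" for i
    using joins_compose[OF q k] joins_compose[OF that k] ij by metis
  have "j = q" if "joins i j" "i \<noteq> q" for i j
    using joins_compose[OF q that] uniq by blast
  moreover have "q \<in> I" using q by (simp add: joins_def)
  ultimately show ?thesis by blast
qed simp

end

section \<open>No component is distinguished\<close>

context group
begin

lemma pow_inj_if_no_torsion:
  assumes "c \<in> carrier G" "\<And>n::nat. n \<ge> 1 \<Longrightarrow> c [^] n \<noteq> \<one>"
  shows "inj (\<lambda>n::nat. c [^] n)"
proof -
  have less: "c [^] m \<noteq> c [^] n" if "m < n" for m n :: nat
  proof
    assume eq: "c [^] m = c [^] n"
    have "c [^] n = c [^] m \<otimes> c [^] (n - m)" using that assms by (simp add: nat_pow_mult)
    then have "c [^] (n - m) = \<one>" using eq assms by (metis l_cancel_one nat_pow_closed)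
    then show False using assms(2)[of "n - m"] that by simp
  qed
  show ?thesis
  proof (rule injI, rule ccontr)
    fix m n assume "c [^] (m::nat) = c [^] n" "m \<noteq> n"
    then show False using less[of m n] less[of n m] by (metis nat_neq_iff)
  qed
qed

end

context cut
begin

text \<open>In a star, the centre \<open>q\<close> would behave like an end fixed by \<open>G\<close>. Let \<open>M\<close> consist of the far elements
  that move \<open>K\<close> into a component other than \<open>q\<close>; all of them see \<open>K\<close> from the side \<open>q\<close>, and this makes
  \<open>M\<close> a semigroup whose inverses \<open>g\<inverse> K\<close> lie in a chain that leads to \<open>q\<close>: up to finitely many
  exceptions, a quotient \<open>g g'\<inverse>\<close> is in \<open>M\<close> or its inverse is. Moreover \<open>M\<close> is discrete, since an element
  has only finitely many factorisations in \<open>M\<close>. Take \<open>a, c \<in> M\<close> that move \<open>K\<close> into two different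
  components. Along the chain, the points \<open>a\<^sup>-\<^sup>k\<close> stay within bounded distance of the points \<open>c\<^sup>-\<^sup>m\<close>,
  so by the pigeonhole principle a positive power of \<open>a\<close> is a power of \<open>c\<close>. But positive powers
  of \<open>a\<close> and \<open>c\<close> lie in different components, and inverses of elements of \<open>M\<close> are not in \<open>M\<close>.\<close>

lemma not_star:
  assumes q: "q \<in> I" and star: "\<And>i j. joins i j \<Longrightarrow> i \<noteq> q \<Longrightarrow> j = q"
  shows False
proof -
  define M where "M = {g. far g \<and> \<not> g <# K \<subseteq> q}"
  have MV: "g \<in> V" if "g \<in> M" for g using that far_V by (auto simp: M_def)
  have Mfar: "far g" if "g \<in> M" for g using that by (auto simp: M_def)
  have Mtype: "inv g <# K \<subseteq> q \<and> (\<exists>i\<in>I. i \<noteq> q \<and> g <# K \<subseteq> i \<and> g <# (V - q) \<subseteq> i)" if "g \<in> M" for g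
  proof -
    have "far g" using that by (simp add: M_def)
    then obtain i j where *: "i \<in> I" "j \<in> I" "g <# K \<subseteq> i" "inv g <# K \<subseteq> j" "g <# (V - j) \<subseteq> i"
      by (rule far_type)
    then have "joins i j" using \<open>far g\<close> unfolding joins_def by blast
    moreover have "i \<noteq> q" using * that by (auto simp: M_def)
    ultimately have "j = q" using star by blast
    then show ?thesis using * \<open>i \<noteq> q\<close> by blast
  qed
  have MI: "g \<in> M" if "g \<in> V" "g <# K \<subseteq> i" "i \<in> I" "i \<noteq> q" for g i
  proof -
    have "i \<inter> q = {}" using I_disjoint that q by blast
    then have "\<not> g <# K \<subseteq> q" using that self_in_shift[of g] by blast
    then show ?thesis using farI_component[of g i] that I_comps by (simp add: M_def)
  qed
  have MK: "g <# K \<subseteq> V - q" if g: "g \<in> M" for g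
  proof -
    obtain i where "i \<in> I" "i \<noteq> q" "g <# K \<subseteq> i" using Mtype[OF g] by blast
    then show ?thesis using I_disjoint[of i q] q I_V[of i] by blast
  qed
  have Mmult_sub: "(g \<otimes> g') <# K \<subseteq> i" if "g \<in> M" "g' \<in> M" "g <# (V - q) \<subseteq> i" for g g' i
  proof -
    have "g <# (g' <# K) \<subseteq> g <# (V - q)" using MK[OF that(2)] by (rule l_coset_mono)
    then show ?thesis using that MV K_V by (auto simp: lcos_m_assoc)
  qed
  have Mmult: "g \<otimes> g' \<in> M" if g: "g \<in> M" "g' \<in> M" for g g'
  proof -
    obtain i where "i \<in> I" "i \<noteq> q" "g <# (V - q) \<subseteq> i" using Mtype[OF g(1)] by blast
    then show ?thesis using Mmult_sub[OF g] MV[OF g(1)] MV[OF g(2)] by (intro MI[of _ i]) auto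
  qed
  have Minv: "inv g \<notin> M" if "g \<in> M" for g using Mtype[OF that] by (simp add: M_def)
  have one: "\<one> \<notin> M"
    using K_one K_V by (auto simp: M_def far_def lcos_mult_one)
  \<comment> \<open>The chain condition. If neither quotient is in \<open>M\<close>, then \<open>g g'\<inverse>\<close> maps the complement of \<open>q\<close>, which
    contains \<open>g' K\<close>, into \<open>q\<close>.\<close>
  have Mquot: "g \<otimes> inv g' \<in> near \<or> g \<otimes> inv g' \<in> M \<or> g' \<otimes> inv g \<in> M" if "g \<in> M" "g' \<in> M" for g g'
  proof (rule ccontr)
    let ?y = "g \<otimes> inv g'"
    assume *: "\<not> ?thesis"
    have gV: "g \<in> V" "g' \<in> V" using that MV by auto
    have y: "far ?y" using * gV by (simp add: near_def)
    then obtain i j where ij: "i \<in> I" "j \<in> I" "?y <# K \<subseteq> i" "inv ?y <# K \<subseteq> j" "?y <# (V - j) \<subseteq> i"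
      by (rule far_type)
    have "i = q" using MI[of ?y i] ij * gV by auto
    moreover have "inv ?y = g' \<otimes> inv g" using gV by (simp add: inv_mult_group)
    then have "j = q" using MI[of "inv ?y" j] ij * gV by auto
    ultimately have "?y <# (g' <# K) \<subseteq> q"
      using l_coset_mono[OF MK[OF that(2)], of ?y] ij by auto
    then have "g <# K \<subseteq> q" using gV K_V by (simp add: lcos_m_assoc m_assoc)
    then show False using that(1) by (simp add: M_def)
  qed
  \<comment> \<open>If \<open>z = y u\<close> in \<open>M\<close>, then \<open>y K\<close> separates \<open>1\<close> from \<open>z\<close>, so it meets every connected set that
    contains both.\<close>
  have Mfin: "finite {y \<in> M. inv y \<otimes> z \<in> M}" if z: "z \<in> V" for z
  proof -
    obtain P where P: "finite P" "conn P" "\<one> \<in> P" "{z} \<subseteq> P" using finite_conn_superset[of "{z}"] z by auto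
    have PV: "P \<subseteq> V" using P conn_V by auto
    have "{y \<in> M. inv y \<otimes> z \<in> M} \<subseteq> {y \<in> V. (y <# K) \<inter> P \<noteq> {}}"
    proof clarify
      fix y assume y: "y \<in> M" "inv y \<otimes> z \<in> M"
      have yV: "y \<in> V" using y MV by auto
      have "(y <# K) \<inter> P \<noteq> {}"
      proof
        assume "(y <# K) \<inter> P = {}"
        then have "K \<inter> (inv y <# P) = {}" using yV K_V PV l_coset_disjoint_move by blast
        then have dis: "(inv y <# P) \<inter> K = {}" by blast
        have mem: "inv y \<in> inv y <# P" using l_coset_memI[OF P(3), of "inv y"] yV by simp
        have "inv y \<in> q" using Mtype[OF y(1)] self_in_shift[of "inv y"] yV by auto
        then have "inv y <# P \<subseteq> q" using mem dis I_comps q yV P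
          by (intro conn_meets_component[OF _ dis]) (auto intro: conn_shift)
        moreover have "inv y \<otimes> z \<in> inv y <# P" using P(4) by (intro l_coset_memI) auto
        moreover have "inv y \<otimes> z \<in> V - q" using MK[OF y(2)] self_in_shift[of "inv y \<otimes> z"] yV z by auto
        ultimately show False by blast
      qed
      then show "y \<in> V \<and> (y <# K) \<inter> P \<noteq> {}" using yV by simp
    qed
    then show ?thesis using finite_translates_meeting[OF K_fin P(1) K_V PV] finite_subset by blast
  qed
  have pow: "x [^] n \<in> M \<and> (x [^] n) <# K \<subseteq> i" if x: "x \<in> V" "x <# K \<subseteq> i" "i \<in> I" "i \<noteq> q" "n \<ge> 1" for x i and n :: nat
    using \<open>n \<ge> 1\<close>
  proof (induction n rule: dec_induct)
    case base
    have "x \<in> M" using MI x by blast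
    then show ?case using x by simp
  next
    case (step n)
    let ?y = "x [^] n"
    have xM: "x \<in> M" using MI x by blast
    obtain i' where i': "i' \<in> I" "?y <# K \<subseteq> i'" "?y <# (V - q) \<subseteq> i'" using Mtype step by blast
    have yy: "?y \<in> ?y <# K" using x by (intro self_in_shift) auto
    have "i' = i"
    proof (rule ccontr)
      assume "i' \<noteq> i"
      then have "i' \<inter> i = {}" using I_disjoint i' x by blast
      then show False using yy i' step by blast
    qed
    then have "(x [^] Suc n) <# K \<subseteq> i" using Mmult_sub[of ?y x i] xM step i' by simp
    then show ?case using Mmult[of ?y x] xM step by simp
  qed
  obtain i1 where i1: "i1 \<in> I" "i1 \<noteq> q" using other_component[of "{q}"] by auto
  obtain i2 where i2: "i2 \<in> I" "i2 \<notin> {q, i1}" using other_component[of "{q, i1}"] i1(2)[symmetric] by (auto simp: card_insert_if)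
  obtain a where a: "a \<in> i1" "a <# K \<subseteq> i1" using deep_cut[OF i1(1)] by auto
  obtain c where c: "c \<in> i2" "c <# K \<subseteq> i2" using deep_cut[OF i2(1)] by auto
  have aV: "a \<in> V" and cV: "c \<in> V" using a c i1 i2 I_V by auto
  have aM: "a [^] n \<in> M" "a [^] n \<in> i1" if "n \<ge> 1" for n :: nat
    using pow[OF aV a(2) i1 that] self_in_shift[of "a [^] n"] aV by auto
  have cM: "c [^] n \<in> M" "c [^] n \<in> i2" if "n \<ge> 1" for n :: nat
    using pow[OF cV c(2) i2(1) _ that] i2 self_in_shift[of "c [^] n"] cV by auto
  have c_inj: "inj (\<lambda>n::nat. c [^] n)"
    using cM one by (intro pow_inj_if_no_torsion[OF cV]) metis
  have fin_exps: "finite {m::nat. a [^] k \<otimes> inv (c [^] m) \<in> M}" if "k \<ge> 1" for k :: nat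
  proof -
    let ?F = "{y \<in> M. inv y \<otimes> a [^] k \<in> M}"
    have "finite {m::nat. m \<ge> 1 \<and> a [^] k \<otimes> inv (c [^] m) \<in> M}"
    proof (rule finite_imageD)
      show "finite ((\<lambda>m. a [^] k \<otimes> inv (c [^] m)) ` {m::nat. m \<ge> 1 \<and> a [^] k \<otimes> inv (c [^] m) \<in> M})"
      proof (rule finite_subset[OF _ Mfin[of "a [^] k"]])
        have "inv (a [^] k \<otimes> inv (c [^] m)) \<otimes> a [^] k = c [^] m" for m :: nat
          using aV cV by (simp add: inv_mult_group m_assoc)
        then show "(\<lambda>m. a [^] k \<otimes> inv (c [^] m)) ` {m::nat. m \<ge> 1 \<and> a [^] k \<otimes> inv (c [^] m) \<in> M} \<subseteq> ?F"
          using cM by auto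
      qed (use aV in simp)
      show "inj_on (\<lambda>m. a [^] k \<otimes> inv (c [^] m)) {m::nat. m \<ge> 1 \<and> a [^] k \<otimes> inv (c [^] m) \<in> M}"
      proof (rule inj_onI)
        fix m n :: nat assume "a [^] k \<otimes> inv (c [^] m) = a [^] k \<otimes> inv (c [^] n)"
        then have "inv (c [^] m) = inv (c [^] n)" using aV cV by simp
        then have "c [^] m = c [^] n" using cV by (metis inv_inv nat_pow_closed)
        then show "m = n" using c_inj by (simp add: inj_def)
      qed
    qed
    then show ?thesis by (rule finite_subset[rotated, OF finite_insert[THEN iffD2]]) (auto simp: not_less_eq_eq)
  qed
  define T where "T = near \<union> (\<lambda>u. inv u) ` {u \<in> M. inv u \<otimes> c \<in> M}"
  have finT: "finite T" using finite_near Mfin[OF cV] by (simp add: T_def)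
  have "\<exists>n::nat. a [^] k \<otimes> inv (c [^] n) \<in> T" if k: "k \<ge> 1" for k :: nat
  proof -
    \<comment> \<open>At the last exponent \<open>m\<close> with \<open>a\<^sup>k c\<^sup>-\<^sup>m \<in> M\<close>, either the next quotient is near, or \<open>c\<close> factors in \<open>M\<close>
      through the inverse of the next quotient; there are finitely many such factorisations.\<close>
    let ?A = "{m::nat. a [^] k \<otimes> inv (c [^] m) \<in> M}"
    have "0 \<in> ?A" using aM[OF k] aV by simp
    define m where "m = Max ?A"
    have "?A \<noteq> {}" using \<open>0 \<in> ?A\<close> by (metis empty_iff)
    then have m: "m \<in> ?A" unfolding m_def by (rule Max_in[OF fin_exps[OF k]])
    have "Suc m \<notin> ?A" using Max_ge[OF fin_exps[OF k], of "Suc m"] unfolding m_def by auto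
    then have "a [^] k \<otimes> inv (c [^] Suc m) \<in> near \<or> c [^] Suc m \<otimes> inv (a [^] k) \<in> M"
      using Mquot[OF aM(1)[OF k] cM(1)[of "Suc m"]] by auto
    then have "a [^] k \<otimes> inv (c [^] Suc m) \<in> T"
    proof
      let ?u = "c [^] Suc m \<otimes> inv (a [^] k)"
      assume u: "?u \<in> M"
      have pc: "c [^] Suc m = c \<otimes> c [^] m" using cV by (metis nat_pow_Suc2)
      have uinv: "inv ?u = a [^] k \<otimes> inv (c [^] Suc m)" using aV cV by (simp add: inv_mult_group del: nat_pow_Suc)
      also have "\<dots> = a [^] k \<otimes> inv (c [^] m) \<otimes> inv c"
        unfolding pc using aV cV by (simp add: inv_mult_group m_assoc)
      finally have "inv ?u \<otimes> c = a [^] k \<otimes> inv (c [^] m)" using aV cV by (simp add: m_assoc)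
      then have "inv ?u \<otimes> c \<in> M" using m by simp
      then show ?thesis using u uinv unfolding T_def by (metis (mono_tags, lifting) UnI2 image_eqI mem_Collect_eq)
    qed (simp add: T_def)
    then show ?thesis by blast
  qed
  then obtain f where f: "\<And>k::nat. k \<ge> 1 \<Longrightarrow> a [^] k \<otimes> inv (c [^] (f k :: nat)) \<in> T" by metis
  have "\<not> inj_on (\<lambda>k. a [^] k \<otimes> inv (c [^] (f k))) {1::nat..}"
    using f finT by (intro notI) (metis (no_types, lifting) atLeast_iff finite_imageD finite_subset image_subsetI infinite_Ici)
  then obtain k k' where "k \<ge> 1" "k' \<ge> 1" "k \<noteq> k'" "a [^] k \<otimes> inv (c [^] (f k)) = a [^] k' \<otimes> inv (c [^] (f k'))"
    by (auto simp: inj_on_def)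
  then obtain k k' where kk: "k \<ge> 1" "k < k'" "a [^] k \<otimes> inv (c [^] (f k)) = a [^] k' \<otimes> inv (c [^] (f k'))"
    by (metis nat_neq_iff)
  define p where "p = k' - k"
  have p: "p \<ge> 1" "a [^] k' = a [^] k \<otimes> a [^] p" using kk aV by (auto simp: p_def nat_pow_mult)
  then have "a [^] k \<otimes> inv (c [^] (f k)) = a [^] k \<otimes> (a [^] p \<otimes> inv (c [^] (f k')))"
    using kk aV cV by (simp add: m_assoc)
  then have "inv (c [^] (f k)) = a [^] p \<otimes> inv (c [^] (f k'))" using aV cV by simp
  then have eq: "inv (c [^] (f k)) \<otimes> c [^] (f k') = a [^] p"
    using aV cV by (simp add: m_assoc)
  have "i1 \<inter> i2 = {}" using I_disjoint i1 i2 by auto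
  show False
  proof (cases "f k < f k'")
    case True
    then have "c [^] (f k') = c [^] (f k) \<otimes> c [^] (f k' - f k)" using cV by (simp add: nat_pow_mult)
    then have "a [^] p = c [^] (f k' - f k)" using eq cV by (simp add: m_assoc[symmetric])
    then show False using aM(2)[OF p(1)] cM(2)[of "f k' - f k"] True \<open>i1 \<inter> i2 = {}\<close> by auto
  next
    case False
    then have "c [^] (f k) = c [^] (f k') \<otimes> c [^] (f k - f k')" using cV by (simp add: nat_pow_mult)
    then have "a [^] p = inv (c [^] (f k - f k'))" using eq cV by (simp add: m_assoc inv_mult_group)
    then have *: "inv (c [^] (f k - f k')) \<in> M" using aM(1)[OF p(1)] by simp
    show False
    proof (cases "f k = f k'")
      case True then show False using * one by simp
    next
      case False
      then have "f k - f k' \<ge> 1" using \<open>\<not> f k < f k'\<close> by auto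
      then show False using * cM Minv by blast
    qed
  qed
qed

lemma joins_all: "i \<in> I \<Longrightarrow> j \<in> I \<Longrightarrow> joins i j"
  using joins_dichotomy not_star by metis

lemma joins_elem:
  assumes "i \<in> I" "j \<in> I" obtains g where "g \<in> V" "g <# (V - j) \<subseteq> i"
proof -
  obtain g where "far g" "g <# K \<subseteq> i" "inv g <# K \<subseteq> j" using joins_all[OF assms] by (auto simp: joins_def)
  then show thesis using that nest[of g i j] assms I_comps far_V by blast
qed

text \<open>Two translations contract the complement of \<open>D\<close> into two further, disjoint components.\<close>

lemma spread_compl_component:
  assumes D: "D \<in> I" shows "spread (V - D)"
proof -
  obtain i1 where i1: "i1 \<in> I" "i1 \<noteq> D" using other_component[of "{D}"] by auto
  obtain i2 where i2: "i2 \<in> I" "i2 \<notin> {D, i1}" using other_component[of "{D, i1}"] i1(2)[symmetric] by (auto simp: card_insert_if)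
  obtain a where a: "a \<in> V" "a <# (V - D) \<subseteq> i1" using joins_elem i1 D by blast
  obtain b where b: "b \<in> V" "b <# (V - D) \<subseteq> i2" using joins_elem i2 D by blast
  have "i1 \<inter> D = {}" "i2 \<inter> D = {}" "i1 \<inter> i2 = {}" using I_disjoint i1 i2 D by auto
  then show ?thesis using a b I_V[OF i1(1)] I_V[OF i2(1)] K_one component_props[OF I_comps[OF D]]
    by (intro spreadI_pingpong[of _ a b]) auto
qed

end

section \<open>Elements of bounded displacement\<close>

locale faithful_cut = cut +
  assumes no_finite_normal: "\<And>N. N \<lhd> G \<Longrightarrow> finite N \<Longrightarrow> N = {\<one>}"

context group
begin

text \<open>Elements with finitely many conjugates. Equivalently, left multiplication by \<open>q\<close> moves the
  points of the Cayley graph by a bounded amount, since \<open>q b = b (b\<inverse> q b)\<close>.\<close>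

definition fc_center :: "'a set" where
  "fc_center = {q \<in> carrier G. finite ((\<lambda>b. inv b \<otimes> q \<otimes> b) ` carrier G)}"

lemma fc_center_normal: "fc_center \<lhd> G"
proof (rule normalI)
  show "subgroup fc_center G"
  proof (rule subgroupI)
    show "fc_center \<subseteq> carrier G" by (auto simp: fc_center_def)
    have "(\<lambda>b. inv b \<otimes> \<one> \<otimes> b) ` carrier G \<subseteq> {\<one>}" by auto
    then have "finite ((\<lambda>b. inv b \<otimes> \<one> \<otimes> b) ` carrier G)" by (rule finite_subset) simp
    then have "\<one> \<in> fc_center" by (simp add: fc_center_def)
    then show "fc_center \<noteq> {}" by blast
  next
    fix q assume q: "q \<in> fc_center"
    have "inv b \<otimes> inv q \<otimes> b = inv (inv b \<otimes> q \<otimes> b)" if "b \<in> carrier G" for b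
      using that q by (simp add: fc_center_def inv_mult_group m_assoc)
    then have "(\<lambda>b. inv b \<otimes> inv q \<otimes> b) ` carrier G \<subseteq> (\<lambda>x. inv x) ` (\<lambda>b. inv b \<otimes> q \<otimes> b) ` carrier G"
      by auto
    then show "inv q \<in> fc_center" using q finite_subset by (auto simp: fc_center_def)
  next
    fix p q assume pq: "p \<in> fc_center" "q \<in> fc_center"
    have "inv b \<otimes> (p \<otimes> q) \<otimes> b = (inv b \<otimes> p \<otimes> b) \<otimes> (inv b \<otimes> q \<otimes> b)" if "b \<in> carrier G" for b
    proof -
      have "b \<otimes> (inv b \<otimes> (q \<otimes> b)) = q \<otimes> b" using that pq by (simp add: fc_center_def m_assoc[symmetric])
      then show ?thesis using that pq by (simp add: fc_center_def m_assoc)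
    qed
    then have "(\<lambda>b. inv b \<otimes> (p \<otimes> q) \<otimes> b) ` carrier G \<subseteq>
        (\<lambda>(x, y). x \<otimes> y) ` (((\<lambda>b. inv b \<otimes> p \<otimes> b) ` carrier G) \<times> ((\<lambda>b. inv b \<otimes> q \<otimes> b) ` carrier G))"
      by force
    moreover have "finite \<dots>" using pq by (auto simp: fc_center_def)
    ultimately have "finite ((\<lambda>b. inv b \<otimes> (p \<otimes> q) \<otimes> b) ` carrier G)" by (rule finite_subset)
    then show "p \<otimes> q \<in> fc_center" using pq by (simp add: fc_center_def)
  qed
next
  show "\<forall>x\<in>carrier G. fc_center #> x = x <# fc_center"
  proof
    fix x assume x: "x \<in> carrier G"
    have conj: "inv y \<otimes> q \<otimes> y \<in> fc_center" if "q \<in> fc_center" "y \<in> carrier G" for q y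
    proof -
      have "inv b \<otimes> (inv y \<otimes> q \<otimes> y) \<otimes> b = inv (y \<otimes> b) \<otimes> q \<otimes> (y \<otimes> b)" if "b \<in> carrier G" for b
        using that \<open>q \<in> fc_center\<close> \<open>y \<in> carrier G\<close> by (simp add: fc_center_def inv_mult_group m_assoc)
      then have "(\<lambda>b. inv b \<otimes> (inv y \<otimes> q \<otimes> y) \<otimes> b) ` carrier G \<subseteq> (\<lambda>b. inv b \<otimes> q \<otimes> b) ` carrier G"
        using that by auto
      then show ?thesis using that finite_subset by (auto simp: fc_center_def)
    qed
    show "fc_center #> x = x <# fc_center"
    proof (intro equalityI subsetI)
      fix z assume "z \<in> fc_center #> x"
      then obtain q where q: "q \<in> fc_center" "z = q \<otimes> x" by (auto simp: r_coset_def)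
      have qc: "q \<in> carrier G" using q by (simp add: fc_center_def)
      have "x \<otimes> (inv x \<otimes> q \<otimes> x) = q \<otimes> x" using qc x by (simp add: m_assoc[symmetric])
      then show "z \<in> x <# fc_center" using conj[OF q(1) x] q by (metis l_coset_memI)
    next
      fix z assume "z \<in> x <# fc_center"
      then obtain q where q: "q \<in> fc_center" "z = x \<otimes> q" by (auto simp: l_coset_def)
      have qc: "q \<in> carrier G" using q by (simp add: fc_center_def)
      have "inv (inv x) \<otimes> q \<otimes> inv x \<in> fc_center" using conj[OF q(1)] x by blast
      moreover have "(inv (inv x) \<otimes> q \<otimes> inv x) \<otimes> x = z" using q qc x by (simp add: m_assoc)
      ultimately show "z \<in> fc_center #> x" by (auto simp: r_coset_def)
    qed
  qed
qed

end

context cut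
begin

text \<open>A far \<open>f\<close> maps the complement of some \<open>j\<close> into some \<open>i\<close>. If its displacement is bounded, then it
  fixes each further component \<open>k\<close> up to a bounded neighbourhood, and a deep point of \<open>k\<close> stays in \<open>k\<close>.
  Hence the elements with finitely many conjugates form a finite normal subgroup.\<close>

lemma fc_center_near: "fc_center \<subseteq> near"
proof
  fix f assume f: "f \<in> fc_center"
  have fV: "f \<in> V" using f by (simp add: fc_center_def)
  show "f \<in> near"
  proof (rule ccontr)
    assume "f \<notin> near"
    then have "far f" using fV by (simp add: near_def)
    then obtain i j where ij: "i \<in> I" "j \<in> I" "f <# (V - j) \<subseteq> i" by (rule far_type)
    have "card {i, j} < 4" by (simp add: card_insert_if)
    then obtain k where k: "k \<in> I" "k \<noteq> i" "k \<noteq> j" using other_component[of "{i, j}"] by auto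
    let ?Q = "(\<lambda>b. inv b \<otimes> f \<otimes> b) ` V"
    have "finite ?Q" "?Q \<subseteq> V" using f fV by (auto simp: fc_center_def)
    then obtain P where P: "finite P" "conn P" "\<one> \<in> P" "?Q \<subseteq> P" using finite_conn_superset by blast
    obtain c where c: "c \<in> k" "c <# P \<subseteq> k" using deep_point[OF k(1) P(1-3)] by auto
    have cV: "c \<in> V" using c I_V k by auto
    have "inv c \<otimes> f \<otimes> c \<in> P" using P(4) cV by auto
    then have "c \<otimes> (inv c \<otimes> f \<otimes> c) \<in> k" using c(2) l_coset_memI by blast
    then have "f \<otimes> c \<in> k" using cV fV by (simp add: m_assoc[symmetric])
    moreover have "c \<in> V - j" using I_disjoint[OF k(1) ij(2) k(3)] c cV by blast
    then have "f \<otimes> c \<in> i" using ij(3) l_coset_memI[of c "V - j" f] by auto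
    ultimately show False using I_disjoint[OF k(1) ij(1) k(2)] by blast
  qed
qed

end

context faithful_cut
begin

lemma fc_center_trivial: "fc_center = {\<one>}"
  using no_finite_normal[OF fc_center_normal] fc_center_near finite_near finite_subset by blast

text \<open>Otherwise \<open>c\<inverse> f c\<close> would be near for all \<open>c\<close> deep in \<open>D\<close>. As \<open>D\<close> contains arbitrarily large balls
  and there are finitely many near elements, one of the values \<open>q = d\<inverse> f d\<close> would work for balls of every
  size, so that \<open>q\<close> would be a non-trivial element with finitely many conjugates.\<close>

lemma unbounded_displacement:
  assumes D: "D \<in> I" and f: "f \<in> V" "f \<noteq> \<one>"
  shows "\<exists>c\<in>V. c <# K \<subseteq> D \<and> far (inv c \<otimes> f \<otimes> c)"
proof (rule ccontr)
  assume contra: "\<not> ?thesis"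
  have *: "inv c \<otimes> f \<otimes> c \<in> near" if "c \<in> V" "c <# K \<subseteq> D" for c
    using contra that f by (auto simp: near_def)
  have ball: "\<exists>q\<in>near - {\<one>}. \<forall>b\<in>B. inv b \<otimes> q \<otimes> b \<in> near" if B: "finite B" "B \<subseteq> V" for B
  proof -
    let ?U = "\<Union>b\<in>insert \<one> B. b <# K"
    have "finite ?U" "?U \<subseteq> V"
      using B K_fin K_V by (auto simp: finite_l_coset l_coset_eq_image)
    from finite_conn_superset[OF this]
    obtain P where P: "finite P" "conn P" "\<one> \<in> P" "?U \<subseteq> P" by (elim exE conjE) (rule that)
    obtain d where d: "d \<in> D" "d <# P \<subseteq> D" using deep_point[OF D P(1-3)] by auto
    have dV: "d \<in> V" using d(1) I_V[OF D] by blast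
    have near: "inv b \<otimes> (inv d \<otimes> f \<otimes> d) \<otimes> b \<in> near" if "b \<in> insert \<one> B" for b
    proof -
      have bV: "b \<in> V" using that B by auto
      have "b <# K \<subseteq> P" using P(4) that by (simp only: UN_subset_iff)
      then have "d <# (b <# K) \<subseteq> D" using d(2) l_coset_mono[of "b <# K" P d] by blast
      then have "inv (d \<otimes> b) \<otimes> f \<otimes> (d \<otimes> b) \<in> near" using dV bV K_V by (intro *) (auto simp: lcos_m_assoc)
      then show ?thesis using dV bV f by (simp add: inv_mult_group m_assoc)
    qed
    have "inv d \<otimes> f \<otimes> d \<in> near" using near[of \<one>] dV f by simp
    moreover have "inv d \<otimes> f \<otimes> d \<noteq> \<one>"
    proof
      assume "inv d \<otimes> f \<otimes> d = \<one>"
      then have "d \<otimes> (inv d \<otimes> f \<otimes> d) \<otimes> inv d = d \<otimes> \<one> \<otimes> inv d" by simp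
      moreover have "d \<otimes> (inv d \<otimes> f \<otimes> d) \<otimes> inv d = f" using dV f by (simp add: m_assoc mult_inv_cancel)
      ultimately show False using f dV by simp
    qed
    ultimately show ?thesis using near by blast
  qed
  have "\<exists>q\<in>near - {\<one>}. \<forall>b\<in>V. inv b \<otimes> q \<otimes> b \<in> near"
  proof (rule ccontr)
    assume "\<not> ?thesis"
    then obtain b where b: "\<And>q. q \<in> near - {\<one>} \<Longrightarrow> b q \<in> V \<and> inv (b q) \<otimes> q \<otimes> b q \<notin> near" by metis
    have "\<exists>q\<in>near - {\<one>}. \<forall>x\<in>b ` (near - {\<one>}). inv x \<otimes> q \<otimes> x \<in> near"
      using finite_near b by (intro ball) auto
    then show False using b by blast
  qed
  then obtain q where q: "q \<in> near" "q \<noteq> \<one>" "\<And>b. b \<in> V \<Longrightarrow> inv b \<otimes> q \<otimes> b \<in> near" by auto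
  have "finite ((\<lambda>b. inv b \<otimes> q \<otimes> b) ` V)" using q(3) by (intro finite_subset[OF _ finite_near]) auto
  then have "q \<in> fc_center" using q(1) by (simp add: fc_center_def near_def)
  then show False using fc_center_trivial q(2) by simp
qed

text \<open>The elements of \<open>\<Phi>\<close> are treated one at a time, passing to a smaller half-space each time. If \<open>f\<close>
  displaces a cut \<open>c K\<close> inside \<open>g j\<close>, then \<open>f\<close> also displaces each half-space at \<open>c K\<close> other than the
  one that contains \<open>f c K\<close> and the one whose image under \<open>f\<close> contains \<open>c K\<close>. A third half-space at \<open>c K\<close> is excluded, the one
  that is not contained in \<open>g j\<close>.\<close>

lemma moved_half_space:
  assumes "finite \<Phi>" "\<Phi> \<subseteq> V - {\<one>}" and D: "D \<in> I"
  shows "\<exists>g\<in>V. \<exists>j\<in>I. g <# j \<subseteq> D \<and> (\<forall>f\<in>\<Phi>. (f <# (g <# j)) \<inter> (g <# j) = {})"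
  using assms(1,2)
proof (induction \<Phi> rule: finite_induct)
  case empty
  then show ?case using D I_V by (intro bexI[of _ \<one>] bexI[of _ D]) (auto simp: lcos_mult_one)
next
  case (insert f \<Phi>)
  then obtain g j where gj: "g \<in> V" "j \<in> I" "g <# j \<subseteq> D" "\<forall>f\<in>\<Phi>. (f <# (g <# j)) \<inter> (g <# j) = {}" by auto
  have fV: "f \<in> V" "f \<noteq> \<one>" using insert by auto
  \<comment> \<open>Conjugating by \<open>g\<close> replaces the half-space \<open>g j\<close> by the component \<open>j\<close>.\<close>
  define f' where "f' = inv g \<otimes> f \<otimes> g"
  have f': "f' \<in> V" "f' \<noteq> \<one>"
  proof -
    show "f' \<in> V" using fV gj by (simp add: f'_def)
    have "g \<otimes> f' \<otimes> inv g = f" using fV gj by (simp add: f'_def m_assoc mult_inv_cancel)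
    then show "f' \<noteq> \<one>" using fV gj by auto
  qed
  obtain c where c: "c \<in> V" "c <# K \<subseteq> j" "far (inv c \<otimes> f' \<otimes> c)" using unbounded_displacement[OF gj(2) f'] by auto
  define u where "u = inv c \<otimes> f' \<otimes> c"
  have uV: "u \<in> V" using c f' by (simp add: u_def)
  obtain a b where ab: "a \<in> I" "b \<in> I" "u <# (V - b) \<subseteq> a" using c(3) unfolding u_def[symmetric] by (rule far_type)
  have "far c" using c gj I_comps by (intro farI_component[of _ j]) auto
  then obtain j' e where e: "j' \<in> I" "e \<in> I" "c <# K \<subseteq> j'" "c <# (V - e) \<subseteq> j'" by (rule far_type)
  have "j' = j" using I_disjoint[OF e(1) gj(2)] e(3) c(2) self_in_shift[OF c(1)] by blast
  have "card {a, b, e} < 4" by (simp add: card_insert_if)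
  then obtain k where k: "k \<in> I" "k \<noteq> a" "k \<noteq> b" "k \<noteq> e" using other_component[of "{a, b, e}"] by auto
  have kV: "k \<subseteq> V" using k I_V by auto
  have jV: "j \<subseteq> V" using gj I_V by auto
  have ckV: "c <# k \<subseteq> V" using kV c by (simp add: l_coset_subset_G)
  have ck: "c <# k \<subseteq> j"
    using l_coset_mono[of k "V - e" c] I_disjoint[OF k(1) e(2) k(4)] kV e(4) \<open>j' = j\<close> by blast
  have "u <# k \<subseteq> a" using l_coset_mono[of k "V - b" u] I_disjoint[OF k(1) ab(2) k(3)] kV ab(3) by blast
  then have "(u <# k) \<inter> k = {}" using I_disjoint[OF k(1) ab(1) k(2)] by blast
  then have "(c <# (u <# k)) \<inter> (c <# k) = {}" using c uV kV by (simp add: l_coset_disjoint_iff l_coset_subset_G)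
  moreover have "c \<otimes> u = f' \<otimes> c" using c f' by (simp add: u_def m_assoc[symmetric])
  then have "c <# (u <# k) = f' <# (c <# k)" using c uV f' kV by (simp add: lcos_m_assoc)
  ultimately have "(f' <# (c <# k)) \<inter> (c <# k) = {}" by simp
  then have "(g <# (f' <# (c <# k))) \<inter> (g <# (c <# k)) = {}"
    using gj f' ckV by (simp add: l_coset_disjoint_iff l_coset_subset_G)
  moreover have "g \<otimes> f' = f \<otimes> g" using gj fV by (simp add: f'_def m_assoc[symmetric])
  then have "g <# (f' <# (c <# k)) = f <# (g <# (c <# k))" using gj f' fV ckV by (simp add: lcos_m_assoc)
  ultimately have new: "(f <# (g <# (c <# k))) \<inter> (g <# (c <# k)) = {}" by simp
  have sub: "g <# (c <# k) \<subseteq> g <# j" using ck by (rule l_coset_mono)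
  have "(f1 <# (g <# (c <# k))) \<inter> (g <# (c <# k)) = {}" if "f1 \<in> insert f \<Phi>" for f1
  proof (cases "f1 = f")
    case False
    then have "(f1 <# (g <# j)) \<inter> (g <# j) = {}" using that gj by blast
    then show ?thesis using sub l_coset_mono[OF sub, of f1] by blast
  qed (use new in simp)
  moreover have "(g \<otimes> c) <# k = g <# (c <# k)" using gj c kV by (simp add: lcos_m_assoc)
  ultimately show ?case using gj c sub k by (intro bexI[of _ "g \<otimes> c"] bexI[of _ k]) auto
qed

text \<open>A non-trivial \<open>f\<close> with \<open>f K\<close> meeting \<open>K\<close> displaces suitable cuts deeper inside \<open>D\<close>; as there are
  finitely many such \<open>f\<close>, one cut serves all of them.\<close>

lemma moved_cut:
  assumes D: "D \<in> I"
  shows "\<exists>c\<in>V. c <# K \<subseteq> D \<and> (\<forall>f\<in>near - {\<one>}. (f <# (c <# K)) \<inter> (c <# K) = {})"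
proof -
  have "near - {\<one>} \<subseteq> V - {\<one>}" by (auto simp: near_def)
  then obtain g j where gj: "g \<in> V" "j \<in> I" "g <# j \<subseteq> D" "\<forall>f\<in>near - {\<one>}. (f <# (g <# j)) \<inter> (g <# j) = {}"
    using moved_half_space[of "near - {\<one>}" D] finite_near D by auto
  obtain d where d: "d \<in> j" "d <# K \<subseteq> j" using deep_cut[OF gj(2)] by auto
  have dV: "d \<in> V" using d(1) I_V[OF gj(2)] by blast
  have eq: "(g \<otimes> d) <# K = g <# (d <# K)" using gj dV K_V by (simp add: lcos_m_assoc)
  have sub: "g <# (d <# K) \<subseteq> g <# j" using d(2) by (rule l_coset_mono)
  show ?thesis
  proof (intro bexI[of _ "g \<otimes> d"] conjI ballI)
    show "(g \<otimes> d) <# K \<subseteq> D" using eq sub gj by blast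
    fix f assume "f \<in> near - {\<one>}"
    then have "(f <# (g <# j)) \<inter> (g <# j) = {}" using gj by blast
    then show "(f <# ((g \<otimes> d) <# K)) \<inter> ((g \<otimes> d) <# K) = {}" unfolding eq using sub l_coset_mono[OF sub, of f] by blast
  qed (use gj dV in auto)
qed

end

section \<open>Separating a subgroup of infinite index\<close>

context group
begin

text \<open>Up to left multiplication by \<open>H\<close>, only the finitely many starting points in \<open>Q\<close> matter, and each of
  them can be moved to one and the same point outside the proper subset \<open>H Q\<close>.\<close>

lemma infinite_index_escape:
  assumes H: "subgroup H G" and inf: "infinite (rcosets H)" and Q: "finite Q" "Q \<subseteq> carrier G"
  shows "\<exists>C. finite C \<and> C \<subseteq> carrier G \<and> (\<forall>p\<in>carrier G. \<exists>c\<in>C. p \<otimes> c \<notin> H <#> Q)"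
proof -
  have HV: "H \<subseteq> carrier G" using H by (rule subgroup.subset)
  have "\<exists>v\<in>carrier G. v \<notin> H <#> Q"
  proof (rule ccontr)
    assume *: "\<not> ?thesis"
    have "rcosets H \<subseteq> (\<lambda>q. H #> q) ` Q"
    proof
      fix X assume "X \<in> rcosets H"
      then obtain x where x: "x \<in> carrier G" "X = H #> x" by (auto simp: RCOSETS_def)
      then obtain h q where hq: "h \<in> H" "q \<in> Q" "x = h \<otimes> q" using * by (auto simp: set_mult_def)
      have "x \<in> H #> q" using hq by (auto simp: r_coset_def)
      then have "H #> q = H #> x" using hq Q H by (intro repr_independence) auto
      then show "X \<in> (\<lambda>q. H #> q) ` Q" using x hq by auto
    qed
    then show False using inf Q finite_subset by blast
  qed
  then obtain v where v: "v \<in> carrier G" "v \<notin> H <#> Q" by auto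
  show ?thesis
  proof (intro exI conjI ballI)
    show "finite (insert \<one> ((\<lambda>q. inv q \<otimes> v) ` Q))" using Q by simp
    show "insert \<one> ((\<lambda>q. inv q \<otimes> v) ` Q) \<subseteq> carrier G" using Q v by auto
    fix p assume p: "p \<in> carrier G"
    show "\<exists>c\<in>insert \<one> ((\<lambda>q. inv q \<otimes> v) ` Q). p \<otimes> c \<notin> H <#> Q"
    proof (cases "p \<in> H <#> Q")
      case True
      then obtain h q where hq: "h \<in> H" "q \<in> Q" "p = h \<otimes> q" by (auto simp: set_mult_def)
      have c: "h \<in> carrier G" "q \<in> carrier G" using hq HV Q by auto
      have "p \<otimes> (inv q \<otimes> v) = h \<otimes> v" using hq c v by (simp add: m_assoc mult_inv_cancel)
      moreover have "h \<otimes> v \<notin> H <#> Q"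
      proof
        assume "h \<otimes> v \<in> H <#> Q"
        then obtain h' q' where hq': "h' \<in> H" "q' \<in> Q" "h \<otimes> v = h' \<otimes> q'" by (auto simp: set_mult_def)
        have c': "h' \<in> carrier G" "q' \<in> carrier G" using hq' HV Q by auto
        have "inv h \<otimes> (h \<otimes> v) = inv h \<otimes> (h' \<otimes> q')" using hq' by simp
        then have "v = (inv h \<otimes> h') \<otimes> q'" using v c c' by (simp add: mult_inv_cancel m_assoc)
        moreover have "inv h \<otimes> h' \<in> H"
          using hq(1) hq'(1) H by (simp add: subgroup.m_closed subgroup.m_inv_closed)
        ultimately show False using v hq'(2) by (auto simp: set_mult_def)
      qed
      ultimately have "p \<otimes> (inv q \<otimes> v) \<notin> H <#> Q" by simp
      then show ?thesis using hq(2) by blast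
    qed (use p in auto)
  qed
qed

end

context cayley_graph
begin

text \<open>A subgroup with a connected invariant set around it. The set replaces a subgroup, which
  need not be connected in the given Cayley graph, by something that lies on one side of each cut
  that misses it.\<close>

definition envelope :: "'a set \<Rightarrow> 'a set \<Rightarrow> bool" where
  "envelope H N \<longleftrightarrow> subgroup H G \<and> conn N \<and> \<one> \<in> N \<and> (\<forall>h\<in>H. h <# N \<subseteq> N)"

lemma envelope_subgroup_subset: "envelope H N \<Longrightarrow> H \<subseteq> N"
proof
  fix h assume h: "envelope H N" "h \<in> H"
  then have "h \<otimes> \<one> \<in> h <# N" by (intro l_coset_memI) (simp add: envelope_def)
  then show "h \<in> N" using h subgroup.mem_carrier[of H G h] by (auto simp: envelope_def)
qed

text \<open>The translates \<open>h P\<close> and \<open>h a P\<close> have the point \<open>h a\<close> in common for each generator \<open>a\<close>.\<close>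

lemma envelope_exists:
  assumes A: "A \<subseteq> V" "A \<subseteq> P" and P: "conn P" "\<one> \<in> P"
  shows "envelope (generate G A) (generate G A <#> P)"
proof -
  let ?H = "generate G A"
  let ?N = "?H <#> P"
  have H: "subgroup ?H G" using A by (intro generate_is_subgroup)
  have HV: "?H \<subseteq> V" using H by (rule subgroup.subset)
  have PV: "P \<subseteq> V" using P conn_V by auto
  have NV: "?N \<subseteq> V" using HV PV by (rule set_mult_closed)
  have hP: "h <# P \<subseteq> ?N" if "h \<in> ?H" for h using that by (auto simp: l_coset_def set_mult_def)
  have inv: "h <# ?N \<subseteq> ?N" if h: "h \<in> ?H" for h
  proof
    fix y assume "y \<in> h <# ?N"
    then obtain k p where kp: "k \<in> ?H" "p \<in> P" "y = h \<otimes> (k \<otimes> p)" by (auto simp: l_coset_def set_mult_def)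
    have "y = (h \<otimes> k) \<otimes> p" using kp h HV PV by (auto simp: m_assoc subset_iff)
    then show "y \<in> ?N" using kp h subgroup.m_closed[OF H] by (auto simp: set_mult_def)
  qed
  have shiftN: "(g \<otimes> x, g \<otimes> y) \<in> (Restr E ?N)\<^sup>*" if "(x, y) \<in> (Restr E ?N)\<^sup>*" "g \<in> ?H" for g x y
    using Restr_rtrancl_mono[OF Restr_rtrancl_shift[OF that(1), of g] inv[OF that(2)]] that HV by auto
  have PN: "P \<subseteq> ?N" using hP[OF generate.one] PV by (simp add: lcos_mult_one)
  have step: "(\<one>, h) \<in> (Restr E ?N)\<^sup>*" if "h \<in> ?H" for h
    using that
  proof induction
    case one then show ?case by simp
  next
    case (incl a)
    then show ?case using P A PN Restr_rtrancl_mono[of \<one> a P ?N] unfolding conn_def by blast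
  next
    case (inv a)
    then have "(a, \<one>) \<in> (Restr E ?N)\<^sup>*" using P A PN Restr_rtrancl_mono[of a \<one> P ?N] unfolding conn_def by blast
    then have "(inv a \<otimes> a, inv a \<otimes> \<one>) \<in> (Restr E ?N)\<^sup>*" using inv by (intro shiftN) (auto intro: generate.inv)
    then show ?case using inv A by auto
  next
    case (eng h1 h2)
    then have "(h1 \<otimes> \<one>, h1 \<otimes> h2) \<in> (Restr E ?N)\<^sup>*" by (intro shiftN)
    then have "(h1, h1 \<otimes> h2) \<in> (Restr E ?N)\<^sup>*" using eng HV by auto
    with eng show ?case by (meson rtrancl_trans)
  qed
  have "conn ?N"
  proof (rule connI_star[OF NV, of \<one>])
    fix x assume "x \<in> ?N"
    then obtain h p where hp: "h \<in> ?H" "p \<in> P" "x = h \<otimes> p" by (auto simp: set_mult_def)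
    have "(p, \<one>) \<in> (Restr E ?N)\<^sup>*" using hp P PN Restr_rtrancl_mono[of p \<one> P ?N] unfolding conn_def by blast
    then have "(h \<otimes> p, h \<otimes> \<one>) \<in> (Restr E ?N)\<^sup>*" using hp by (intro shiftN)
    then have "(x, h) \<in> (Restr E ?N)\<^sup>*" using hp HV by auto
    then show "(x, \<one>) \<in> (Restr E ?N)\<^sup>*" using Restr_rtrancl_sym[OF step[OF hp(1)]] by (rule rtrancl_trans)
  qed
  then show ?thesis using H PN P inv unfolding envelope_def by blast
qed

lemma relpow_shift:
  assumes "(x, y) \<in> E ^^ n" "g \<in> V" shows "(g \<otimes> x, g \<otimes> y) \<in> E ^^ n"
  using assms(1)
proof (induction n arbitrary: y)
  case (Suc n)
  then obtain z where "(x, z) \<in> E ^^ n" "(z, y) \<in> E" by auto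
  then show ?case using Suc.IH E_shift[OF _ assms(2)] by (auto intro: relpow_Suc_I)
qed simp

text \<open>The crossing point is strictly closer to \<open>z\<close> than a starting point that is not in \<open>L\<close>; this strict
  decrease is what \<open>moved_cut_in_core\<close> needs.\<close>

lemma path_into_component_crosses:
  assumes "(v, z) \<in> E ^^ n" "z \<in> component L x" "v \<notin> component L x" "x \<in> V - L"
  shows "\<exists>y\<in>L. \<exists>m\<le>n. (y, z) \<in> E ^^ m \<and> (v \<notin> L \<longrightarrow> m < n)"
  using assms(1,3)
proof (induction n arbitrary: v)
  case 0
  then show ?case using assms(2) by simp
next
  case (Suc n)
  obtain w where w: "(v, w) \<in> E" "(w, z) \<in> E ^^ n" using relpow_Suc_D2[OF Suc.prems(1)] by blast
  show ?case
  proof (cases "v \<in> L")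
    case True
    then show ?thesis using Suc.prems by blast
  next
    case False
    have "w \<notin> component L x"
      using comp_neighbour[OF _ assms(4) E_sym[OF w(1)] False] Suc.prems by blast
    then obtain y m where "y \<in> L" "m \<le> n" "(y, z) \<in> E ^^ m" using Suc.IH w by blast
    then show ?thesis by (intro bexI[of _ y] exI[of _ m]) auto
  qed
qed

end

context cut
begin

text \<open>The side of the cut \<open>x K\<close> on which the subgroups under consideration lie.\<close>

definition core :: "'a \<Rightarrow> 'a set" where
  "core x = component (x <# K) \<one>"

definition separates :: "'a set \<Rightarrow> 'a set \<Rightarrow> 'a \<Rightarrow> bool" where
  "separates H N x \<longleftrightarrow> x \<in> V \<and> (x <# K) \<inter> N = {} \<and>
     (\<forall>h\<in>H - {\<one>}. (h <# (x <# K)) \<inter> (x <# K) = {})"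

lemma shift_K_V: "x \<in> V \<Longrightarrow> x <# K \<subseteq> V"
  using K_V by (simp add: l_coset_subset_G)

lemma core_component:
  assumes "x \<in> V" "\<one> \<notin> x <# K" shows "core x \<in> components_off V E (x <# K)"
  using assms by (auto simp: core_def components_off_eq)

lemma envelope_subset_core:
  assumes "envelope H N" "(x <# K) \<inter> N = {}" shows "N \<subseteq> core x"
  unfolding core_def using assms by (intro conn_subset_comp) (auto simp: envelope_def)

text \<open>Let \<open>y\<close> be a point of \<open>x K\<close> at minimal distance from \<open>N\<close>. By invariance, \<open>h y\<close> has the same distance
  from \<open>N\<close>. If it were outside \<open>core x\<close>, then a shortest path from \<open>h y\<close> to \<open>N\<close> would cross \<open>x K\<close> at a
  point that is closer to \<open>N\<close> than \<open>y\<close>.\<close>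

lemma moved_cut_in_core:
  assumes envelope: "envelope H N" and x: "x \<in> V" "(x <# K) \<inter> N = {}" and h: "h \<in> H"
    and dis: "(h <# (x <# K)) \<inter> (x <# K) = {}"
  shows "h <# (x <# K) \<subseteq> core x"
proof -
  let ?L = "x <# K"
  have hV: "h \<in> V" using envelope h subgroup.mem_carrier by (auto simp: envelope_def)
  have one: "\<one> \<in> V - ?L" using envelope x by (auto simp: envelope_def)
  define near_path where "near_path m \<longleftrightarrow> (\<exists>y\<in>?L. \<exists>z\<in>N. (y, z) \<in> E ^^ m)" for m
  have "(x, \<one>) \<in> E\<^sup>*" using x by (intro E_connected) auto
  then obtain m0 where "(x, \<one>) \<in> E ^^ m0" using rtrancl_imp_relpow by blast
  then have "near_path m0" using envelope self_in_shift[OF x(1)] by (auto simp: near_path_def envelope_def)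
  then have least: "near_path (LEAST m. near_path m)" by (rule LeastI)
  define m where "m = (LEAST m. near_path m)"
  have min: "m \<le> m'" if "near_path m'" for m' unfolding m_def using that by (rule Least_le)
  obtain y z where yz: "y \<in> ?L" "z \<in> N" "(y, z) \<in> E ^^ m" using least[folded m_def] unfolding near_path_def by blast
  have path: "(h \<otimes> y, h \<otimes> z) \<in> E ^^ m" using yz hV by (intro relpow_shift)
  have "h \<otimes> z \<in> h <# N" using yz by (intro l_coset_memI)
  then have hz: "h \<otimes> z \<in> N" using envelope h by (auto simp: envelope_def)
  then have hz': "h \<otimes> z \<in> component ?L \<one>" using envelope_subset_core[OF envelope x(2)] by (auto simp: core_def)
  have hy: "h \<otimes> y \<in> h <# ?L" using yz by (intro l_coset_memI)
  have "h \<otimes> y \<in> component ?L \<one>"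
  proof (rule ccontr)
    assume "h \<otimes> y \<notin> component ?L \<one>"
    then obtain y' m' where "y' \<in> ?L" "(y', h \<otimes> z) \<in> E ^^ m'" "h \<otimes> y \<notin> ?L \<longrightarrow> m' < m"
      using path_into_component_crosses[OF path hz' _ one] by blast
    moreover have "h \<otimes> y \<notin> ?L" using hy dis by blast
    ultimately have "near_path m'" "m' < m" using hz by (auto simp: near_path_def)
    then show False using min[of m'] by simp
  qed
  then show ?thesis unfolding core_def using hy dis hV x K_conn
    by (intro conn_meets_comp) (auto intro: conn_shift)
qed

text \<open>The complement of \<open>core x\<close> is connected. It misses \<open>h x K\<close> by the previous lemma for \<open>h\<close>, and it meets
  \<open>h (core x)\<close> by the previous lemma for \<open>h\<inverse>\<close>.\<close>

lemma compl_core_moved: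
  assumes envelope: "envelope H N" and x: "x \<in> V" "(x <# K) \<inter> N = {}" and h: "h \<in> H"
    and dis: "(h <# (x <# K)) \<inter> (x <# K) = {}"
  shows "V - core x \<subseteq> h <# core x"
proof -
  let ?L = "x <# K"
  have LV: "?L \<subseteq> V" using x shift_K_V by blast
  have Lconn: "conn ?L" using x K_conn by (intro conn_shift)
  have H: "subgroup H G" using envelope by (simp add: envelope_def)
  have hV: "h \<in> V" using H h by (rule subgroup.mem_carrier)
  have hi: "inv h \<in> H" using H h by (rule subgroup.m_inv_closed)
  have "\<one> \<notin> ?L" using envelope x by (auto simp: envelope_def)
  then have core: "core x \<in> components_off V E ?L" using core_component x by blast
  have coreV: "core x \<subseteq> V" "core x \<inter> ?L = {}" using component_props[OF core] by auto
  have "(inv h <# ?L) \<inter> ?L = {}" using dis l_coset_disjoint_move[OF LV LV hV] by blast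
  then have "inv h <# ?L \<subseteq> core x" by (rule moved_cut_in_core[OF envelope x hi])
  then have "?L \<subseteq> h <# core x" using l_coset_subset_move[OF LV coreV(1), of "inv h"] hV by simp
  moreover have "x \<in> ?L" using x self_in_shift by auto
  ultimately have meet: "(V - core x) \<inter> (h <# core x) \<noteq> {}" using coreV x by blast
  have "h <# ?L \<subseteq> core x" by (rule moved_cut_in_core[OF envelope x h dis])
  then have "(V - core x) \<inter> (h <# ?L) = {}" by blast
  moreover have "conn (V - core x)" using conn_compl_component[OF Lconn _ core] \<open>x \<in> ?L\<close> by blast
  ultimately show ?thesis using component_shift[OF core hV LV] meet
    by (intro conn_meets_component) auto
qed

lemma separates_moved:
  assumes "envelope H N" "separates H N x" "h \<in> H" "h \<noteq> \<one>"
  shows "V - core x \<subseteq> h <# core x"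
  using assms by (intro compl_core_moved) (auto simp: separates_def)

end

context faithful_cut
begin

text \<open>From \<open>p\<close>, first go to a point \<open>g\<close> whose cut \<open>g K\<close> misses the envelope, using the infinite index. The
  elements of \<open>H\<close> that move \<open>g K\<close> off itself also move each half-space at \<open>g K\<close> away from \<open>H\<close> off
  itself. For the other elements \<open>h\<close>, the conjugate \<open>g\<inverse> h g\<close> is near, so that a cut as in
  \<open>moved_cut\<close>, further inside such a half-space, is moved off itself by them as well. Two
  components are available, and at least one of them gives a half-space away from \<open>H\<close>.\<close>

lemma separating_cuts_nearby:
  assumes H: "envelope H (H <#> P)" and inf: "infinite (rcosets H)" and P: "finite P" "P \<subseteq> V"
  shows "\<exists>C. finite C \<and> C \<subseteq> V \<and> (\<forall>p\<in>V. \<exists>c\<in>C. separates H (H <#> P) (p \<otimes> c))"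
proof -
  let ?N = "H <#> P"
  have sub: "subgroup H G" using H by (simp add: envelope_def)
  have HV: "H \<subseteq> V" using sub by (rule subgroup.subset)
  have NV: "?N \<subseteq> V" using H conn_V by (auto simp: envelope_def)
  let ?Q = "{x \<in> V. (x <# K) \<inter> P \<noteq> {}}"
  have Q: "finite ?Q" "?Q \<subseteq> V" using finite_translates_meeting K_fin K_V P by auto
  obtain C1 where C1: "finite C1" "C1 \<subseteq> V" "\<forall>p\<in>V. \<exists>c\<in>C1. p \<otimes> c \<notin> H <#> ?Q"
    using infinite_index_escape[OF sub inf Q] by blast
  obtain D1 D2 where D1: "D1 \<in> I" and D2: "D2 \<in> I" "D1 \<noteq> D2" by (rule two_components)
  obtain d1 where d1: "d1 \<in> V" "d1 <# K \<subseteq> D1" "\<forall>f\<in>near - {\<one>}. (f <# (d1 <# K)) \<inter> (d1 <# K) = {}"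
    using moved_cut[OF D1] by auto
  obtain d2 where d2: "d2 \<in> V" "d2 <# K \<subseteq> D2" "\<forall>f\<in>near - {\<one>}. (f <# (d2 <# K)) \<inter> (d2 <# K) = {}"
    using moved_cut[OF D2(1)] by auto
  let ?C = "(\<lambda>c. c \<otimes> d1) ` C1 \<union> (\<lambda>c. c \<otimes> d2) ` C1"
  show ?thesis
  proof (intro exI[of _ ?C] conjI ballI)
    show "finite ?C" "?C \<subseteq> V" using C1 d1 d2 by auto
    fix p assume p: "p \<in> V"
    then obtain c where c: "c \<in> C1" "p \<otimes> c \<notin> H <#> ?Q" using C1 by auto
    have cV: "c \<in> V" using c C1 by auto
    define g where "g = p \<otimes> c"
    have gV: "g \<in> V" using p cV by (simp add: g_def)
    have gN: "(g <# K) \<inter> ?N = {}"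
    proof (rule ccontr)
      assume "(g <# K) \<inter> ?N \<noteq> {}"
      then obtain k h r where k: "k \<in> K" "h \<in> H" "r \<in> P" "g \<otimes> k = h \<otimes> r"
        by (auto simp: l_coset_def set_mult_def)
      have V: "k \<in> V" "h \<in> V" "r \<in> V" using k K_V HV P by auto
      have "(inv h \<otimes> g) \<otimes> k = r" using k V gV by (simp add: m_assoc mult_inv_cancel)
      then have "r \<in> (inv h \<otimes> g) <# K" using k by (auto simp: l_coset_def)
      then have "inv h \<otimes> g \<in> ?Q" using k V gV by auto
      moreover have "g = h \<otimes> (inv h \<otimes> g)" using V gV by (simp add: mult_inv_cancel)
      ultimately have "g \<in> H <#> ?Q" using k(2) unfolding set_mult_def by blast
      then show False using c by (simp add: g_def)
    qed
    have "\<one> \<notin> g <# K" using gN H by (auto simp: envelope_def)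
    then have core: "core g \<in> components_off V E (g <# K)" using core_component gV by blast
    have sep: "separates H ?N (g \<otimes> d)"
      if D: "D \<in> I" "g <# D \<noteq> core g" and d: "d \<in> V" "d <# K \<subseteq> D" "\<forall>f\<in>near - {\<one>}. (f <# (d <# K)) \<inter> (d <# K) = {}" for D d
    proof -
      have DV: "D \<subseteq> V" using I_V D by auto
      have dKV: "d <# K \<subseteq> V" using d shift_K_V by auto
      have gDV: "g <# D \<subseteq> V" using DV gV by (simp add: l_coset_subset_G)
      have gdK: "(g \<otimes> d) <# K = g <# (d <# K)" using gV d K_V by (simp add: lcos_m_assoc)
      have sub: "g <# (d <# K) \<subseteq> g <# D" using d by (intro l_coset_mono)
      have "g <# D \<in> components_off V E (g <# K)" using component_shift[OF I_comps[OF D(1)] gV K_V] .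
      then have disc: "(g <# D) \<inter> core g = {}" using component_disjoint[OF _ core] D by blast
      have N: "((g \<otimes> d) <# K) \<inter> ?N = {}"
        using envelope_subset_core[OF H gN] disc sub unfolding gdK by blast
      have "(h <# ((g \<otimes> d) <# K)) \<inter> ((g \<otimes> d) <# K) = {}" if h: "h \<in> H" "h \<noteq> \<one>" for h
      proof -
        have hV: "h \<in> V" using h HV by auto
        show ?thesis
        proof (cases "(h <# (g <# K)) \<inter> (g <# K) = {}")
          case True
          then have "V - core g \<subseteq> h <# core g" by (rule compl_core_moved[OF H gV gN h(1)])
          then have "g <# D \<subseteq> h <# core g" using disc gDV by blast
          moreover have "(h <# (g <# D)) \<inter> (h <# core g) = {}"
            using disc hV gDV component_props(4)[OF core] by (simp add: l_coset_disjoint_iff)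
          ultimately have "(h <# (g <# D)) \<inter> (g <# D) = {}" by blast
          then show ?thesis using sub l_coset_mono[OF sub, of h] unfolding gdK by blast
        next
          case False
          define f where "f = inv g \<otimes> h \<otimes> g"
          have fV: "f \<in> V" using gV hV by (simp add: f_def)
          have gf: "g \<otimes> f = h \<otimes> g" using gV hV by (simp add: f_def m_assoc mult_inv_cancel)
          have "f \<noteq> \<one>"
          proof
            assume "f = \<one>"
            then have "h \<otimes> g = g" using gf gV by simp
            then show False using h gV hV by (metis r_cancel_one')
          qed
          have "g <# (f <# K) = h <# (g <# K)" using gf gV hV fV K_V by (simp add: lcos_m_assoc)
          then have "(f <# K) \<inter> K \<noteq> {}"
            using False gV fV K_V l_coset_disjoint_iff[of "f <# K" K g] by (simp add: l_coset_subset_G)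
          then have "f \<in> near - {\<one>}" using fV \<open>f \<noteq> \<one>\<close> by (simp add: near_def far_def)
          then have "(f <# (d <# K)) \<inter> (d <# K) = {}" using d by blast
          then have "(g <# (f <# (d <# K))) \<inter> (g <# (d <# K)) = {}"
            using gV fV dKV by (simp add: l_coset_disjoint_iff l_coset_subset_G)
          moreover have "g <# (f <# (d <# K)) = h <# (g <# (d <# K))"
            using gf gV hV fV dKV by (simp add: lcos_m_assoc)
          ultimately show ?thesis unfolding gdK by simp
        qed
      qed
      then show ?thesis using N gV d by (auto simp: separates_def)
    qed
    have pc: "p \<otimes> (c \<otimes> d) = g \<otimes> d" if "d \<in> V" for d using p cV that by (simp add: g_def m_assoc)
    have "g <# D1 \<noteq> g <# D2"
    proof
      assume "g <# D1 = g <# D2"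
      then have "inv g <# (g <# D1) = inv g <# (g <# D2)" by simp
      then show False using D1 D2 I_V gV by (simp add: l_coset_inv_cancel)
    qed
    then consider "g <# D1 \<noteq> core g" | "g <# D2 \<noteq> core g" by auto
    then show "\<exists>c\<in>?C. separates H ?N (p \<otimes> c)"
    proof cases
      case 1
      then have "separates H ?N (p \<otimes> (c \<otimes> d1))" using sep[OF D1 1 d1] d1 pc by simp
      then show ?thesis using c by blast
    next
      case 2
      then have "separates H ?N (p \<otimes> (c \<otimes> d2))" using sep[OF D2(1) 2 d2] d2 pc by simp
      then show ?thesis using c by blast
    qed
  qed
qed

end

section \<open>Random walks and spread sets\<close>

lemma measure_bind_pmf_finite:
  assumes "finite (set_pmf p)"
  shows "measure_pmf.prob (bind_pmf p f) X = (\<Sum>z\<in>set_pmf p. pmf p z * measure_pmf.prob (f z) X)"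
proof -
  have "emeasure (measure_pmf (bind_pmf p f)) X
      = (\<integral>\<^sup>+z. ennreal (measure_pmf.prob (f z) X) \<partial>measure_pmf p)"
    by (subst emeasure_bind_pmf) (simp add: measure_pmf.emeasure_eq_measure)
  also have "\<dots> = (\<Sum>z\<in>set_pmf p. ennreal (measure_pmf.prob (f z) X) * ennreal (pmf p z))"
    using assms by (intro nn_integral_measure_pmf_finite) auto
  also have "\<dots> = ennreal (\<Sum>z\<in>set_pmf p. pmf p z * measure_pmf.prob (f z) X)"
    by (subst sum_ennreal[symmetric]) (auto simp: ennreal_mult mult.commute)
  finally show ?thesis
    by (simp add: measure_pmf.emeasure_eq_measure sum_nonneg)
qed

text \<open>The average of \<open>f\<close> falls short of \<open>B\<close> by at least \<open>\<alpha>\<close> times the total deficit of \<open>f\<close> on \<open>Z\<close>, which is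
  at least \<open>card Z * B - 1\<close>. As a map in \<open>B\<close>, the bound is a contraction with fixed point \<open>1 / card Z\<close>.\<close>

lemma weighted_average_contracts:
  fixes p f :: "'a \<Rightarrow> real" and \<alpha> B :: real
  assumes "finite A" "Z \<subseteq> A" "sum p A = 1" "\<And>z. z \<in> A \<Longrightarrow> 0 \<le> p z" "\<And>z. z \<in> Z \<Longrightarrow> \<alpha> \<le> p z"
    and "\<And>z. z \<in> A \<Longrightarrow> f z \<le> B" "sum f Z \<le> 1" "0 \<le> \<alpha>"
  shows "(\<Sum>z\<in>A. p z * f z) \<le> (1 - card Z * \<alpha>) * B + \<alpha>"
proof -
  have finZ: "finite Z" using assms finite_subset by blast
  have "\<alpha> * (card Z * B - 1) \<le> \<alpha> * (\<Sum>z\<in>Z. B - f z)"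
    using assms finZ by (intro mult_left_mono) (simp_all add: sum_subtractf)
  also have "\<dots> = (\<Sum>z\<in>Z. \<alpha> * (B - f z))" by (simp add: sum_distrib_left)
  also have "\<dots> \<le> (\<Sum>z\<in>Z. p z * (B - f z))"
    using assms by (intro sum_mono mult_right_mono) auto
  also have "\<dots> \<le> (\<Sum>z\<in>A. p z * (B - f z))"
    using assms by (intro sum_mono2) (auto intro!: mult_nonneg_nonneg)
  also have "\<dots> = (\<Sum>z\<in>A. p z * B) - (\<Sum>z\<in>A. p z * f z)"
    by (simp add: right_diff_distrib sum_subtractf)
  also have "(\<Sum>z\<in>A. p z * B) = B" using assms(3) by (simp add: sum_distrib_right[symmetric])
  finally show ?thesis by (simp add: algebra_simps)
qed

locale walk = group G for G (structure) +
  fixes \<mu>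
  assumes \<mu>_V: "set_pmf \<mu> \<subseteq> carrier G" and \<mu>_fin: "finite (set_pmf \<mu>)"
    and \<mu>_sym: "\<And>s. s \<in> set_pmf \<mu> \<Longrightarrow> inv s \<in> set_pmf \<mu>"
    and \<mu>_gen: "generate G (set_pmf \<mu>) = carrier G"
begin

abbreviation "step_set n \<equiv> set_pmf (conv_pow G \<mu> n)"
abbreviation "walk_prob n A \<equiv> measure_pmf.prob (conv_pow G \<mu> n) A"

lemma convolve_bind: "convolve G p q = bind_pmf p (\<lambda>g. map_pmf (\<lambda>h. g \<otimes> h) q)"
  unfolding convolve_def pair_pmf_def map_pmf_def
  by (simp add: bind_assoc_pmf bind_return_pmf)

lemma set_convolve: "set_pmf (convolve G p q) = {g \<otimes> h | g h. g \<in> set_pmf p \<and> h \<in> set_pmf q}"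
  by (auto simp: convolve_def)

lemma convolve_assoc:
  assumes "set_pmf p \<subseteq> carrier G" "set_pmf q \<subseteq> carrier G" "set_pmf r \<subseteq> carrier G"
  shows "convolve G (convolve G p q) r = convolve G p (convolve G q r)"
proof -
  have "convolve G (convolve G p q) r
      = bind_pmf p (\<lambda>x. bind_pmf q (\<lambda>y. bind_pmf r (\<lambda>z. return_pmf ((x \<otimes> y) \<otimes> z))))"
    unfolding convolve_bind map_pmf_def by (simp add: bind_assoc_pmf bind_return_pmf)
  also have "\<dots> = bind_pmf p (\<lambda>x. bind_pmf q (\<lambda>y. bind_pmf r (\<lambda>z. return_pmf (x \<otimes> (y \<otimes> z)))))"
    using assms by (intro bind_pmf_cong refl) (auto simp: m_assoc subset_iff)
  also have "\<dots> = convolve G p (convolve G q r)"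
    unfolding convolve_bind map_pmf_def by (simp add: bind_assoc_pmf bind_return_pmf)
  finally show ?thesis .
qed

lemma convolve_one:
  assumes "set_pmf p \<subseteq> carrier G" shows "convolve G p (return_pmf \<one>) = p" "convolve G (return_pmf \<one>) p = p"
proof -
  have "convolve G p (return_pmf \<one>) = bind_pmf p return_pmf"
    unfolding convolve_bind using assms by (intro bind_pmf_cong) auto
  then show "convolve G p (return_pmf \<one>) = p" by (simp add: bind_return_pmf')
  have "convolve G (return_pmf \<one>) p = map_pmf (\<lambda>x. x) p"
    unfolding convolve_bind bind_return_pmf using assms by (intro map_pmf_cong) auto
  then show "convolve G (return_pmf \<one>) p = p" by (simp add: map_pmf_ident)
qed

lemma step_set_V: "step_set n \<subseteq> carrier G"
  by (induction n) (use \<mu>_V in \<open>auto simp: set_convolve\<close>)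

lemma step_set_finite: "finite (step_set n)"
proof (induction n)
  case (Suc n)
  have "step_set (Suc n) = (\<lambda>(g, h). g \<otimes> h) ` (step_set n \<times> set_pmf \<mu>)" by (auto simp: set_convolve)
  then show ?case using Suc \<mu>_fin by simp
qed simp

lemma conv_pow_add: "conv_pow G \<mu> (m + n) = convolve G (conv_pow G \<mu> m) (conv_pow G \<mu> n)"
proof (induction n)
  case 0 then show ?case using convolve_one(1)[OF step_set_V] by simp
next
  case (Suc n)
  then show ?case using convolve_assoc[OF step_set_V step_set_V \<mu>_V] by simp
qed

lemma step_set_mult: "g \<in> step_set m \<Longrightarrow> h \<in> step_set n \<Longrightarrow> g \<otimes> h \<in> step_set (m + n)"
  by (auto simp: conv_pow_add set_convolve)

lemma step_set_1: "step_set (Suc 0) = set_pmf \<mu>"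
  using convolve_one(2)[OF \<mu>_V] by simp

lemma step_set_exhausts: "g \<in> carrier G \<Longrightarrow> \<exists>n. g \<in> step_set n"
proof -
  assume "g \<in> carrier G"
  then have "g \<in> generate G (set_pmf \<mu>)" using \<mu>_gen by simp
  then show ?thesis
  proof induction
    case one show ?case by (intro exI[of _ 0]) simp
  next
    case (incl s) then show ?case using step_set_1 by blast
  next
    case (inv s) then show ?case using step_set_1 \<mu>_sym by blast
  next
    case (eng g h) then show ?case using step_set_mult by blast
  qed
qed

lemma step_set_add_even: "g \<in> step_set n \<Longrightarrow> g \<in> step_set (n + 2 * k)"
proof (induction k)
  case (Suc k)
  obtain s where s: "s \<in> set_pmf \<mu>" using set_pmf_not_empty by fast
  have "s \<otimes> inv s \<in> step_set (Suc 0 + Suc 0)" using s \<mu>_sym step_set_1 by (intro step_set_mult) auto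
  then have one: "\<one> \<in> step_set 2" using s \<mu>_V by (auto simp: numeral_2_eq_2)
  have g: "g \<in> step_set (n + 2 * k)" using Suc by simp
  have "g \<otimes> \<one> \<in> step_set ((n + 2 * k) + 2)" by (rule step_set_mult[OF g one])
  moreover have "g \<in> carrier G" using g step_set_V by auto
  ultimately show ?case by (simp add: algebra_simps)
qed simp

text \<open>An element may be reached by the walk at times of one parity only, whereas the translates used
  by \<open>walk_escapes\<close> have to be reached at a common time. By symmetry of the support, an element reached
  at an even time is reached at all later even times.\<close>

definition "even_elements = (\<Union>n. step_set (2 * n))"

lemma finite_even_subset:
  assumes "finite Z" "Z \<subseteq> even_elements" shows "\<exists>m. Z \<subseteq> step_set m"
proof -
  have "\<forall>z\<in>Z. \<exists>n. z \<in> step_set (2 * n)" using assms by (auto simp: even_elements_def)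
  then obtain n where n: "\<And>z. z \<in> Z \<Longrightarrow> z \<in> step_set (2 * n z)" by metis
  have "z \<in> step_set (2 * Max (insert 0 (n ` Z)))" if "z \<in> Z" for z
  proof -
    have "n z \<le> Max (insert 0 (n ` Z))" using that assms by (intro Max_ge) auto
    then obtain k where "Max (insert 0 (n ` Z)) = n z + k" by (auto simp: le_iff_add)
    then show ?thesis using step_set_add_even[OF n[OF that], of k] by (simp add: algebra_simps)
  qed
  then show ?thesis by blast
qed

text \<open>Among \<open>2 k\<close> elements, \<open>k\<close> are even or \<open>k\<close> become even after multiplication by one fixed \<open>s\<close> in the
  support. The multiplication acts on the disjoint translates by a common translation.\<close>

lemma spread_even:
  assumes X: "spread X"
  shows "\<exists>Z\<subseteq>even_elements. finite Z \<and> card Z = k \<and>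
      (\<forall>z\<in>Z. \<forall>z'\<in>Z. z \<noteq> z' \<longrightarrow> (inv z <# X) \<inter> (inv z' <# X) = {})"
proof -
  have XV: "X \<subseteq> carrier G" using X by (simp add: spread_def)
  obtain Z0 where Z0: "Z0 \<subseteq> carrier G" "finite Z0" "card Z0 = 2 * k"
      "\<forall>z\<in>Z0. \<forall>z'\<in>Z0. z \<noteq> z' \<longrightarrow> (z <# X) \<inter> (z' <# X) = {}"
    using X unfolding spread_def by (elim exE conjE allE[of _ "2 * k"]) (rule that)
  define Z where "Z = (\<lambda>z. inv z) ` Z0"
  have ZV: "Z \<subseteq> carrier G" using Z0 by (auto simp: Z_def)
  have "inj_on (\<lambda>z. inv z) Z0" using Z0(1) by (intro inj_onI) (metis inv_inv subsetD)
  then have Z: "finite Z" "card Z = 2 * k" using Z0 by (auto simp: Z_def card_image)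
  have Zdis: "(inv z <# X) \<inter> (inv z' <# X) = {}" if z: "z \<in> Z" "z' \<in> Z" "z \<noteq> z'" for z z'
  proof -
    obtain y y' where y: "y \<in> Z0" "y' \<in> Z0" "z = inv y" "z' = inv y'"
      using z(1,2) unfolding Z_def by blast
    then have "y \<noteq> y'" using z(3) by blast
    then have "(y <# X) \<inter> (y' <# X) = {}" using Z0(4) y by simp
    moreover have "inv z = y" "inv z' = y'" using y Z0(1) by auto
    ultimately show ?thesis by simp
  qed
  obtain s where s: "s \<in> set_pmf \<mu>" using set_pmf_not_empty by fast
  have sV: "s \<in> carrier G" using s \<mu>_V by auto
  have odd: "z \<otimes> s \<in> even_elements" if z: "z \<in> Z - even_elements" for z
  proof -
    obtain n where n: "z \<in> step_set n" using step_set_exhausts z ZV by blast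
    have "odd n" using n z by (auto simp: even_elements_def elim!: evenE)
    then obtain l where "Suc n = 2 * l" by (metis even_Suc evenE)
    moreover have "z \<otimes> s \<in> step_set (n + Suc 0)" using n s step_set_1 by (intro step_set_mult) auto
    ultimately show ?thesis unfolding even_elements_def by (metis UN_I UNIV_I add.right_neutral add_Suc_right)
  qed
  have "card (Z \<inter> even_elements) + card (Z - even_elements) = 2 * k"
    using Z card_Int_Diff[of Z even_elements] by simp
  then consider "k \<le> card (Z \<inter> even_elements)" | "k \<le> card (Z - even_elements)" by linarith
  then show ?thesis
  proof cases
    case 1
    then obtain Z' where Z': "Z' \<subseteq> Z \<inter> even_elements" "card Z' = k" "finite Z'"
      using obtain_subset_with_card_n by metis
    then show ?thesis using Zdis by (intro exI[of _ Z']) auto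
  next
    case 2
    then obtain Z' where Z': "Z' \<subseteq> Z - even_elements" "card Z' = k" "finite Z'"
      using obtain_subset_with_card_n by metis
    have Z'V: "z \<in> carrier G" if "z \<in> Z'" for z using that Z' ZV by auto
    have inj: "inj_on (\<lambda>z. z \<otimes> s) Z'" using Z'V sV by (auto simp: inj_on_def)
    show ?thesis
    proof (intro exI[of _ "(\<lambda>z. z \<otimes> s) ` Z'"] conjI ballI impI)
      show "(\<lambda>z. z \<otimes> s) ` Z' \<subseteq> even_elements" using odd Z' by auto
      show "card ((\<lambda>z. z \<otimes> s) ` Z') = k" using inj Z' by (simp add: card_image)
      fix z z' assume "z \<in> (\<lambda>z. z \<otimes> s) ` Z'" "z' \<in> (\<lambda>z. z \<otimes> s) ` Z'" "z \<noteq> z'"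
      then obtain y y' where y: "y \<in> Z'" "y' \<in> Z'" "z = y \<otimes> s" "z' = y' \<otimes> s" "y \<noteq> y'" by auto
      have V: "y \<in> carrier G" "y' \<in> carrier G" using y Z'V by auto
      have "(inv y <# X) \<inter> (inv y' <# X) = {}" using Zdis y Z' by blast
      then have "(inv s <# (inv y <# X)) \<inter> (inv s <# (inv y' <# X)) = {}"
        using V XV sV by (simp add: l_coset_disjoint_iff l_coset_subset_G)
      then show "(inv z <# X) \<inter> (inv z' <# X) = {}"
        using y V XV sV by (simp add: lcos_m_assoc inv_mult_group)
    qed (use Z' in auto)
  qed
qed

lemma spread_family_even:
  assumes fin: "finite \<X>" and X: "\<forall>X\<in>\<X>. spread X"
  shows "\<exists>m Z. \<forall>X\<in>\<X>. Z X \<subseteq> step_set m \<and> card (Z X) = k \<and>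
      (\<forall>z\<in>Z X. \<forall>z'\<in>Z X. z \<noteq> z' \<longrightarrow> (inv z <# X) \<inter> (inv z' <# X) = {})"
proof -
  define ok where "ok X Z \<longleftrightarrow> Z \<subseteq> even_elements \<and> finite Z \<and> card Z = k \<and>
      (\<forall>z\<in>Z. \<forall>z'\<in>Z. z \<noteq> z' \<longrightarrow> (inv z <# X) \<inter> (inv z' <# X) = {})" for X Z
  have "\<exists>Z. ok X Z" if "X \<in> \<X>" for X
    using spread_even[of X k] X that by (simp add: ok_def)
  then obtain Z where Z: "\<And>X. X \<in> \<X> \<Longrightarrow> ok X (Z X)" by metis
  have "finite (\<Union>X\<in>\<X>. Z X)" using fin Z by (simp add: ok_def)
  moreover have "(\<Union>X\<in>\<X>. Z X) \<subseteq> even_elements" using Z by (simp add: ok_def UN_subset_iff)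
  ultimately obtain m where m: "(\<Union>X\<in>\<X>. Z X) \<subseteq> step_set m" using finite_even_subset by blast
  have "Z X \<subseteq> step_set m" if "X \<in> \<X>" for X using m that by blast
  then show ?thesis using Z unfolding ok_def by (intro exI[of _ m] exI[of _ Z]) simp
qed

lemma P_first_steps:
  "walk_prob (m + n) {g \<in> carrier G. x \<otimes> g \<in> E}
     = (\<Sum>z\<in>step_set m. pmf (conv_pow G \<mu> m) z * walk_prob n {g \<in> carrier G. (x \<otimes> z) \<otimes> g \<in> E})"
  if x: "x \<in> carrier G"
proof -
  have eq: "measure_pmf.prob (map_pmf (\<lambda>h. z \<otimes> h) (conv_pow G \<mu> n)) {g \<in> carrier G. x \<otimes> g \<in> E}
      = walk_prob n {g \<in> carrier G. (x \<otimes> z) \<otimes> g \<in> E}" if z: "z \<in> step_set m" for z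
  proof -
    have zV: "z \<in> carrier G" using z step_set_V by auto
    have "measure_pmf.prob (map_pmf (\<lambda>h. z \<otimes> h) (conv_pow G \<mu> n)) {g \<in> carrier G. x \<otimes> g \<in> E}
        = walk_prob n ({h. z \<otimes> h \<in> carrier G \<and> x \<otimes> (z \<otimes> h) \<in> E} \<inter> step_set n)"
      by (simp add: vimage_def measure_Int_set_pmf)
    also have "{h. z \<otimes> h \<in> carrier G \<and> x \<otimes> (z \<otimes> h) \<in> E} \<inter> step_set n
        = {g \<in> carrier G. (x \<otimes> z) \<otimes> g \<in> E} \<inter> step_set n"
      using x zV step_set_V[of n] by (auto simp: m_assoc)
    finally show ?thesis by (simp add: measure_Int_set_pmf)
  qed
  show ?thesis unfolding conv_pow_add convolve_bind
    by (subst measure_bind_pmf_finite[OF step_set_finite]) (use eq in simp)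
qed

lemma disjoint_translates_sum:
  assumes Z: "finite Z" "Z \<subseteq> carrier G" "\<forall>z\<in>Z. \<forall>z'\<in>Z. z \<noteq> z' \<longrightarrow> (inv z <# X) \<inter> (inv z' <# X) = {}"
    and X: "X \<subseteq> carrier G" "{g \<in> carrier G. x \<otimes> g \<in> E} \<subseteq> X" and x: "x \<in> carrier G"
  shows "(\<Sum>z\<in>Z. walk_prob n {g \<in> carrier G. (x \<otimes> z) \<otimes> g \<in> E}) \<le> 1"
proof -
  have sub: "{g \<in> carrier G. (x \<otimes> z) \<otimes> g \<in> E} \<subseteq> inv z <# X" if z: "z \<in> Z" for z
  proof
    fix g assume g: "g \<in> {g \<in> carrier G. (x \<otimes> z) \<otimes> g \<in> E}"
    have zV: "z \<in> carrier G" using z Z by auto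
    have gV: "g \<in> carrier G" and gE: "(x \<otimes> z) \<otimes> g \<in> E" using g by auto
    have "x \<otimes> (z \<otimes> g) \<in> E" using gE m_assoc[OF x zV gV] by simp
    then have "z \<otimes> g \<in> X" using X(2) g zV by auto
    then show "g \<in> inv z <# X" using g zV X by (simp add: mem_l_coset_iff)
  qed
  have "disjoint_family_on (\<lambda>z. {g \<in> carrier G. (x \<otimes> z) \<otimes> g \<in> E}) Z"
    unfolding disjoint_family_on_def
  proof (intro ballI impI)
    fix z z' assume "z \<in> Z" "z' \<in> Z" "z \<noteq> z'"
    then have "(inv z <# X) \<inter> (inv z' <# X) = {}" using Z by simp
    then show "{g \<in> carrier G. (x \<otimes> z) \<otimes> g \<in> E} \<inter> {g \<in> carrier G. (x \<otimes> z') \<otimes> g \<in> E} = {}"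
      using sub[OF \<open>z \<in> Z\<close>] sub[OF \<open>z' \<in> Z\<close>] by blast
  qed
  then have "(\<Sum>z\<in>Z. walk_prob n {g \<in> carrier G. (x \<otimes> z) \<otimes> g \<in> E})
      = walk_prob n (\<Union>z\<in>Z. {g \<in> carrier G. (x \<otimes> z) \<otimes> g \<in> E})"
    using Z by (intro measure_pmf.finite_measure_finite_Union[symmetric]) auto
  then show ?thesis by simp
qed

text \<open>The probability to end in \<open>E\<close> from the start \<open>x\<close> is an average of the probabilities from the starts
  \<open>x z\<close>, where \<open>z\<close> ranges over the first \<open>m\<close> steps. If \<open>x\<inverse> E\<close> is contained in a spread set, then for \<open>k\<close> of
  these \<open>z\<close> the sets of continuations that end in \<open>E\<close> are disjoint, so that their
  probabilities add up to at most \<open>1\<close>. Iterating \<open>j\<close> times gives the bound \<open>1/k + r\<^sup>j\<close> with \<open>r < 1\<close>. As \<open>m\<close>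
  and \<open>r\<close> depend only on \<open>\<X>\<close> and \<open>k\<close>, the hypothesis on \<open>E\<close> concerns finitely many starts \<open>y\<close>; they are
  the points that the walk can reach at the times \<open>i * m\<close> with \<open>i < j\<close>.\<close>

lemma walk_escapes:
  assumes fin: "finite \<X>" and spread: "\<forall>X\<in>\<X>. spread X" and \<epsilon>: "\<epsilon> > 0"
  shows "\<exists>Y N. finite Y \<and> Y \<subseteq> carrier G \<and>
    (\<forall>E. (\<forall>y\<in>Y. \<exists>X\<in>\<X>. {g \<in> carrier G. y \<otimes> g \<in> E} \<subseteq> X) \<longrightarrow> (\<forall>n\<ge>N. walk_prob n E \<le> \<epsilon>))"
proof (cases "\<X> = {}")
  case True
  then show ?thesis by (intro exI[of _ "{\<one>}"]) auto
next
  case False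
  then obtain X0 where X0: "X0 \<in> \<X>" by auto
  obtain k0 :: nat where k0: "2 / \<epsilon> < k0" using reals_Archimedean2 by blast
  define k where "k = max 1 k0"
  have "2 / \<epsilon> \<le> k" using k0 by (auto simp: k_def)
  then have "2 \<le> \<epsilon> * k" using \<epsilon> by (simp add: field_simps)
  moreover have "1 \<le> k" by (simp add: k_def)
  ultimately have k: "k \<ge> 1" "1 / k \<le> \<epsilon> / 2" by (simp_all add: field_simps)
  obtain m Z where Z: "\<forall>X\<in>\<X>. Z X \<subseteq> step_set m \<and> card (Z X) = k \<and>
      (\<forall>z\<in>Z X. \<forall>z'\<in>Z X. z \<noteq> z' \<longrightarrow> (inv z <# X) \<inter> (inv z' <# X) = {})"
    using spread_family_even[OF fin spread, of k] by (elim exE) (rule that)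
  define \<alpha> where "\<alpha> = Min (pmf (conv_pow G \<mu> m) ` step_set m)"
  have ne: "step_set m \<noteq> {}" by (rule set_pmf_not_empty)
  have "\<alpha> \<in> pmf (conv_pow G \<mu> m) ` step_set m" unfolding \<alpha>_def using step_set_finite ne by (intro Min_in) auto
  then have \<alpha>0: "\<alpha> > 0" by (auto intro: pmf_positive)
  have \<alpha>le: "\<alpha> \<le> pmf (conv_pow G \<mu> m) z" if "z \<in> step_set m" for z
    unfolding \<alpha>_def using step_set_finite that by (intro Min_le) auto
  have sum1: "sum (pmf (conv_pow G \<mu> m)) (step_set m) = 1"
    by (intro sum_pmf_eq_1 step_set_finite) auto
  define r where "r = 1 - k * \<alpha>"
  have ZX0: "Z X0 \<subseteq> step_set m" "card (Z X0) = k" using Z X0 by simp_all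
  have "k * \<alpha> = (\<Sum>z\<in>Z X0. \<alpha>)" using ZX0 by simp
  also have "\<dots> \<le> sum (pmf (conv_pow G \<mu> m)) (Z X0)" using ZX0 \<alpha>le by (intro sum_mono) blast
  also have "\<dots> \<le> sum (pmf (conv_pow G \<mu> m)) (step_set m)"
    using ZX0 step_set_finite by (intro sum_mono2) auto
  finally have r: "0 \<le> r" "r < 1" using sum1 \<alpha>0 k by (auto simp: r_def)
  have iter: "walk_prob (n + j * m) {g \<in> carrier G. x \<otimes> g \<in> E} \<le> 1 / k + r ^ j"
    if "x \<in> carrier G" "\<And>i y. i < j \<Longrightarrow> y \<in> step_set (i * m) \<Longrightarrow>
        \<exists>X\<in>\<X>. {g \<in> carrier G. (x \<otimes> y) \<otimes> g \<in> E} \<subseteq> X" for x E n j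
    using that
  proof (induction j arbitrary: x)
    case 0
    have "walk_prob (n + 0 * m) {g \<in> carrier G. x \<otimes> g \<in> E} \<le> 1" by (rule measure_pmf.prob_le_1)
    moreover have "0 \<le> 1 / real k" by simp
    ultimately show ?case unfolding power_0 by linarith
  next
    case (Suc j)
    let ?B = "1 / k + r ^ j"
    let ?f = "\<lambda>z. walk_prob (n + j * m) {g \<in> carrier G. (x \<otimes> z) \<otimes> g \<in> E}"
    have x: "x \<in> carrier G" using Suc by simp
    have le: "?f z \<le> ?B" if z: "z \<in> step_set m" for z
    proof (rule Suc.IH)
      have zV: "z \<in> carrier G" using z step_set_V by auto
      then show "x \<otimes> z \<in> carrier G" using x by simp
      fix i y assume i: "i < j" "y \<in> step_set (i * m)"
      have yV: "y \<in> carrier G" using i step_set_V by auto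
      have "z \<otimes> y \<in> step_set (Suc i * m)" using step_set_mult[OF z i(2)] by simp
      then show "\<exists>X\<in>\<X>. {g \<in> carrier G. x \<otimes> z \<otimes> y \<otimes> g \<in> E} \<subseteq> X"
        using Suc.prems(2)[of "Suc i" "z \<otimes> y"] i x zV yV by (simp add: m_assoc)
    qed
    obtain X where X: "X \<in> \<X>" "{g \<in> carrier G. x \<otimes> g \<in> E} \<subseteq> X"
      using Suc.prems(2)[of 0 \<one>] x by auto
    have XV: "X \<subseteq> carrier G" using X spread by (simp add: spread_def)
    have ZX: "Z X \<subseteq> step_set m" "card (Z X) = k" using Z X by auto
    have "Z X \<subseteq> carrier G" using ZX(1) step_set_V by blast
    then have "sum ?f (Z X) \<le> 1"
      using Z X XV x finite_subset[OF ZX(1) step_set_finite]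
      by (intro disjoint_translates_sum[of _ X]) auto
    then have "(\<Sum>z\<in>step_set m. pmf (conv_pow G \<mu> m) z * ?f z) \<le> (1 - card (Z X) * \<alpha>) * ?B + \<alpha>"
      using step_set_finite ZX sum1 \<alpha>le \<alpha>0 le by (intro weighted_average_contracts) auto
    then have "walk_prob (m + (n + j * m)) {g \<in> carrier G. x \<otimes> g \<in> E} \<le> r * ?B + \<alpha>"
      unfolding P_first_steps[OF x] using ZX by (simp add: r_def)
    also have "r * ?B + \<alpha> = 1 / k + r ^ Suc j" using k by (simp add: r_def field_simps)
    finally show ?case by (simp add: algebra_simps)
  qed
  obtain j where j: "r ^ j < \<epsilon> / 2" using real_arch_pow_inv[of "\<epsilon> / 2" r] r \<epsilon> by auto
  define Y where "Y = (\<Union>i<j. step_set (i * m))"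
  show ?thesis
  proof (intro exI[of _ Y] exI[of _ "j * m"] conjI allI impI)
    show "finite Y" "Y \<subseteq> carrier G" using step_set_finite step_set_V by (auto simp: Y_def)
    fix E n assume E: "\<forall>y\<in>Y. \<exists>X\<in>\<X>. {g \<in> carrier G. y \<otimes> g \<in> E} \<subseteq> X" and n: "j * m \<le> n"
    obtain n' where n': "n = n' + j * m" using n by (metis add.commute le_iff_add)
    have "walk_prob (n' + j * m) {g \<in> carrier G. \<one> \<otimes> g \<in> E} \<le> 1 / k + r ^ j"
    proof (rule iter)
      fix i y assume "i < j" "y \<in> step_set (i * m)"
      then have "y \<in> Y" "y \<in> carrier G" using step_set_V by (auto simp: Y_def)
      then show "\<exists>X\<in>\<X>. {g \<in> carrier G. \<one> \<otimes> y \<otimes> g \<in> E} \<subseteq> X" using E by simp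
    qed simp
    also have "\<dots> \<le> \<epsilon>" using k j by linarith
    finally have *: "walk_prob n {g \<in> carrier G. \<one> \<otimes> g \<in> E} \<le> \<epsilon>" using n' by simp
    have "{g \<in> carrier G. \<one> \<otimes> g \<in> E} \<inter> step_set n = E \<inter> step_set n" using step_set_V[of n] by auto
    then show "walk_prob n E \<le> \<epsilon>" using * measure_Int_set_pmf by metis
  qed
qed

text \<open>All translates of a point lie in \<open>X\<close> or in \<open>X'\<close>.\<close>

lemma singleton_escapes:
  assumes X: "spread X" "spread X'" "X \<union> X' = carrier G" and \<epsilon>: "\<epsilon> > 0"
  shows "\<exists>N. \<forall>n\<ge>N. walk_prob n {a} \<le> \<epsilon>"
proof -
  obtain Y N where YN: "finite Y" "Y \<subseteq> carrier G"
    "\<forall>E. (\<forall>y\<in>Y. \<exists>X\<in>{X, X'}. {g \<in> carrier G. y \<otimes> g \<in> E} \<subseteq> X) \<longrightarrow> (\<forall>n\<ge>N. walk_prob n E \<le> \<epsilon>)"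
    using walk_escapes[of "{X, X'}" \<epsilon>] X \<epsilon> by auto
  have "\<exists>X\<in>{X, X'}. {g \<in> carrier G. y \<otimes> g \<in> {a}} \<subseteq> X" if "y \<in> Y" for y
  proof -
    have yV: "y \<in> carrier G" using that YN by auto
    have sub: "{g \<in> carrier G. y \<otimes> g \<in> {a}} \<subseteq> {inv y \<otimes> a}" using yV by (auto simp: mult_inv_cancel)
    show ?thesis
    proof (cases "inv y \<otimes> a \<in> carrier G")
      case True
      then have "inv y \<otimes> a \<in> X \<or> inv y \<otimes> a \<in> X'" using X by auto
      then show ?thesis using sub by blast
    next
      case False
      have "{g \<in> carrier G. y \<otimes> g \<in> {a}} \<subseteq> X"
      proof
        fix g assume g: "g \<in> {g \<in> carrier G. y \<otimes> g \<in> {a}}"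
        then have "g = inv y \<otimes> a" using sub by blast
        then show "g \<in> X" using g False by simp
      qed
      then show ?thesis by simp
    qed
  qed
  then show ?thesis using YN(3) by blast
qed

lemma finite_set_escapes:
  assumes X: "spread X" "spread X'" "X \<union> X' = carrier G" and B: "finite B" and \<epsilon>: "\<epsilon> > 0"
  shows "\<exists>N. \<forall>n\<ge>N. walk_prob n B \<le> \<epsilon>"
proof -
  define \<delta> where "\<delta> = \<epsilon> / (card B + 1)"
  have \<delta>: "\<delta> > 0" using \<epsilon> by (simp add: \<delta>_def)
  obtain N where N: "\<And>a n. n \<ge> N a \<Longrightarrow> walk_prob n {a} \<le> \<delta>" using singleton_escapes[OF X \<delta>] by metis
  have "walk_prob n B \<le> \<epsilon>" if n: "n \<ge> Max (insert 0 (N ` B))" for n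
  proof -
    have "walk_prob n B = (\<Sum>a\<in>B. walk_prob n {a})" using B by (intro measure_pmf.finite_measure_eq_sum_singleton) auto
    also have "\<dots> \<le> (\<Sum>a\<in>B. \<delta>)" using B n by (intro sum_mono N) auto
    also have "\<dots> \<le> \<epsilon>" using \<epsilon> by (simp add: \<delta>_def field_simps)
    finally show ?thesis .
  qed
  then show ?thesis by blast
qed

text \<open>The mixing statement needs the position of \<open>g\<close> as well as that of \<open>g\<inverse>\<close>; the latter is
  distributed as the walk with inverted steps.\<close>

lemma inverse_walk: "walk G (map_pmf (\<lambda>g. inv g) \<mu>)"
proof -
  have "set_pmf (map_pmf (\<lambda>g. inv g) \<mu>) = set_pmf \<mu>"
  proof
    show "set_pmf \<mu> \<subseteq> set_pmf (map_pmf (\<lambda>g. inv g) \<mu>)"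
    proof
      fix s assume s: "s \<in> set_pmf \<mu>"
      then have "s = inv (inv s)" using \<mu>_V by auto
      then show "s \<in> set_pmf (map_pmf (\<lambda>g. inv g) \<mu>)" using \<mu>_sym[OF s] by auto
    qed
  qed (use \<mu>_sym in auto)
  then show ?thesis using \<mu>_V \<mu>_fin \<mu>_sym \<mu>_gen by unfold_locales auto
qed

lemma conv_pow_inverse:
  "conv_pow G (map_pmf (\<lambda>g. inv g) \<mu>) n = map_pmf (\<lambda>g. inv g) (conv_pow G \<mu> n)"
proof (induction n)
  case 0 then show ?case by simp
next
  case (Suc n)
  interpret i: walk G "map_pmf (\<lambda>g. inv g) \<mu>" by (rule inverse_walk)
  let ?\<nu> = "map_pmf (\<lambda>g. inv g) \<mu>"
  have "map_pmf (\<lambda>g. inv g) (conv_pow G \<mu> (Suc n))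
      = bind_pmf (conv_pow G \<mu> n) (\<lambda>x. bind_pmf \<mu> (\<lambda>y. return_pmf (inv (x \<otimes> y))))"
    unfolding conv_pow.simps convolve_bind map_pmf_def by (simp add: bind_assoc_pmf bind_return_pmf)
  also have "\<dots> = bind_pmf (conv_pow G \<mu> n) (\<lambda>x. bind_pmf \<mu> (\<lambda>y. return_pmf (inv y \<otimes> inv x)))"
    using step_set_V[of n] \<mu>_V by (intro bind_pmf_cong refl) (auto simp: inv_mult_group subset_iff)
  also have "\<dots> = bind_pmf \<mu> (\<lambda>y. bind_pmf (conv_pow G \<mu> n) (\<lambda>x. return_pmf (inv y \<otimes> inv x)))"
    by (rule bind_commute_pmf)
  also have "\<dots> = convolve G ?\<nu> (map_pmf (\<lambda>g. inv g) (conv_pow G \<mu> n))"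
    unfolding convolve_bind map_pmf_def by (simp add: bind_assoc_pmf bind_return_pmf)
  also have "\<dots> = convolve G (conv_pow G ?\<nu> (Suc 0)) (conv_pow G ?\<nu> n)"
    using Suc i.convolve_one(2)[OF i.\<mu>_V] by simp
  also have "\<dots> = conv_pow G ?\<nu> (Suc n)" using i.conv_pow_add[of "Suc 0" n] by simp
  finally show ?case by simp
qed

end

section \<open>Ping-pong\<close>

context group
begin

text \<open>Products of elements taken alternately from \<open>H1\<close> and \<open>H2\<close>, according to the subgroup of the leftmost
  factor. The last factor is an arbitrary element of \<open>H1\<close>, possibly trivial, so that the words that end
  in \<open>H2\<close> are included; the other factors are non-trivial.\<close>

inductive alternating1 and alternating2 for H1 H2 where
  base: "h \<in> H1 \<Longrightarrow> alternating1 H1 H2 h"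
| left1: "alternating2 H1 H2 w \<Longrightarrow> h \<in> H1 \<Longrightarrow> h \<noteq> \<one> \<Longrightarrow> alternating1 H1 H2 (h \<otimes> w)"
| left2: "alternating1 H1 H2 w \<Longrightarrow> k \<in> H2 \<Longrightarrow> k \<noteq> \<one> \<Longrightarrow> alternating2 H1 H2 (k \<otimes> w)"

lemma generate_alternating:
  assumes H1: "subgroup H1 G" and H2: "subgroup H2 G" and g: "g \<in> generate G (H1 \<union> H2)"
  shows "alternating1 H1 H2 g \<or> alternating2 H1 H2 g"
proof -
  let ?alt = "\<lambda>w. alternating1 H1 H2 w \<or> alternating2 H1 H2 w"
  note sub = subgroup.mem_carrier[OF H1] subgroup.mem_carrier[OF H2]
  note closed = subgroup.m_closed[OF H1] subgroup.m_closed[OF H2]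
  have carr: "(alternating1 H1 H2 w \<longrightarrow> w \<in> carrier G) \<and> (alternating2 H1 H2 w' \<longrightarrow> w' \<in> carrier G)" for w w'
    by (induction rule: alternating1_alternating2.induct) (auto intro: sub)
  then have alt_carr: "?alt w \<Longrightarrow> w \<in> carrier G" for w by blast
  have mult1: "?alt (h \<otimes> w)" if h: "h \<in> H1" and w: "?alt w" for h w
    using w
  proof
    assume "alternating1 H1 H2 w"
    then show ?thesis
    proof cases
      case base
      then show ?thesis using h closed by (auto intro: alternating1_alternating2.base)
    next
      case (left1 w' h')
      have V: "h \<in> carrier G" "h' \<in> carrier G" "w' \<in> carrier G" using h left1 sub alt_carr by blast+
      have eq: "h \<otimes> w = (h \<otimes> h') \<otimes> w'" using left1 V by (simp add: m_assoc)
      show ?thesis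
      proof (cases "h \<otimes> h' = \<one>")
        case True then show ?thesis using eq left1 V by simp
      next
        case False
        then have "alternating1 H1 H2 ((h \<otimes> h') \<otimes> w')"
          using left1 h closed by (intro alternating1_alternating2.left1) auto
        then show ?thesis using eq by simp
      qed
    qed
  next
    assume w2: "alternating2 H1 H2 w"
    show ?thesis
    proof (cases "h = \<one>")
      case True then show ?thesis using w2 alt_carr by simp
    next
      case False then show ?thesis using w2 h alternating1_alternating2.left1 by blast
    qed
  qed
  have mult2: "?alt (k \<otimes> w)" if k: "k \<in> H2" and w: "?alt w" for k w
    using w
  proof
    assume "alternating2 H1 H2 w"
    then show ?thesis
    proof cases
      case (left2 w' k')
      have V: "k \<in> carrier G" "k' \<in> carrier G" "w' \<in> carrier G" using k left2 sub alt_carr by blast+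
      have eq: "k \<otimes> w = (k \<otimes> k') \<otimes> w'" using left2 V by (simp add: m_assoc)
      show ?thesis
      proof (cases "k \<otimes> k' = \<one>")
        case True then show ?thesis using eq left2 V by simp
      next
        case False
        then have "alternating2 H1 H2 ((k \<otimes> k') \<otimes> w')"
          using left2 k closed by (intro alternating1_alternating2.left2) auto
        then show ?thesis using eq by simp
      qed
    qed
  next
    assume w1: "alternating1 H1 H2 w"
    show ?thesis
    proof (cases "k = \<one>")
      case True then show ?thesis using w1 alt_carr by simp
    next
      case False then show ?thesis using w1 k alternating1_alternating2.left2 by blast
    qed
  qed
  have gen_carr: "x \<in> carrier G" if "x \<in> generate G (H1 \<union> H2)" for x
    using that generate_in_carrier[of "H1 \<union> H2" x] sub by blast
  have "?alt (g \<otimes> w)" if "?alt w" for w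
    using g that
  proof (induction arbitrary: w)
    case one then show ?case using alt_carr by auto
  next
    case (incl h) then show ?case using mult1 mult2 by blast
  next
    case (inv h)
    then have "inv h \<in> H1 \<or> inv h \<in> H2"
      using subgroup.m_inv_closed[OF H1, of h] subgroup.m_inv_closed[OF H2, of h] by auto
    then show ?case using mult1[OF _ inv(2)] mult2[OF _ inv(2)] by auto
  next
    case (eng x y)
    have "x \<in> carrier G" "y \<in> carrier G" "w \<in> carrier G"
      using gen_carr[OF eng(1)] gen_carr[OF eng(2)] alt_carr[OF eng(5)] by auto
    moreover have "?alt (x \<otimes> (y \<otimes> w))" by (rule eng(3)[OF eng(4)[OF eng(5)]])
    ultimately show ?case by (simp add: m_assoc)
  qed
  moreover have "?alt \<one>" using subgroup.one_closed[OF H1] alternating1_alternating2.base by blast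
  ultimately have "?alt (g \<otimes> \<one>)" by blast
  then show ?thesis using gen_carr[OF g] by simp
qed

lemma alternating_induct:
  assumes H: "subgroup H1 G" "subgroup H2 G" and g: "g \<in> generate G (H1 \<union> H2)"
    and base: "\<And>h. h \<in> H1 \<Longrightarrow> A h"
    and A: "\<And>h w. B w \<Longrightarrow> w \<in> carrier G \<Longrightarrow> h \<in> H1 \<Longrightarrow> h \<noteq> \<one> \<Longrightarrow> A (h \<otimes> w)"
    and B: "\<And>k w. A w \<Longrightarrow> w \<in> carrier G \<Longrightarrow> k \<in> H2 \<Longrightarrow> k \<noteq> \<one> \<Longrightarrow> B (k \<otimes> w)"
  shows "A g \<or> B g"
proof -
  note sub = subgroup.mem_carrier[OF H(1)] subgroup.mem_carrier[OF H(2)]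
  have "(alternating1 H1 H2 w \<longrightarrow> w \<in> carrier G \<and> A w) \<and> (alternating2 H1 H2 w' \<longrightarrow> w' \<in> carrier G \<and> B w')" for w w'
    by (induction rule: alternating1_alternating2.induct) (auto intro: sub base A B)
  then show ?thesis using generate_alternating[OF H g] by blast
qed

end

text \<open>The sets cover \<open>G\<close> and are moved off themselves. In terms of their complements this is the
  usual situation of disjoint sets into which the two groups contract everything else.\<close>

locale ping_pong = group G for G (structure) +
  fixes H1 H2 X1 X2
  assumes H1: "subgroup H1 G" and H2: "subgroup H2 G"
    and cover: "X1 \<union> X2 = carrier G"
    and move1: "\<And>h z. h \<in> H1 \<Longrightarrow> h \<noteq> \<one> \<Longrightarrow> z \<in> X1 \<Longrightarrow> h \<otimes> z \<notin> X1"
    and move2: "\<And>k z. k \<in> H2 \<Longrightarrow> k \<noteq> \<one> \<Longrightarrow> z \<in> X2 \<Longrightarrow> k \<otimes> z \<notin> X2"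
begin

lemma swap: "ping_pong G H2 H1 X2 X1"
  by (intro ping_pong.intro ping_pong_axioms.intro) (use H1 H2 cover move1 move2 in auto)

text \<open>A reduced word that is not in \<open>H1\<close> takes \<open>a\<close> to the outside of \<open>X2\<close>, hence into \<open>X1\<close>, if it begins
  in \<open>H2\<close>, and otherwise to an \<open>H1\<close>-translate of such a point. Both are outside \<open>N\<close>.\<close>

lemma returning_element:
  assumes N: "\<And>h z. h \<in> H1 \<Longrightarrow> z \<in> N \<Longrightarrow> h \<otimes> z \<in> N" "N \<inter> X1 = {}"
    and a: "a \<in> N" "a \<in> carrier G"
    and w: "w \<in> generate G (H1 \<union> H2)" "w \<otimes> a \<in> N"
  shows "w \<in> H1"
proof -
  note sub = subgroup.mem_carrier[OF H1] subgroup.mem_carrier[OF H2]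
  define A where "A w \<longleftrightarrow> w \<otimes> a \<notin> X1 \<and> (w \<in> H1 \<or> w \<otimes> a \<notin> N)" for w
  define B where "B w \<longleftrightarrow> w \<otimes> a \<in> X1 \<and> w \<otimes> a \<notin> X2" for w
  have "A w \<or> B w"
  proof (rule alternating_induct[OF H1 H2 w(1)])
    fix h assume "h \<in> H1"
    then show "A h" using N a by (auto simp: A_def)
  next
    fix h w assume *: "B w" "w \<in> carrier G" "h \<in> H1" "h \<noteq> \<one>"
    have hV: "h \<in> carrier G" using * sub by blast
    have eq: "(h \<otimes> w) \<otimes> a = h \<otimes> (w \<otimes> a)" using * hV a by (simp add: m_assoc)
    have "(h \<otimes> w) \<otimes> a \<notin> X1" using move1[OF *(3,4), of "w \<otimes> a"] * eq by (simp add: B_def)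
    moreover have "(h \<otimes> w) \<otimes> a \<notin> N"
    proof
      assume "(h \<otimes> w) \<otimes> a \<in> N"
      then have "inv h \<otimes> (h \<otimes> (w \<otimes> a)) \<in> N" unfolding eq
        using N(1) subgroup.m_inv_closed[OF H1 *(3)] by blast
      then have "w \<otimes> a \<in> N" using hV * a by (simp add: mult_inv_cancel)
      then show False using * N(2) by (auto simp: B_def)
    qed
    ultimately show "A (h \<otimes> w)" by (simp add: A_def)
  next
    fix k w assume *: "A w" "w \<in> carrier G" "k \<in> H2" "k \<noteq> \<one>"
    have kV: "k \<in> carrier G" using * sub by blast
    have eq: "(k \<otimes> w) \<otimes> a = k \<otimes> (w \<otimes> a)" using * kV a by (simp add: m_assoc)
    have "w \<otimes> a \<in> X2" using * a cover by (auto simp: A_def)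
    then have "(k \<otimes> w) \<otimes> a \<notin> X2" using move2[OF *(3,4)] eq by simp
    moreover have "(k \<otimes> w) \<otimes> a \<in> carrier G" using * kV a by simp
    ultimately show "B (k \<otimes> w)" using cover by (auto simp: B_def)
  qed
  then show ?thesis using w N by (auto simp: A_def B_def)
qed

text \<open>A non-trivial reduced word takes \<open>X1 \<inter> X2\<close> to the complement of \<open>X1\<close> or of \<open>X2\<close>.\<close>

lemma free_on_overlap:
  assumes w: "w \<in> generate G (H1 \<union> H2)" and a: "a \<in> X1" "a \<in> X2" and wa: "w \<otimes> a \<in> X1" "w \<otimes> a \<in> X2"
  shows "w = \<one>"
proof -
  note sub = subgroup.mem_carrier[OF H1] subgroup.mem_carrier[OF H2]
  have aV: "a \<in> carrier G" using a cover by auto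
  define A where "A w \<longleftrightarrow> w = \<one> \<or> w \<otimes> a \<notin> X1" for w
  define B where "B w \<longleftrightarrow> w \<otimes> a \<in> X1 \<and> w \<otimes> a \<notin> X2" for w
  have "A w \<or> B w"
  proof (rule alternating_induct[OF H1 H2 w])
    fix h assume "h \<in> H1"
    then show "A h" using move1[of h a] a by (auto simp: A_def)
  next
    fix h w assume *: "B w" "w \<in> carrier G" "h \<in> H1" "h \<noteq> \<one>"
    then have "(h \<otimes> w) \<otimes> a = h \<otimes> (w \<otimes> a)" using sub aV by (simp add: m_assoc)
    then show "A (h \<otimes> w)" using move1[OF *(3,4), of "w \<otimes> a"] * by (simp add: A_def B_def)
  next
    fix k w assume *: "A w" "w \<in> carrier G" "k \<in> H2" "k \<noteq> \<one>"
    have kV: "k \<in> carrier G" using * sub by blast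
    have eq: "(k \<otimes> w) \<otimes> a = k \<otimes> (w \<otimes> a)" using * kV aV by (simp add: m_assoc)
    have "w \<otimes> a \<in> X2" using * a aV cover by (auto simp: A_def)
    then have "(k \<otimes> w) \<otimes> a \<notin> X2" using move2[OF *(3,4)] eq by simp
    moreover have "(k \<otimes> w) \<otimes> a \<in> carrier G" using * kV aV by simp
    ultimately show "B (k \<otimes> w)" using cover by (auto simp: B_def)
  qed
  then show ?thesis using wa by (auto simp: A_def B_def)
qed

text \<open>Distinct points of the overlap lie in distinct cosets.\<close>

lemma infinite_index:
  assumes "infinite (X1 \<inter> X2)"
  shows "infinite (rcosets (generate G (H1 \<union> H2)))"
proof -
  let ?H = "generate G (H1 \<union> H2)"
  have H: "subgroup ?H G"
    using subgroup.subset[OF H1] subgroup.subset[OF H2] by (intro generate_is_subgroup) auto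
  have "inj_on (\<lambda>a. ?H #> a) (X1 \<inter> X2)"
  proof (rule inj_onI)
    fix a b assume a: "a \<in> X1 \<inter> X2" and b: "b \<in> X1 \<inter> X2" and eq: "?H #> a = ?H #> b"
    have V: "a \<in> carrier G" "b \<in> carrier G" using a b cover by auto
    have "b \<in> ?H #> a" using eq rcos_self[OF V(2) H] by simp
    then obtain w where w: "w \<in> ?H" "b = w \<otimes> a" by (auto simp: r_coset_def)
    then have "w = \<one>" using a b by (intro free_on_overlap[of w a]) auto
    then show "a = b" using w V by simp
  qed
  then have "infinite ((\<lambda>a. ?H #> a) ` (X1 \<inter> X2))" using assms finite_imageD by blast
  moreover have "(\<lambda>a. ?H #> a) ` (X1 \<inter> X2) \<subseteq> rcosets ?H" using cover by (auto simp: RCOSETS_def)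
  ultimately show ?thesis using finite_subset by blast
qed

end

section \<open>Conjugate subgroups and neighbourhoods in the space of subgroups\<close>

context group
begin

lemma mem_conj_subgroup_iff:
  assumes "H \<subseteq> carrier G" "g \<in> carrier G"
  shows "z \<in> conj_subgroup G g H \<longleftrightarrow> z \<in> carrier G \<and> inv g \<otimes> z \<otimes> g \<in> H"
proof
  assume "z \<in> conj_subgroup G g H"
  then obtain h where h: "h \<in> H" "z = g \<otimes> (h \<otimes> inv g)"
    by (auto simp: conj_subgroup_def l_coset_def r_coset_def)
  then have "h \<in> carrier G" using assms by auto
  then show "z \<in> carrier G \<and> inv g \<otimes> z \<otimes> g \<in> H" using h assms by (simp add: m_assoc mult_inv_cancel)
next
  assume z: "z \<in> carrier G \<and> inv g \<otimes> z \<otimes> g \<in> H"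
  then have "z = g \<otimes> ((inv g \<otimes> z \<otimes> g) \<otimes> inv g)" using assms by (simp add: m_assoc mult_inv_cancel)
  then show "z \<in> conj_subgroup G g H" using z unfolding conj_subgroup_def l_coset_def r_coset_def by blast
qed

lemma subgroup_conj_subgroup:
  assumes H: "subgroup H G" and g: "g \<in> carrier G"
  shows "subgroup (conj_subgroup G g H) G"
proof (rule subgroupI)
  note HV = subgroup.subset[OF H]
  note mem = mem_conj_subgroup_iff[OF HV g]
  show "conj_subgroup G g H \<subseteq> carrier G" using mem by auto
  show "conj_subgroup G g H \<noteq> {}" using mem[of \<one>] g subgroup.one_closed[OF H] by auto
  fix a assume a: "a \<in> conj_subgroup G g H"
  then have "inv (inv g \<otimes> a \<otimes> g) \<in> H" using mem subgroup.m_inv_closed[OF H] by blast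
  moreover have "inv (inv g \<otimes> a \<otimes> g) = inv g \<otimes> inv a \<otimes> g" using a mem g by (simp add: inv_mult_group m_assoc)
  ultimately show "inv a \<in> conj_subgroup G g H" using a mem by auto
next
  note HV = subgroup.subset[OF H]
  note mem = mem_conj_subgroup_iff[OF HV g]
  fix a b assume ab: "a \<in> conj_subgroup G g H" "b \<in> conj_subgroup G g H"
  then have "(inv g \<otimes> a \<otimes> g) \<otimes> (inv g \<otimes> b \<otimes> g) \<in> H" using mem subgroup.m_closed[OF H] by blast
  moreover have "(inv g \<otimes> a \<otimes> g) \<otimes> (inv g \<otimes> b \<otimes> g) = inv g \<otimes> (a \<otimes> b) \<otimes> g"
    using ab mem g by (simp add: m_assoc mult_inv_cancel)
  ultimately show "a \<otimes> b \<in> conj_subgroup G g H" using ab mem by auto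
qed

lemma infinite_index_conj_subgroup:
  assumes H: "subgroup H G" and g: "g \<in> carrier G" and inf: "infinite (rcosets H)"
  shows "infinite (rcosets (conj_subgroup G g H))"
proof -
  note HV = subgroup.subset[OF H]
  have sub: "X \<subseteq> carrier G" if "X \<in> rcosets H" for X
    using that HV r_coset_subset_G by (auto simp: RCOSETS_def)
  have "inj_on (\<lambda>X. g <# X) (rcosets H)"
    using sub g by (intro inj_onI) (metis l_coset_inv_cancel(1))
  then have "infinite ((\<lambda>X. g <# X) ` (rcosets H))" using inf finite_imageD by blast
  moreover have "(\<lambda>X. g <# X) ` (rcosets H) \<subseteq> rcosets (conj_subgroup G g H)"
  proof clarify
    fix X assume "X \<in> rcosets H"
    then obtain x where x: "x \<in> carrier G" "X = H #> x" by (auto simp: RCOSETS_def)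
    have "g <# X = conj_subgroup G g H #> (g \<otimes> x)"
    proof (intro equalityI subsetI)
      fix z assume "z \<in> g <# X"
      then obtain h where h: "h \<in> H" "z = g \<otimes> (h \<otimes> x)" using x by (auto simp: l_coset_def r_coset_def)
      have "h \<in> carrier G" using h HV by auto
      then have "z = (g \<otimes> (h \<otimes> inv g)) \<otimes> (g \<otimes> x)" using h g x by (simp add: m_assoc mult_inv_cancel)
      then show "z \<in> conj_subgroup G g H #> (g \<otimes> x)"
        using h unfolding conj_subgroup_def l_coset_def r_coset_def by blast
    next
      fix z assume "z \<in> conj_subgroup G g H #> (g \<otimes> x)"
      then obtain h where h: "h \<in> H" "z = (g \<otimes> (h \<otimes> inv g)) \<otimes> (g \<otimes> x)"
        by (auto simp: conj_subgroup_def l_coset_def r_coset_def)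
      have "h \<in> carrier G" using h HV by auto
      then have "z = g \<otimes> (h \<otimes> x)" using h g x by (simp add: m_assoc mult_inv_cancel)
      then show "z \<in> g <# X" using h x unfolding l_coset_def r_coset_def by blast
    qed
    then show "g <# X \<in> rcosets (conj_subgroup G g H)" using g x by (auto simp: RCOSETS_def)
  qed
  ultimately show ?thesis using finite_subset by blast
qed

lemma infinite_index_mono:
  assumes H: "subgroup H G" and H': "subgroup H' G" and sub: "H' \<subseteq> H" and inf: "infinite (rcosets H)"
  shows "infinite (rcosets H')"
proof
  assume fin: "finite (rcosets H')"
  have "rcosets H \<subseteq> (\<lambda>X. H <#> X) ` (rcosets H')"
  proof
    fix Y assume "Y \<in> rcosets H"
    then obtain x where x: "x \<in> carrier G" "Y = H #> x" by (auto simp: RCOSETS_def)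
    have "H <#> (H' #> x) = H #> x"
    proof (intro equalityI subsetI)
      fix z assume "z \<in> H <#> (H' #> x)"
      then obtain h h' where h: "h \<in> H" "h' \<in> H'" "z = h \<otimes> (h' \<otimes> x)" by (auto simp: set_mult_def r_coset_def)
      then have "z = (h \<otimes> h') \<otimes> x" using x subgroup.mem_carrier[OF H] subgroup.mem_carrier[OF H'] by (simp add: m_assoc)
      moreover have "h \<otimes> h' \<in> H" using h sub subgroup.m_closed[OF H] by blast
      ultimately show "z \<in> H #> x" by (auto simp: r_coset_def)
    next
      fix z assume "z \<in> H #> x"
      then obtain h where h: "h \<in> H" "z = h \<otimes> (\<one> \<otimes> x)" using x by (auto simp: r_coset_def)
      then show "z \<in> H <#> (H' #> x)" using subgroup.one_closed[OF H'] unfolding set_mult_def r_coset_def by blast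
    qed
    then show "Y \<in> (\<lambda>X. H <#> X) ` (rcosets H')" using x by (auto simp: RCOSETS_def)
  qed
  then show False using fin inf finite_subset by blast
qed

lemma open_Sub_inf_neighbourhood:
  assumes U: "openin (Sub_inf G) U" and H0: "H0 \<in> U"
  shows "\<exists>F. finite F \<and> F \<subseteq> carrier G \<and> subgroup H0 G \<and> infinite (rcosets H0) \<and>
    (\<forall>H. subgroup H G \<longrightarrow> infinite (rcosets H) \<longrightarrow> H \<inter> F = H0 \<inter> F \<longrightarrow> H \<in> U)"
proof -
  let ?f = "\<lambda>H. \<lambda>g\<in>carrier G. g \<in> H"
  obtain T where T: "openin (Sub G) T" "U = T \<inter> {H. subgroup H G \<and> infinite (rcosets H)}"
    using U by (auto simp: Sub_inf_def openin_subtopology)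
  obtain W where W: "openin (product_topology (\<lambda>_. discrete_topology (UNIV :: bool set)) (carrier G)) W"
      "T = ?f -` W \<inter> {H. subgroup H G}"
    using T(1) by (auto simp: Sub_def openin_pullback_topology)
  have "?f H0 \<in> W" using H0 T W by auto
  then obtain Us where Us: "finite {i \<in> carrier G. Us i \<noteq> (UNIV :: bool set)}" "?f H0 \<in> Pi\<^sub>E (carrier G) Us" "Pi\<^sub>E (carrier G) Us \<subseteq> W"
    using W(1) unfolding openin_product_topology_alt by auto
  let ?F = "{i \<in> carrier G. Us i \<noteq> UNIV}"
  have "H \<in> U" if H: "subgroup H G" "infinite (rcosets H)" "H \<inter> ?F = H0 \<inter> ?F" for H
  proof -
    have "(i \<in> H) \<in> Us i" if i: "i \<in> carrier G" for i
    proof (cases "Us i = UNIV")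
      case False
      then have "i \<in> H \<longleftrightarrow> i \<in> H0" using H(3) i by blast
      then show ?thesis using Us(2) i by auto
    qed auto
    then have "?f H \<in> Pi\<^sub>E (carrier G) Us" by auto
    then have "?f H \<in> W" by (rule subsetD[OF Us(3)])
    then show ?thesis using T(2) W(2) H by simp
  qed
  then show ?thesis using Us(1) H0 T by (intro exI[of _ ?F]) auto
qed

end

section \<open>Mixing\<close>

context faithful_cut
begin

definition joint_subgroup :: "'a set \<Rightarrow> 'a set \<Rightarrow> 'a \<Rightarrow> 'a set" where
  "joint_subgroup H1 H2 \<gamma> = generate G (H1 \<union> conj_subgroup G \<gamma> H2)"

text \<open>The connected sets \<open>B1\<close> and \<open>\<gamma> B2\<close> are disjoint; they contain \<open>1\<close> and the first cut, and \<open>\<gamma>\<close> and the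
  second cut. So each cut lies on the same side of the other one as the points near it, and
  \<open>core x\<close> and \<open>\<gamma> (core y)\<close> are disjoint. Their complements are the ping-pong sets. The overlap is infinite
  because at least one of the infinite half-spaces at \<open>x K\<close> contains neither \<open>N1\<close> nor \<open>\<gamma> N2\<close>. The
  traces of \<open>H\<close> on \<open>N1\<close> and of its conjugate on \<open>N2\<close> are found by letting words act on \<open>1\<close> and
  on \<open>\<gamma>\<close>, respectively.\<close>

lemma joint_subgroup_properties:
  assumes e1: "envelope H1 N1" and e2: "envelope H2 N2"
    and x: "separates H1 N1 x" and y: "separates H2 N2 y"
    and \<gamma>: "\<gamma> \<in> V" "\<gamma> \<notin> core x" "inv \<gamma> \<notin> core y"
    and B1: "conn B1" "\<one> \<in> B1" "x <# K \<subseteq> B1" and B2: "conn B2" "\<one> \<in> B2" "y <# K \<subseteq> B2"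
    and far: "B1 \<inter> (\<gamma> <# B2) = {}"
  defines "H \<equiv> joint_subgroup H1 H2 \<gamma>"
  shows "subgroup H G" "infinite (rcosets H)" "H \<inter> N1 = H1" "conj_subgroup G (inv \<gamma>) H \<inter> N2 = H2"
proof -
  let ?H2 = "conj_subgroup G \<gamma> H2"
  let ?C1 = "core x" and ?C2 = "\<gamma> <# core y"
  have xV: "x \<in> V" and yV: "y \<in> V" using x y by (auto simp: separates_def)
  have H1: "subgroup H1 G" and H2: "subgroup H2 G" using e1 e2 by (auto simp: envelope_def)
  note H1V = subgroup.subset[OF H1] and H2V = subgroup.subset[OF H2]
  have H2': "subgroup ?H2 G" using subgroup_conj_subgroup[OF H2 \<gamma>(1)] .
  have H2'V: "?H2 \<subseteq> V" using subgroup.subset[OF H2'] .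
  show H: "subgroup H G" unfolding H_def joint_subgroup_def
    using H1V H2'V by (intro generate_is_subgroup) auto
  have one: "\<one> \<notin> x <# K" "\<one> \<notin> y <# K" using x y e1 e2 by (auto simp: separates_def envelope_def)
  have c1: "core x \<in> components_off V E (x <# K)" using core_component[OF xV one(1)] .
  have c2: "core y \<in> components_off V E (y <# K)" using core_component[OF yV one(2)] .
  have KV: "x <# K \<subseteq> V" "y <# K \<subseteq> V" using shift_K_V xV yV by auto
  have c2': "?C2 \<in> components_off V E (\<gamma> <# (y <# K))" using component_shift[OF c2 \<gamma>(1) KV(2)] .
  have c1V: "?C1 \<subseteq> V" and c2V: "core y \<subseteq> V" and c2'V: "?C2 \<subseteq> V" using component_props c1 c2 c2' by auto
  have one1: "\<one> \<in> ?C1" "\<one> \<in> core y" by (simp_all add: core_def comp_self)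
  have mem2: "z \<in> ?C2 \<longleftrightarrow> z \<in> V \<and> inv \<gamma> \<otimes> z \<in> core y" for z using c2V \<gamma>(1) by (rule mem_l_coset_iff)
  have one2: "\<one> \<notin> ?C2" using \<gamma> mem2[of \<one>] by simp
  have \<gamma>B2: "\<gamma> \<in> \<gamma> <# B2" using l_coset_memI[OF B2(2), of \<gamma>] \<gamma> by simp
  have yB2: "\<gamma> <# (y <# K) \<subseteq> \<gamma> <# B2" using B2(3) by (rule l_coset_mono)
  have "(\<gamma> <# B2) \<inter> ?C1 = {}"
  proof (rule ccontr)
    assume "(\<gamma> <# B2) \<inter> ?C1 \<noteq> {}"
    then have "\<gamma> <# B2 \<subseteq> ?C1"
      using far B1(3) \<gamma>(1) B2(1) by (intro conn_meets_component[OF _ _ c1] conn_shift) auto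
    then show False using \<gamma>B2 \<gamma> by blast
  qed
  then have dis1: "?C1 \<inter> (\<gamma> <# (y <# K)) = {}" using yB2 by blast
  have "B1 \<inter> ?C2 = {}"
  proof (rule ccontr)
    assume "B1 \<inter> ?C2 \<noteq> {}"
    then have "B1 \<subseteq> ?C2" using far yB2 B1(1) by (intro conn_meets_component[OF _ _ c2']) auto
    then show False using B1(2) one2 by blast
  qed
  then have dis2: "?C2 \<inter> (x <# K) = {}" using B1(3) by blast
  have disj: "?C1 \<inter> ?C2 = {}"
  proof (rule ccontr)
    assume "?C1 \<inter> ?C2 \<noteq> {}"
    then have "?C1 \<subseteq> ?C2" using component_props(2)[OF c1] dis1 by (intro conn_meets_component[OF _ _ c2'])
    then show False using one1 one2 by blast
  qed
  have moved: "h \<otimes> z \<in> core u" if "separates H' N' u" "envelope H' N'" "h \<in> H'" "h \<noteq> \<one>" "z \<in> V - core u" "core u \<subseteq> V" for H' N' u h z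
  proof -
    have S: "subgroup H' G" using that by (simp add: envelope_def)
    have hV: "h \<in> V" using subgroup.mem_carrier[OF S that(3)] .
    have "inv h \<noteq> \<one>" using that(4) hV by (metis inv_inv inv_one)
    then have "V - core u \<subseteq> inv h <# core u"
      using separates_moved[OF that(2,1) subgroup.m_inv_closed[OF S that(3)]] by blast
    then have "z \<in> inv h <# core u" using that(5) by blast
    then show ?thesis using mem_l_coset_iff[OF that(6), of "inv h" z] hV by simp
  qed
  interpret pp: ping_pong G H1 ?H2 "V - ?C1" "V - ?C2"
  proof (intro ping_pong.intro ping_pong_axioms.intro)
    show "(V - ?C1) \<union> (V - ?C2) = V" using disj by blast
    fix h z assume "h \<in> H1" "h \<noteq> \<one>" "z \<in> V - ?C1"
    then show "h \<otimes> z \<notin> V - ?C1" using moved[OF x e1 _ _ _ c1V] by blast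
  next
    fix k z assume k: "k \<in> ?H2" "k \<noteq> \<one>" "z \<in> V - ?C2"
    have kV: "k \<in> V" using k H2'V by blast
    have k': "inv \<gamma> \<otimes> k \<otimes> \<gamma> \<in> H2" using k mem_conj_subgroup_iff[OF H2V \<gamma>(1)] by blast
    have "inv \<gamma> \<otimes> k \<otimes> \<gamma> \<noteq> \<one>"
    proof
      assume "inv \<gamma> \<otimes> k \<otimes> \<gamma> = \<one>"
      then have "\<gamma> \<otimes> (inv \<gamma> \<otimes> k \<otimes> \<gamma>) \<otimes> inv \<gamma> = \<one>" using \<gamma> by simp
      then show False using k(2) kV \<gamma>(1) by (simp add: m_assoc mult_inv_cancel)
    qed
    moreover have "inv \<gamma> \<otimes> z \<in> V - core y" using k(3) mem2 \<gamma> by auto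
    ultimately have "(inv \<gamma> \<otimes> k \<otimes> \<gamma>) \<otimes> (inv \<gamma> \<otimes> z) \<in> core y"
      using moved[OF y e2 k' _ _ c2V] by blast
    then have "inv \<gamma> \<otimes> (k \<otimes> z) \<in> core y" using kV k(3) \<gamma>(1) by (simp add: m_assoc mult_inv_cancel)
    then show "k \<otimes> z \<notin> V - ?C2" using mem2 kV k(3) by auto
  qed (use H1 H2' in auto)
  have N1: "N1 \<subseteq> ?C1" and N2: "N2 \<subseteq> core y"
    using envelope_subset_core[OF e1] envelope_subset_core[OF e2] x y by (auto simp: separates_def)
  have gen: "generate G (?H2 \<union> H1) = H" unfolding H_def joint_subgroup_def by (simp add: Un_commute)
  show "H \<inter> N1 = H1"
  proof
    show "H1 \<subseteq> H \<inter> N1" using envelope_subgroup_subset[OF e1] unfolding H_def joint_subgroup_def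
      by (auto intro: generate.incl)
    show "H \<inter> N1 \<subseteq> H1"
    proof
      fix w assume w: "w \<in> H \<inter> N1"
      show "w \<in> H1"
      proof (rule pp.returning_element)
        show "h \<otimes> z \<in> N1" if "h \<in> H1" "z \<in> N1" for h z
          using that e1 l_coset_memI[of z N1 h] by (auto simp: envelope_def)
        show "w \<in> generate G (H1 \<union> ?H2)" "w \<otimes> \<one> \<in> N1" "\<one> \<in> N1"
          using w e1 subgroup.mem_carrier[OF H] by (auto simp: H_def joint_subgroup_def envelope_def)
      qed (use N1 in auto)
    qed
  qed
  interpret pp2: ping_pong G ?H2 H1 "V - ?C2" "V - ?C1" by (rule pp.swap)
  have conjmem: "z \<in> conj_subgroup G (inv \<gamma>) H \<longleftrightarrow> z \<in> V \<and> \<gamma> \<otimes> z \<otimes> inv \<gamma> \<in> H" for z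
    using mem_conj_subgroup_iff[OF subgroup.subset[OF H], of "inv \<gamma>"] \<gamma>(1) by simp
  show "conj_subgroup G (inv \<gamma>) H \<inter> N2 = H2"
  proof
    show "H2 \<subseteq> conj_subgroup G (inv \<gamma>) H \<inter> N2"
    proof
      fix k assume k: "k \<in> H2"
      have kV: "k \<in> V" using k H2V by blast
      have "\<gamma> \<otimes> k \<otimes> inv \<gamma> \<in> ?H2"
        using k kV \<gamma>(1) mem_conj_subgroup_iff[OF H2V \<gamma>(1)] by (simp add: m_assoc mult_inv_cancel)
      then have "\<gamma> \<otimes> k \<otimes> inv \<gamma> \<in> H" unfolding H_def joint_subgroup_def by (auto intro: generate.incl)
      then show "k \<in> conj_subgroup G (inv \<gamma>) H \<inter> N2"
        using conjmem kV k envelope_subgroup_subset[OF e2] by blast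
    qed
    show "conj_subgroup G (inv \<gamma>) H \<inter> N2 \<subseteq> H2"
    proof
      fix k assume k: "k \<in> conj_subgroup G (inv \<gamma>) H \<inter> N2"
      then have kV: "k \<in> V" and w: "\<gamma> \<otimes> k \<otimes> inv \<gamma> \<in> H" using conjmem by auto
      have "\<gamma> \<otimes> k \<otimes> inv \<gamma> \<in> ?H2"
      proof (rule pp2.returning_element)
        show "w \<otimes> z \<in> \<gamma> <# N2" if wz: "w \<in> ?H2" "z \<in> \<gamma> <# N2" for w z
        proof -
          obtain n where n: "n \<in> N2" "z = \<gamma> \<otimes> n" using wz by (auto simp: l_coset_def)
          have V: "w \<in> V" "n \<in> V" using wz H2'V n N2 c2V by auto
          have "inv \<gamma> \<otimes> w \<otimes> \<gamma> \<in> H2" using wz mem_conj_subgroup_iff[OF H2V \<gamma>(1)] by blast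
          then have "(inv \<gamma> \<otimes> w \<otimes> \<gamma>) \<otimes> n \<in> N2" using n e2 l_coset_memI[of n N2] by (auto simp: envelope_def)
          moreover have "w \<otimes> z = \<gamma> \<otimes> ((inv \<gamma> \<otimes> w \<otimes> \<gamma>) \<otimes> n)" using V n \<gamma>(1) by (simp add: m_assoc mult_inv_cancel)
          ultimately show ?thesis by (simp add: l_coset_memI)
        qed
        have "\<gamma> <# N2 \<subseteq> ?C2" using N2 by (rule l_coset_mono)
        then show "(\<gamma> <# N2) \<inter> (V - ?C2) = {}" by blast
        have "\<one> \<in> N2" using e2 by (simp add: envelope_def)
        then have "\<gamma> \<otimes> \<one> \<in> \<gamma> <# N2" by (rule l_coset_memI)
        then show "\<gamma> \<in> \<gamma> <# N2" using \<gamma> by simp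
        show "\<gamma> \<otimes> k \<otimes> inv \<gamma> \<in> generate G (?H2 \<union> H1)" using w gen by simp
        have "\<gamma> \<otimes> k \<in> \<gamma> <# N2" using k by (intro l_coset_memI) auto
        then show "(\<gamma> \<otimes> k \<otimes> inv \<gamma>) \<otimes> \<gamma> \<in> \<gamma> <# N2" using \<gamma>(1) kV by (simp add: m_assoc)
      qed (use \<gamma> in auto)
      then have "inv \<gamma> \<otimes> (\<gamma> \<otimes> k \<otimes> inv \<gamma>) \<otimes> \<gamma> \<in> H2" using mem_conj_subgroup_iff[OF H2V \<gamma>(1)] by blast
      then show "k \<in> H2" using kV \<gamma>(1) by (simp add: m_assoc mult_inv_cancel)
    qed
  qed
  have "infinite ((V - ?C1) \<inter> (V - ?C2))"
  proof -
    obtain C where C: "C \<in> components_off V E (x <# K)" "?C2 \<subseteq> C"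
      using conn_in_component[OF component_props(2)[OF c2'] dis2] component_props(3)[OF c2'] by blast
    have "card {inv x <# ?C1, inv x <# C} < 4" by (simp add: card_insert_if)
    then obtain i where i: "i \<in> I" "i \<noteq> inv x <# ?C1" "i \<noteq> inv x <# C"
      using other_component[of "{inv x <# ?C1, inv x <# C}"] by auto
    have iV: "i \<subseteq> V" using I_V i by blast
    have cancel: "inv x <# (x <# i) = i" using l_coset_inv_cancel[OF iV xV] by simp
    have xi: "x <# i \<in> components_off V E (x <# K)" using component_shift[OF I_comps[OF i(1)] xV K_V] .
    have "x <# i \<noteq> ?C1" "x <# i \<noteq> C" using i cancel by auto
    then have "(x <# i) \<inter> ?C1 = {}" "(x <# i) \<inter> C = {}" using component_disjoint[OF xi] c1 C by blast+
    then have "x <# i \<subseteq> (V - ?C1) \<inter> (V - ?C2)" using C component_props(4)[OF xi] by blast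
    moreover have "infinite (x <# i)" using infinite_l_coset xV iV I_inf i by blast
    ultimately show ?thesis using finite_subset by blast
  qed
  then show "infinite (rcosets H)" unfolding H_def joint_subgroup_def by (rule pp.infinite_index)
qed

end

locale cut_walk = faithful_cut G S K + walk G \<mu> for G (structure) and S K \<mu>
begin

text \<open>The set of bad endpoints is contained in \<open>core x\<close> for each \<open>x\<close> in \<open>R\<close>. For each start \<open>y\<close>, the set \<open>R\<close> contains a
  separating cut \<open>y c K\<close> with \<open>c\<close> from a fixed finite set, and one of the half-spaces at this cut is
  disjoint from its core. Hence the bad set, seen from \<open>y\<close>, lies in the complement of one of
  finitely many half-spaces.\<close>

lemma separated_with_high_probability:
  assumes e: "envelope H (H <#> Q)" and Q: "finite Q" "Q \<subseteq> V" and inf: "infinite (rcosets H)" and \<epsilon>: "\<epsilon> > 0"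
  shows "\<exists>R n0. finite R \<and> (\<forall>x\<in>R. separates H (H <#> Q) x) \<and>
    (\<forall>n\<ge>n0. measure_pmf.prob (conv_pow G \<mu> n) {\<gamma> \<in> V. \<forall>x\<in>R. \<gamma> \<in> core x} \<le> \<epsilon>)"
proof -
  let ?N = "H <#> Q"
  obtain C where C: "finite C" "C \<subseteq> V" "\<forall>p\<in>V. \<exists>c\<in>C. separates H ?N (p \<otimes> c)"
    using separating_cuts_nearby[OF e inf Q] by blast
  obtain D1 D2 where D: "D1 \<in> I" "D2 \<in> I" "D1 \<noteq> D2" by (rule two_components)
  define \<X> where "\<X> = (\<lambda>(c, D). V - (c <# D)) ` (C \<times> {D1, D2})"
  have "finite \<X>" using C by (simp add: \<X>_def)
  moreover have "\<forall>X\<in>\<X>. spread X"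
  proof
    fix X assume "X \<in> \<X>"
    then obtain c D where cD: "c \<in> C" "D \<in> I" "X = V - (c <# D)" using D by (auto simp: \<X>_def)
    then have "X = c <# (V - D)" using l_coset_Diff[OF I_V[OF cD(2)], of c] C by auto
    then show "spread X" using spread_shift[OF spread_compl_component[OF cD(2)], of c] cD C by auto
  qed
  ultimately have "\<exists>Y n0. finite Y \<and> Y \<subseteq> V \<and>
      (\<forall>F. (\<forall>y\<in>Y. \<exists>X\<in>\<X>. {g \<in> V. y \<otimes> g \<in> F} \<subseteq> X) \<longrightarrow> (\<forall>n\<ge>n0. measure_pmf.prob (conv_pow G \<mu> n) F \<le> \<epsilon>))"
    using \<epsilon> by (rule walk_escapes)
  then obtain Y n0 where Y: "finite Y" "Y \<subseteq> V"
    "\<forall>F. (\<forall>y\<in>Y. \<exists>X\<in>\<X>. {g \<in> V. y \<otimes> g \<in> F} \<subseteq> X) \<longrightarrow> (\<forall>n\<ge>n0. measure_pmf.prob (conv_pow G \<mu> n) F \<le> \<epsilon>)"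
    by (elim exE conjE) (rule that)
  define R where "R = {x \<in> (\<lambda>(y, c). y \<otimes> c) ` (Y \<times> C). separates H ?N x}"
  let ?F = "{\<gamma> \<in> V. \<forall>x\<in>R. \<gamma> \<in> core x}"
  have "\<exists>X\<in>\<X>. {g \<in> V. y \<otimes> g \<in> ?F} \<subseteq> X" if y: "y \<in> Y" for y
  proof -
    have yV: "y \<in> V" using y Y by auto
    obtain c where c: "c \<in> C" "separates H ?N (y \<otimes> c)" using C yV by blast
    have cV: "c \<in> V" using c C by auto
    define x where "x = y \<otimes> c"
    have xV: "x \<in> V" using yV cV by (simp add: x_def)
    have "x \<in> R" using y c by (auto simp: R_def x_def)
    have "\<one> \<notin> x <# K" using c(2) e by (auto simp: separates_def envelope_def x_def)
    then have core: "core x \<in> components_off V E (x <# K)" using core_component xV by blast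
    have "x <# D1 \<noteq> x <# D2"
    proof
      assume "x <# D1 = x <# D2"
      then have "inv x <# (x <# D1) = inv x <# (x <# D2)" by simp
      then show False using D I_V xV by (simp add: l_coset_inv_cancel)
    qed
    then obtain D where D': "D \<in> {D1, D2}" "x <# D \<noteq> core x" by auto
    then have DI: "D \<in> I" using D by auto
    have "x <# D \<in> components_off V E (x <# K)" using component_shift[OF I_comps[OF DI] xV K_V] .
    then have dis: "(x <# D) \<inter> core x = {}" using component_disjoint[OF _ core] D' by blast
    have "{g \<in> V. y \<otimes> g \<in> ?F} \<subseteq> V - (c <# D)"
    proof
      fix g assume g: "g \<in> {g \<in> V. y \<otimes> g \<in> ?F}"
      then have "y \<otimes> g \<in> core x" using \<open>x \<in> R\<close> by blast
      moreover have "y \<otimes> g \<in> x <# D" if "g \<in> c <# D"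
      proof -
        have "y <# (c <# D) = x <# D" using yV cV I_V[OF DI] by (simp add: lcos_m_assoc x_def)
        then show ?thesis using l_coset_memI[OF that, of y] by simp
      qed
      ultimately show "g \<in> V - (c <# D)" using dis g by blast
    qed
    moreover have "V - (c <# D) \<in> \<X>" using c D' by (auto simp: \<X>_def)
    ultimately show ?thesis by blast
  qed
  then have "\<forall>n\<ge>n0. measure_pmf.prob (conv_pow G \<mu> n) ?F \<le> \<epsilon>" using Y(3) by blast
  moreover have "finite R" using Y C by (simp add: R_def)
  ultimately show ?thesis by (intro exI[of _ R] exI[of _ n0]) (auto simp: R_def)
qed

lemma cut_walk_inverse: "cut_walk G S K (map_pmf (\<lambda>g. inv g) \<mu>)"
  by (intro cut_walk.intro faithful_cut_axioms inverse_walk)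

text \<open>The subgroup generated by \<open>H \<inter> F\<close> has the same trace on \<open>F\<close>, and it has an envelope.\<close>

lemma finitely_generated_approximation:
  assumes H: "subgroup H G" "infinite (rcosets H)" and F: "finite F" "F \<subseteq> V"
  shows "\<exists>H' Q. finite Q \<and> Q \<subseteq> V \<and> F \<subseteq> H' <#> Q \<and> envelope H' (H' <#> Q) \<and>
    infinite (rcosets H') \<and> H' \<inter> F = H \<inter> F"
proof -
  let ?H = "generate G (H \<inter> F)"
  obtain Q where Q: "finite Q" "conn Q" "\<one> \<in> Q" "F \<subseteq> Q" using finite_conn_superset[OF F] by blast
  have QV: "Q \<subseteq> V" using Q conn_V by auto
  have e: "envelope ?H (?H <#> Q)" using Q F by (intro envelope_exists) auto
  then have H': "subgroup ?H G" by (simp add: envelope_def)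
  have sub: "?H \<subseteq> H" using H by (intro generate_subgroup_incl) auto
  have "?H \<inter> F = H \<inter> F" using sub by (auto intro: generate.incl)
  moreover have "infinite (rcosets ?H)" using infinite_index_mono[OF H(1) H' sub H(2)] .
  moreover have "F \<subseteq> ?H <#> Q"
  proof
    fix f assume "f \<in> F"
    then have "f = \<one> \<otimes> f" "f \<in> Q" using F Q by auto
    then show "f \<in> ?H <#> Q" using generate.one[of G "H \<inter> F"] unfolding set_mult_def by blast
  qed
  ultimately show ?thesis using Q QV e by blast
qed

lemma cuts_in_ball:
  assumes "finite R" "R \<subseteq> V"
  shows "\<exists>B. finite B \<and> conn B \<and> \<one> \<in> B \<and> (\<forall>x\<in>R. x <# K \<subseteq> B)"
proof -
  have "finite (\<Union>x\<in>R. x <# K)" "(\<Union>x\<in>R. x <# K) \<subseteq> V"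
    using assms K_fin shift_K_V by (auto simp: finite_l_coset)
  from finite_conn_superset[OF this] show ?thesis by (simp add: UN_subset_iff)
qed

lemma mixing: "topologically_mixing G \<mu> (conj_subgroup G) (Sub_inf G)"
  unfolding topologically_mixing_def
proof (intro allI impI, elim conjE)
  fix U W assume U: "openin (Sub_inf G) U" "U \<noteq> {}" and W: "openin (Sub_inf G) W" "W \<noteq> {}"
  let ?good = "{g \<in> V. conj_subgroup G g ` U \<inter> W \<noteq> {}}"
  obtain H1' where H1': "H1' \<in> U" using U by auto
  obtain F1 where F1: "finite F1" "F1 \<subseteq> V" "subgroup H1' G" "infinite (rcosets H1')"
      "\<forall>H. subgroup H G \<longrightarrow> infinite (rcosets H) \<longrightarrow> H \<inter> F1 = H1' \<inter> F1 \<longrightarrow> H \<in> U"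
    using open_Sub_inf_neighbourhood[OF U(1) H1'] by (elim exE conjE) (rule that)
  obtain H2' where H2': "H2' \<in> W" using W by auto
  obtain F2 where F2: "finite F2" "F2 \<subseteq> V" "subgroup H2' G" "infinite (rcosets H2')"
      "\<forall>H. subgroup H G \<longrightarrow> infinite (rcosets H) \<longrightarrow> H \<inter> F2 = H2' \<inter> F2 \<longrightarrow> H \<in> W"
    using open_Sub_inf_neighbourhood[OF W(1) H2'] by (elim exE conjE) (rule that)
  obtain H1 Q1 where H1: "finite Q1" "Q1 \<subseteq> V" "F1 \<subseteq> H1 <#> Q1" "envelope H1 (H1 <#> Q1)"
      "infinite (rcosets H1)" "H1 \<inter> F1 = H1' \<inter> F1"
    using finitely_generated_approximation[OF F1(3,4,1,2)] by (elim exE conjE) (rule that)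
  obtain H2 Q2 where H2: "finite Q2" "Q2 \<subseteq> V" "F2 \<subseteq> H2 <#> Q2" "envelope H2 (H2 <#> Q2)"
      "infinite (rcosets H2)" "H2 \<inter> F2 = H2' \<inter> F2"
    using finitely_generated_approximation[OF F2(3,4,1,2)] by (elim exE conjE) (rule that)
  interpret inv_walk: cut_walk G S K "map_pmf (\<lambda>g. inv g) \<mu>" by (rule cut_walk_inverse)
  have bound: "\<exists>n0. \<forall>n\<ge>n0. 1 - 3 * \<epsilon> \<le> measure_pmf.prob (conv_pow G \<mu> n) ?good" if \<epsilon>: "\<epsilon> > 0" for \<epsilon>
  proof -
    obtain R1 n1 where R1: "finite R1" "\<forall>x\<in>R1. separates H1 (H1 <#> Q1) x"
      "\<forall>n\<ge>n1. measure_pmf.prob (conv_pow G (map_pmf (\<lambda>g. inv g) \<mu>) n) {\<gamma> \<in> V. \<forall>x\<in>R1. \<gamma> \<in> core x} \<le> \<epsilon>"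
      using inv_walk.separated_with_high_probability[OF H1(4,1,2,5) \<epsilon>] by (elim exE conjE) (rule that)
    obtain R2 n2 where R2: "finite R2" "\<forall>y\<in>R2. separates H2 (H2 <#> Q2) y"
      "\<forall>n\<ge>n2. measure_pmf.prob (conv_pow G \<mu> n) {\<gamma> \<in> V. \<forall>x\<in>R2. \<gamma> \<in> core x} \<le> \<epsilon>"
      using separated_with_high_probability[OF H2(4,1,2,5) \<epsilon>] by (elim exE conjE) (rule that)
    have RV: "R1 \<subseteq> V" "R2 \<subseteq> V" using R1 R2 by (auto simp: separates_def)
    obtain B1 where B1: "finite B1" "conn B1" "\<one> \<in> B1" "\<forall>x\<in>R1. x <# K \<subseteq> B1" using cuts_in_ball[OF R1(1) RV(1)] by (elim exE conjE) (rule that)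
    obtain B2 where B2: "finite B2" "conn B2" "\<one> \<in> B2" "\<forall>x\<in>R2. x <# K \<subseteq> B2" using cuts_in_ball[OF R2(1) RV(2)] by (elim exE conjE) (rule that)
    have BV: "B1 \<subseteq> V" "B2 \<subseteq> V" using B1 B2 conn_V by auto
    \<comment> \<open>With \<open>\<gamma> = g\<inverse>\<close>: no cut in \<open>R1\<close> separates \<open>\<gamma>\<close> from \<open>H1\<close>, no cut in \<open>R2\<close> separates \<open>\<gamma>\<inverse>\<close> from \<open>H2\<close>, and
      \<open>\<gamma>\<close> is too close for the two cuts to be disjoint.\<close>
    let ?bad1 = "{g. inv g \<in> {\<gamma> \<in> V. \<forall>x\<in>R1. \<gamma> \<in> core x}}"
    let ?bad2 = "{g \<in> V. \<forall>x\<in>R2. g \<in> core x}"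
    let ?bad3 = "{g \<in> V. (g <# B1) \<inter> B2 \<noteq> {}}"
    obtain D1 D2 where D: "D1 \<in> I" "D2 \<in> I" "D1 \<noteq> D2" by (rule two_components)
    have "(V - D1) \<union> (V - D2) = V" using I_disjoint[OF D] by blast
    moreover have "finite ?bad3" using finite_translates_meeting B1 B2 BV by blast
    ultimately obtain n3 where n3: "\<forall>n\<ge>n3. measure_pmf.prob (conv_pow G \<mu> n) ?bad3 \<le> \<epsilon>"
      using finite_set_escapes[OF spread_compl_component[OF D(1)] spread_compl_component[OF D(2)] _ _ \<epsilon>] by blast
    have good: "g \<in> ?good" if g: "g \<in> V" "g \<notin> ?bad1" "g \<notin> ?bad2" "g \<notin> ?bad3" for g
    proof -
      let ?\<gamma> = "inv g"
      obtain x where x: "x \<in> R1" "?\<gamma> \<notin> core x" using g by auto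
      obtain y where y: "y \<in> R2" "g \<notin> core y" using g by auto
      have "(g <# B1) \<inter> B2 = {}" using g by blast
      then have far: "B1 \<inter> (?\<gamma> <# B2) = {}" using l_coset_disjoint_move[OF BV g(1)] by blast
      let ?H = "joint_subgroup H1 H2 ?\<gamma>"
      have \<gamma>: "?\<gamma> \<in> V" "inv ?\<gamma> \<notin> core y" using g y by auto
      have xs: "separates H1 (H1 <#> Q1) x" "x <# K \<subseteq> B1" and ys: "separates H2 (H2 <#> Q2) y" "y <# K \<subseteq> B2"
        using x y R1 R2 B1 B2 by auto
      note props = joint_subgroup_properties[OF H1(4) H2(4) xs(1) ys(1) \<gamma>(1) x(2) \<gamma>(2) B1(2,3) xs(2) B2(2,3) ys(2) far]
      have "?H \<inter> F1 = H1 \<inter> F1" using props(3) H1(3) by blast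
      then have "?H \<in> U" using F1(5) props(1,2) H1(6) by simp
      moreover have "conj_subgroup G g ?H \<in> W"
      proof -
        have "conj_subgroup G g ?H \<inter> (H2 <#> Q2) = H2" using props(4) g by simp
        then have "conj_subgroup G g ?H \<inter> F2 = H2 \<inter> F2" using H2(3) by blast
        then show ?thesis using F2(5) H2(6) subgroup_conj_subgroup[OF props(1) g(1)]
            infinite_index_conj_subgroup[OF props(1) g(1) props(2)] by simp
      qed
      ultimately show ?thesis using g by blast
    qed
    have "1 - 3 * \<epsilon> \<le> measure_pmf.prob (conv_pow G \<mu> n) ?good" if n: "n \<ge> n1 + n2 + n3" for n
    proof -
      let ?M = "measure_pmf (conv_pow G \<mu> n)"
      have 1: "measure ?M ?bad1 \<le> \<epsilon>"
        using R1(3)[rule_format, of n] n unfolding conv_pow_inverse by (simp add: vimage_def)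
      have 2: "measure ?M ?bad2 \<le> \<epsilon>" using R2(3) n by simp
      have 3: "measure ?M ?bad3 \<le> \<epsilon>" using n3 n by simp
      have "1 = measure ?M (set_pmf (conv_pow G \<mu> n))" by (simp add: measure_pmf.prob_eq_1 AE_measure_pmf)
      also have "\<dots> \<le> measure ?M (?good \<union> (?bad1 \<union> (?bad2 \<union> ?bad3)))"
      proof (rule measure_pmf.finite_measure_mono)
        show "set_pmf (conv_pow G \<mu> n) \<subseteq> ?good \<union> (?bad1 \<union> (?bad2 \<union> ?bad3))"
        proof
          fix g assume "g \<in> set_pmf (conv_pow G \<mu> n)"
          then have "g \<in> V" using step_set_V by blast
          then show "g \<in> ?good \<union> (?bad1 \<union> (?bad2 \<union> ?bad3))" using good by (meson UnCI)
        qed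
      qed simp
      also have "\<dots> \<le> measure ?M ?good + measure ?M (?bad1 \<union> (?bad2 \<union> ?bad3))"
        by (rule measure_Un_le) auto
      also have "measure ?M (?bad1 \<union> (?bad2 \<union> ?bad3)) \<le> measure ?M ?bad1 + measure ?M (?bad2 \<union> ?bad3)"
        by (rule measure_Un_le) auto
      also have "measure ?M (?bad2 \<union> ?bad3) \<le> measure ?M ?bad2 + measure ?M ?bad3"
        by (rule measure_Un_le) auto
      finally show ?thesis using 1 2 3 by linarith
    qed
    then show ?thesis by blast
  qed
  show "(\<lambda>n. measure_pmf.prob (conv_pow G \<mu> n) ?good) \<longlonglongrightarrow> 1"
  proof (rule LIMSEQ_I)
    fix r :: real assume r: "0 < r"
    obtain n0 where n0: "\<forall>n\<ge>n0. 1 - 3 * (r / 4) \<le> measure_pmf.prob (conv_pow G \<mu> n) ?good"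
      using bound[of "r / 4"] r by auto
    have "norm (measure_pmf.prob (conv_pow G \<mu> n) ?good - 1) < r" if "n \<ge> n0" for n
      using n0[rule_format, OF that] measure_pmf.prob_le_1[of "conv_pow G \<mu> n" ?good] r
      unfolding real_norm_def by linarith
    then show "\<exists>n0. \<forall>n\<ge>n0. norm (measure_pmf.prob (conv_pow G \<mu> n) ?good - 1) < r" by blast
  qed
qed

end

theorem corollary1p6:
  fixes G :: "('a, 'b) monoid_scheme" and \<mu> :: "'a pmf"
  assumes "group G"
    and "finitely_generated G"
    and "infinitely_many_ends G"
    and "\<And>N. N \<lhd> G \<Longrightarrow> finite N \<Longrightarrow> N = {\<one>\<^bsub>G\<^esub>}"
    and "\<mu> \<in> Prob G"
    and "finite (set_pmf \<mu>)"
    and "set_inv\<^bsub>G\<^esub> (set_pmf \<mu>) = set_pmf \<mu>"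
    and "generate G (set_pmf \<mu>) = carrier G"
  shows "topologically_mixing G \<mu> (conj_subgroup G) (Sub_inf G)"
proof -
  obtain S where S: "finite S" "S \<subseteq> carrier G" "generate G S = carrier G"
      "infinite (ends (carrier G) (cayley_edges G S))"
    using assms(3) by (auto simp: infinitely_many_ends_def)
  interpret cayley_graph G S
    by (intro cayley_graph.intro cayley_graph_axioms.intro assms(1) S)
  obtain K \<D> where K: "finite K" "conn K" "\<one>\<^bsub>G\<^esub> \<in> K" "\<D> \<subseteq> inf_comps K" "card \<D> = 4"
    using infinite_ends_cut[OF S(4), of 4] by blast
  interpret faithful_cut G S K
  proof (intro faithful_cut.intro cut.intro cut_axioms.intro faithful_cut_axioms.intro cayley_graph_axioms)
    show "\<exists>\<D>\<subseteq>inf_comps K. card \<D> = 4" using K by blast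
  qed (use K assms(4) in auto)
  interpret walk G \<mu>
  proof (intro walk.intro walk_axioms.intro assms(1))
    show "inv\<^bsub>G\<^esub> s \<in> set_pmf \<mu>" if "s \<in> set_pmf \<mu>" for s
    proof -
      have "inv\<^bsub>G\<^esub> s \<in> set_inv\<^bsub>G\<^esub> (set_pmf \<mu>)" using that by (auto simp: SET_INV_def)
      then show ?thesis using assms(7) by simp
    qed
  qed (use assms in \<open>auto simp: Prob_def\<close>)
  interpret cut_walk G S K \<mu>
    by (intro cut_walk.intro faithful_cut_axioms walk_axioms)
  show ?thesis by (rule mixing)
qed

end
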